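(* Let $X$ be a scheme and let $\mathrm{cl}$ be a glueable preclosure operation on ideals over $X$. Let $\mathcal{I}$ be a quasi-coherent sheaf of $\mathcal{O}_X$-ideals. Then: (1) For every open set $U\subseteq X$ and every $s\in\mathcal{O}_X(U)$, we have $s\in\mathcal{I}^{\mathrm{cl}}(U)$ if and only if $s|_V\in\mathcal{I}(V)^{\mathrm{cl}}$ in $\mathcal{O}_X(V)$ for all affine open subsets $V$ of $U$. (2) For every affine open subset $V$ of $X$, $\mathcal{I}^{\mathrm{cl}}(V)=\mathcal{I}(V)^{\mathrm{cl}}$ in $\mathcal{O}_X(V)$. (3) $\mathcal{I}^{\mathrm{cl}}$ is unique with respect to this property: if $\mathcal{F}$ is a sheaf of $\mathcal{O}_X$-ideals such that $\mathcal{F}(V)=\mathcal{I}(V)^{\mathrm{cl}}$ for all affine open subsets $V$ of $X$, then $\mathcal{F}=\mathcal{I}^{\mathrm{cl}}$.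
   Context: All rings are commutative with $1$. A preclosure operation on a poset is an extensive ($s\le s^{\mathrm{cl}}$) and order-preserving self-map. A preclosure operation $\mathrm{cl}$ on ideals over a scheme $X$ gives, for every affine open $U\subseteq X$, a preclosure operation $I\mapsto I^{\mathrm{cl}}$ on the ideals of $\mathcal{O}_X(U)$. For $U=\operatorname{Spec}R$ and $f\in R$, $R_f$ is identified with $\mathcal{O}_X(D(f))$. Openly persistent over $X$: for all affine opens $V\subseteq U\subseteq X$ with restriction map $\varphi:R=\mathcal{O}_X(U)\to S=\mathcal{O}_X(V)$, every ideal $I$ of $R$ and every $x\in I^{\mathrm{cl}}$, we have $\varphi(x)\in(IS)^{\mathrm{cl}}$. Glueable over $X$: $\mathrm{cl}$ is openly persistent over $X$ and for every affine open $\operatorname{Spec}R\subseteq X$: whenever $I$ is an ideal of $R$ with generating set $(f_\alpha)_{\alpha\in A}$, $g\in\sqrt I$, $J$ is an ideal of $R$, and $z\in R$ satisfies $z/1\in(J_{f_\alpha})^{\mathrm{cl}}$ in $R_{f_\alpha}$ for all $\alpha\in A$, it follows that $z/1\in(J_g)^{\mathrm{cl}}$ in $R_g$. Sheaf $\mathcal{I}^{\mathrm{cl}}$: for $U\subseteq X$ open, $\mathcal{I}^{\mathrm{cl}}(U)$ is the set of $s\in\mathcal{O}_X(U)$ such that every $x\in U$ has an affine open neighborhood $V\subseteq U$ with $s|_V\in\mathcal{I}(V)^{\mathrm{cl}}$; for openly persistent $\mathrm{cl}$ this is a sheaf of ideals. *)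

theory Defs
  imports "HOL-Algebra.QuotRing" "HOL-Algebra.Module" "HOL-Analysis.Abstract_Topology"
begin

section \<open>Sheaves, ringed spaces, stalks\<close>

text \<open>A sheaf of sets on \<open>T\<close>: \<open>F U\<close> is the set of sections over \<open>U\<close> and \<open>r U V\<close> restricts sections
  from \<open>U\<close> to \<open>V\<close>; only the values at open sets \<open>V \<subseteq> U\<close> matter. Covers are sets of open sets; the
  empty cover of the empty set is included.\<close>

definition is_presheaf :: "'a topology \<Rightarrow> ('a set \<Rightarrow> 's set) \<Rightarrow> ('a set \<Rightarrow> 'a set \<Rightarrow> 's \<Rightarrow> 's) \<Rightarrow> bool" where
  "is_presheaf T F r \<longleftrightarrow>
     (\<forall>U V s. openin T U \<and> openin T V \<and> V \<subseteq> U \<and> s \<in> F U \<longrightarrow> r U V s \<in> F V) \<and>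
     (\<forall>U s. openin T U \<and> s \<in> F U \<longrightarrow> r U U s = s) \<and>
     (\<forall>U V W s. openin T U \<and> openin T V \<and> openin T W \<and> W \<subseteq> V \<and> V \<subseteq> U \<and> s \<in> F U \<longrightarrow>
        r V W (r U V s) = r U W s)"

definition is_sheaf :: "'a topology \<Rightarrow> ('a set \<Rightarrow> 's set) \<Rightarrow> ('a set \<Rightarrow> 'a set \<Rightarrow> 's \<Rightarrow> 's) \<Rightarrow> bool" where
  "is_sheaf T F r \<longleftrightarrow> is_presheaf T F r \<and>
     (\<forall>\<U>. (\<forall>U\<in>\<U>. openin T U) \<longrightarrow>
        (\<forall>s\<in>F (\<Union>\<U>). \<forall>t\<in>F (\<Union>\<U>). (\<forall>U\<in>\<U>. r (\<Union>\<U>) U s = r (\<Union>\<U>) U t) \<longrightarrow> s = t) \<and>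
        (\<forall>s. (\<forall>U\<in>\<U>. s U \<in> F U) \<and>
             (\<forall>U\<in>\<U>. \<forall>V\<in>\<U>. r U (U \<inter> V) (s U) = r V (U \<inter> V) (s V)) \<longrightarrow>
             (\<exists>t\<in>F (\<Union>\<U>). \<forall>U\<in>\<U>. r (\<Union>\<U>) U t = s U)))"

record ('a, 'r) ringed_space =
  Top :: "'a topology"
  Sec :: "'a set \<Rightarrow> 'r ring"
  Res :: "'a set \<Rightarrow> 'a set \<Rightarrow> 'r \<Rightarrow> 'r"

definition is_ringed_space :: "('a, 'r) ringed_space \<Rightarrow> bool" where
  "is_ringed_space X \<longleftrightarrow>
     (\<forall>U. openin (Top X) U \<longrightarrow> cring (Sec X U)) \<and>
     (\<forall>U V. openin (Top X) U \<and> openin (Top X) V \<and> V \<subseteq> U \<longrightarrow>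
        Res X U V \<in> ring_hom (Sec X U) (Sec X V)) \<and>
     is_sheaf (Top X) (\<lambda>U. carrier (Sec X U)) (Res X)"

definition open_subspace :: "('a, 'r) ringed_space \<Rightarrow> 'a set \<Rightarrow> ('a, 'r) ringed_space" where
  "open_subspace X U = \<lparr>Top = subtopology (Top X) U, Sec = Sec X, Res = Res X\<rparr>"

text \<open>The germ at \<open>x\<close> of a section \<open>s\<close> over \<open>U\<close>, as the class of all pairs that agree with \<open>(U, s)\<close>
  near \<open>x\<close>. In the ring operations on the stalk, the union over all representatives is a union of
  copies of one and the same class.\<close>

definition germ :: "('a, 'r) ringed_space \<Rightarrow> 'a \<Rightarrow> 'a set \<Rightarrow> 'r \<Rightarrow> ('a set \<times> 'r) set" where
  "germ X x U s = {(V, t). openin (Top X) V \<and> x \<in> V \<and> t \<in> carrier (Sec X V) \<and>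
     (\<exists>W. openin (Top X) W \<and> x \<in> W \<and> W \<subseteq> U \<inter> V \<and> Res X U W s = Res X V W t)}"

definition stalk :: "('a, 'r) ringed_space \<Rightarrow> 'a \<Rightarrow> ('a set \<times> 'r) set ring" where
  "stalk X x =
     \<lparr>carrier = {germ X x U s | U s. openin (Top X) U \<and> x \<in> U \<and> s \<in> carrier (Sec X U)},
      mult = (\<lambda>A B. \<Union>(U, s)\<in>A. \<Union>(V, t)\<in>B.
        germ X x (U \<inter> V) (Res X U (U \<inter> V) s \<otimes>\<^bsub>Sec X (U \<inter> V)\<^esub> Res X V (U \<inter> V) t)),
      one = germ X x (topspace (Top X)) \<one>\<^bsub>Sec X (topspace (Top X))\<^esub>,
      zero = germ X x (topspace (Top X)) \<zero>\<^bsub>Sec X (topspace (Top X))\<^esub>,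
      add = (\<lambda>A B. \<Union>(U, s)\<in>A. \<Union>(V, t)\<in>B.
        germ X x (U \<inter> V) (Res X U (U \<inter> V) s \<oplus>\<^bsub>Sec X (U \<inter> V)\<^esub> Res X V (U \<inter> V) t))\<rparr>"

definition local_cring :: "('r, 'm) ring_scheme \<Rightarrow> bool" where
  "local_cring R \<longleftrightarrow> cring R \<and> (\<exists>!M. maximalideal M R)"

definition locally_ringed_space :: "('a, 'r) ringed_space \<Rightarrow> bool" where
  "locally_ringed_space X \<longleftrightarrow>
     is_ringed_space X \<and> (\<forall>x\<in>topspace (Top X). local_cring (stalk X x))"

definition preim :: "('a, 'r) ringed_space \<Rightarrow> ('a \<Rightarrow> 'b) \<Rightarrow> 'b set \<Rightarrow> 'a set" where
  "preim X \<phi> W = {x \<in> topspace (Top X). \<phi> x \<in> W}"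

text \<open>An isomorphism of ringed spaces: a homeomorphism with a compatible family of ring isomorphisms
  \<open>\<psi> W\<close> from the sections over \<open>W\<close> to the sections over the preimage of \<open>W\<close>. The induced maps on
  stalks are then isomorphisms, hence local homomorphisms, so for locally ringed spaces this is an
  isomorphism of locally ringed spaces.\<close>

definition ringed_space_iso ::
  "('a, 'r) ringed_space \<Rightarrow> ('b, 's) ringed_space \<Rightarrow> ('a \<Rightarrow> 'b) \<Rightarrow> ('b set \<Rightarrow> 's \<Rightarrow> 'r) \<Rightarrow> bool" where
  "ringed_space_iso X Y \<phi> \<psi> \<longleftrightarrow>
     homeomorphic_map (Top X) (Top Y) \<phi> \<and>
     (\<forall>W. openin (Top Y) W \<longrightarrow> \<psi> W \<in> ring_iso (Sec Y W) (Sec X (preim X \<phi> W))) \<and>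
     (\<forall>W W' s. openin (Top Y) W \<and> openin (Top Y) W' \<and> W' \<subseteq> W \<and> s \<in> carrier (Sec Y W) \<longrightarrow>
        \<psi> W' (Res Y W W' s) = Res X (preim X \<phi> W) (preim X \<phi> W') (\<psi> W s))"


section \<open>Localization\<close>

definition ideal_as_module :: "('r, 'm) ring_scheme \<Rightarrow> 'r set \<Rightarrow> ('r, 'r) module" where
  "ideal_as_module R I = \<lparr>carrier = I, mult = mult R, one = one R, zero = zero R, add = add R,
     smult = mult R\<rparr>"

abbreviation self_module :: "('r, 'm) ring_scheme \<Rightarrow> ('r, 'r) module" where
  "self_module R \<equiv> ideal_as_module R (carrier R)"

text \<open>The fraction \<open>m / s\<close> in the localization of an \<open>R\<close>-module \<open>M\<close> at a multiplicative set \<open>S\<close> of \<open>R\<close>,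
  as an equivalence class of pairs.\<close>

definition frac :: "('r, 'm) module \<Rightarrow> 'r set \<Rightarrow> 'm \<Rightarrow> 'r \<Rightarrow> ('m \<times> 'r) set" where
  "frac M S m s = {(m', s'). m' \<in> carrier M \<and> s' \<in> S \<and>
     (\<exists>u\<in>S. u \<odot>\<^bsub>M\<^esub> (s' \<odot>\<^bsub>M\<^esub> m) = u \<odot>\<^bsub>M\<^esub> (s \<odot>\<^bsub>M\<^esub> m'))}"

definition loc_ring :: "'r ring \<Rightarrow> 'r set \<Rightarrow> ('r \<times> 'r) set ring" where
  "loc_ring R S =
     \<lparr>carrier = {frac (self_module R) S a s | a s. a \<in> carrier R \<and> s \<in> S},
      mult = (\<lambda>A B. \<Union>(a, s)\<in>A. \<Union>(b, t)\<in>B. frac (self_module R) S (a \<otimes>\<^bsub>R\<^esub> b) (s \<otimes>\<^bsub>R\<^esub> t)),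
      one = frac (self_module R) S \<one>\<^bsub>R\<^esub> \<one>\<^bsub>R\<^esub>,
      zero = frac (self_module R) S \<zero>\<^bsub>R\<^esub> \<one>\<^bsub>R\<^esub>,
      add = (\<lambda>A B. \<Union>(a, s)\<in>A. \<Union>(b, t)\<in>B.
        frac (self_module R) S ((t \<otimes>\<^bsub>R\<^esub> a) \<oplus>\<^bsub>R\<^esub> (s \<otimes>\<^bsub>R\<^esub> b)) (s \<otimes>\<^bsub>R\<^esub> t))\<rparr>"

text \<open>The localization of \<open>M\<close> as a module over \<open>loc_ring R S\<close>. The fields \<open>mult\<close> and \<open>one\<close>, which the
  library's module record inherits from the ring record, have no meaning here.\<close>

definition loc_module :: "'r ring \<Rightarrow> ('r, 'm) module \<Rightarrow> 'r set \<Rightarrow> (('r \<times> 'r) set, ('m \<times> 'r) set) module" where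
  "loc_module R M S =
     \<lparr>carrier = {frac M S m s | m s. m \<in> carrier M \<and> s \<in> S},
      mult = undefined,
      one = undefined,
      zero = frac M S \<zero>\<^bsub>M\<^esub> \<one>\<^bsub>R\<^esub>,
      add = (\<lambda>A B. \<Union>(m, s)\<in>A. \<Union>(n, t)\<in>B.
        frac M S ((t \<odot>\<^bsub>M\<^esub> m) \<oplus>\<^bsub>M\<^esub> (s \<odot>\<^bsub>M\<^esub> n)) (s \<otimes>\<^bsub>R\<^esub> t)),
      smult = (\<lambda>A B. \<Union>(a, s)\<in>A. \<Union>(m, t)\<in>B. frac M S (a \<odot>\<^bsub>M\<^esub> m) (s \<otimes>\<^bsub>R\<^esub> t))\<rparr>"


section \<open>Affine schemes, schemes, quasi-coherent sheaves\<close>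

definition zariski_open :: "'r ring \<Rightarrow> 'r set set \<Rightarrow> bool" where
  "zariski_open R W \<longleftrightarrow> (\<exists>E\<subseteq>carrier R. W = {p. primeideal p R \<and> \<not> E \<subseteq> p})"

lemma istopology_zariski_open: "istopology (zariski_open R)"
  unfolding istopology_def
proof (intro conjI allI impI)
  fix S T assume "zariski_open R S" "zariski_open R T"
  then obtain E F where E: "E \<subseteq> carrier R" "S = {p. primeideal p R \<and> \<not> E \<subseteq> p}"
    and F: "F \<subseteq> carrier R" "T = {p. primeideal p R \<and> \<not> F \<subseteq> p}"
    unfolding zariski_open_def by blast
  let ?G = "{e \<otimes>\<^bsub>R\<^esub> f | e f. e \<in> E \<and> f \<in> F}"
  have iff: "(\<not> ?G \<subseteq> p) = (\<not> E \<subseteq> p \<and> \<not> F \<subseteq> p)" if p: "primeideal p R" for p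
  proof -
    interpret primeideal p R by (fact p)
    have "e \<otimes>\<^bsub>R\<^esub> f \<in> p \<longleftrightarrow> e \<in> p \<or> f \<in> p" if "e \<in> E" "f \<in> F" for e f
      using that E(1) F(1) I_prime I_l_closed I_r_closed by (meson subsetD)
    then show ?thesis by blast
  qed
  show "zariski_open R (S \<inter> T)"
  proof (cases "S \<inter> T = {}")
    case True
    then show ?thesis unfolding zariski_open_def by (intro exI[of _ "{}"]) auto
  next
    case False
    then obtain p where "primeideal p R" using E by blast
    then interpret primeideal p R .
    have "?G \<subseteq> carrier R" using E(1) F(1) by (auto intro!: m_closed)
    moreover have "S \<inter> T = {p. primeideal p R \<and> \<not> ?G \<subseteq> p}"
      unfolding E(2) F(2) using iff by blast
    ultimately show ?thesis unfolding zariski_open_def by blast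
  qed
next
  fix K assume "\<forall>W\<in>K. zariski_open R W"
  then have "\<forall>W\<in>K. \<exists>E. E \<subseteq> carrier R \<and> W = {p. primeideal p R \<and> \<not> E \<subseteq> p}"
    unfolding zariski_open_def by assumption
  from bchoice[OF this]
  obtain E where EW: "\<forall>W\<in>K. E W \<subseteq> carrier R \<and> W = {p. primeideal p R \<and> \<not> E W \<subseteq> p}" by blast
  have E: "\<And>W. W \<in> K \<Longrightarrow> E W \<subseteq> carrier R"
    and W: "\<And>W p. W \<in> K \<Longrightarrow> p \<in> W \<longleftrightarrow> primeideal p R \<and> \<not> E W \<subseteq> p"
    using EW by auto
  have "(\<Union>W\<in>K. E W) \<subseteq> carrier R" using E by (rule UN_least)
  moreover have "\<Union>K = {p. primeideal p R \<and> \<not> (\<Union>W\<in>K. E W) \<subseteq> p}"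
    by (rule Set.set_eqI, unfold Union_iff mem_Collect_eq UN_subset_iff) (metis W)
  ultimately show "zariski_open R (\<Union>K)" unfolding zariski_open_def by blast
qed

definition zariski :: "'r ring \<Rightarrow> 'r set topology" where
  "zariski R = topology (zariski_open R)"

lemma openin_zariski: "openin (zariski R) W \<longleftrightarrow> zariski_open R W"
  by (simp add: zariski_def istopology_zariski_open)

text \<open>Sections over \<open>W\<close> of the sheaf associated to \<open>M\<close> on \<open>Spec R\<close>: functions that assign to each
  prime \<open>p\<close> in \<open>W\<close> an element of the localization \<open>M\<^sub>p\<close> and are locally given by a single fraction.\<close>

definition tilde_sections :: "'r ring \<Rightarrow> ('r, 'm) module \<Rightarrow> 'r set set \<Rightarrow> ('r set \<Rightarrow> ('m \<times> 'r) set) set" where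
  "tilde_sections R M W =
     {s \<in> (\<Pi>\<^sub>E p\<in>W. carrier (loc_module R M (carrier R - p))).
        \<forall>p\<in>W. \<exists>V m f. zariski_open R V \<and> p \<in> V \<and> V \<subseteq> W \<and> m \<in> carrier M \<and> f \<in> carrier R \<and>
          (\<forall>q\<in>V. f \<notin> q \<and> s q = frac M (carrier R - q) m f)}"

definition Spec :: "'r ring \<Rightarrow> ('r set, 'r set \<Rightarrow> ('r \<times> 'r) set) ringed_space" where
  "Spec R =
     \<lparr>Top = zariski R,
      Sec = (\<lambda>W. \<lparr>carrier = tilde_sections R (self_module R) W,
        mult = (\<lambda>s t. \<lambda>p\<in>W. s p \<otimes>\<^bsub>loc_ring R (carrier R - p)\<^esub> t p),
        one = (\<lambda>p\<in>W. \<one>\<^bsub>loc_ring R (carrier R - p)\<^esub>),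
        zero = (\<lambda>p\<in>W. \<zero>\<^bsub>loc_ring R (carrier R - p)\<^esub>),
        add = (\<lambda>s t. \<lambda>p\<in>W. s p \<oplus>\<^bsub>loc_ring R (carrier R - p)\<^esub> t p)\<rparr>),
      Res = (\<lambda>W W' s. restrict s W')\<rparr>"

definition tilde :: "'r ring \<Rightarrow> ('r, 'm) module \<Rightarrow> 'r set set \<Rightarrow>
    ('r set \<Rightarrow> ('r \<times> 'r) set, 'r set \<Rightarrow> ('m \<times> 'r) set) module" where
  "tilde R M W =
     \<lparr>carrier = tilde_sections R M W,
      mult = undefined,
      one = undefined,
      zero = (\<lambda>p\<in>W. \<zero>\<^bsub>loc_module R M (carrier R - p)\<^esub>),
      add = (\<lambda>s t. \<lambda>p\<in>W. s p \<oplus>\<^bsub>loc_module R M (carrier R - p)\<^esub> t p),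
      smult = (\<lambda>a s. \<lambda>p\<in>W. a p \<odot>\<^bsub>loc_module R M (carrier R - p)\<^esub> s p)\<rparr>"

text \<open>If \<open>U\<close> is isomorphic to the spectrum of some ring, that ring is isomorphic to \<open>Sec X U\<close>; so it
  is no restriction to take \<open>R\<close> over the type of sections \<open>'r\<close>.\<close>

definition affine_open :: "('a, 'r) ringed_space \<Rightarrow> 'a set \<Rightarrow> bool" where
  "affine_open X U \<longleftrightarrow> openin (Top X) U \<and>
     (\<exists>(R :: 'r ring) \<phi> \<psi>. cring R \<and> ringed_space_iso (open_subspace X U) (Spec R) \<phi> \<psi>)"

definition scheme :: "('a, 'r) ringed_space \<Rightarrow> bool" where
  "scheme X \<longleftrightarrow> locally_ringed_space X \<and> (\<forall>x\<in>topspace (Top X). \<exists>U. affine_open X U \<and> x \<in> U)"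

text \<open>For a sheaf of modules \<open>F\<close> (with restriction maps \<open>r\<close>) on a space identified with \<open>Spec R\<close> by
  \<open>(\<phi>, \<psi>)\<close>: \<open>\<eta>\<close> is an isomorphism from the sheaf associated to \<open>M\<close> onto \<open>F\<close>, linear over \<open>\<psi>\<close>.\<close>

definition tilde_iso :: "('a, 'r) ringed_space \<Rightarrow> ('a set \<Rightarrow> ('r, 'm) module) \<Rightarrow>
    ('a set \<Rightarrow> 'a set \<Rightarrow> 'm \<Rightarrow> 'm) \<Rightarrow> 'q ring \<Rightarrow> ('a \<Rightarrow> 'q set) \<Rightarrow>
    ('q set set \<Rightarrow> ('q set \<Rightarrow> ('q \<times> 'q) set) \<Rightarrow> 'r) \<Rightarrow> ('q, 'n) module \<Rightarrow>
    ('q set set \<Rightarrow> ('q set \<Rightarrow> ('n \<times> 'q) set) \<Rightarrow> 'm) \<Rightarrow> bool" where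
  "tilde_iso X F r R \<phi> \<psi> M \<eta> \<longleftrightarrow>
     (\<forall>W. openin (zariski R) W \<longrightarrow>
        bij_betw (\<eta> W) (carrier (tilde R M W)) (carrier (F (preim X \<phi> W))) \<and>
        (\<forall>s\<in>carrier (tilde R M W). \<forall>t\<in>carrier (tilde R M W).
           \<eta> W (s \<oplus>\<^bsub>tilde R M W\<^esub> t) = \<eta> W s \<oplus>\<^bsub>F (preim X \<phi> W)\<^esub> \<eta> W t) \<and>
        (\<forall>a\<in>carrier (Sec (Spec R) W). \<forall>s\<in>carrier (tilde R M W).
           \<eta> W (a \<odot>\<^bsub>tilde R M W\<^esub> s) = \<psi> W a \<odot>\<^bsub>F (preim X \<phi> W)\<^esub> \<eta> W s)) \<and>
     (\<forall>W W' s. openin (zariski R) W \<and> openin (zariski R) W' \<and> W' \<subseteq> W \<and> s \<in> carrier (tilde R M W) \<longrightarrow>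
        \<eta> W' (restrict s W') = r (preim X \<phi> W) (preim X \<phi> W') (\<eta> W s))"

text \<open>As for \<open>affine_open\<close>, fixing the types of \<open>R\<close> and \<open>M\<close> is no restriction: \<open>M\<close> is isomorphic to the
  module of sections of \<open>F\<close> over \<open>U\<close>.\<close>

definition quasi_coherent :: "('a, 'r) ringed_space \<Rightarrow> ('a set \<Rightarrow> ('r, 'm) module) \<Rightarrow>
    ('a set \<Rightarrow> 'a set \<Rightarrow> 'm \<Rightarrow> 'm) \<Rightarrow> bool" where
  "quasi_coherent X F r \<longleftrightarrow>
     (\<forall>x\<in>topspace (Top X). \<exists>U (R :: 'r ring) \<phi> \<psi> (M :: ('r, 'm) module) \<eta>.
        openin (Top X) U \<and> x \<in> U \<and> cring R \<and>
        ringed_space_iso (open_subspace X U) (Spec R) \<phi> \<psi> \<and>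
        Module.module R M \<and> tilde_iso (open_subspace X U) F r R \<phi> \<psi> M \<eta>)"

definition sheaf_of_ideals :: "('a, 'r) ringed_space \<Rightarrow> ('a set \<Rightarrow> 'r set) \<Rightarrow> bool" where
  "sheaf_of_ideals X \<I> \<longleftrightarrow>
     (\<forall>U. openin (Top X) U \<longrightarrow> ideal (\<I> U) (Sec X U)) \<and> is_sheaf (Top X) \<I> (Res X)"

definition quasi_coherent_ideals :: "('a, 'r) ringed_space \<Rightarrow> ('a set \<Rightarrow> 'r set) \<Rightarrow> bool" where
  "quasi_coherent_ideals X \<I> \<longleftrightarrow>
     sheaf_of_ideals X \<I> \<and> quasi_coherent X (\<lambda>U. ideal_as_module (Sec X U) (\<I> U)) (Res X)"


section \<open>Preclosure operations on ideals over a scheme\<close>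

definition preclosure_on :: "'p::order set \<Rightarrow> ('p \<Rightarrow> 'p) \<Rightarrow> bool" where
  "preclosure_on P c \<longleftrightarrow> c \<in> P \<rightarrow> P \<and> (\<forall>s\<in>P. s \<le> c s) \<and> mono_on P c"

definition preclosure_over :: "('a, 'r) ringed_space \<Rightarrow> ('a set \<Rightarrow> 'r set \<Rightarrow> 'r set) \<Rightarrow> bool" where
  "preclosure_over X cl \<longleftrightarrow>
     (\<forall>U. affine_open X U \<longrightarrow> preclosure_on {I. ideal I (Sec X U)} (cl U))"

text \<open>The extension of an ideal of \<open>Sec X U\<close> to \<open>Sec X V\<close> along restriction.\<close>

definition extend_ideal :: "('a, 'r) ringed_space \<Rightarrow> 'a set \<Rightarrow> 'a set \<Rightarrow> 'r set \<Rightarrow> 'r set" where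
  "extend_ideal X U V I = Idl\<^bsub>Sec X V\<^esub> (Res X U V ` I)"

definition openly_persistent :: "('a, 'r) ringed_space \<Rightarrow> ('a set \<Rightarrow> 'r set \<Rightarrow> 'r set) \<Rightarrow> bool" where
  "openly_persistent X cl \<longleftrightarrow>
     (\<forall>U V I. affine_open X U \<and> affine_open X V \<and> V \<subseteq> U \<and> ideal I (Sec X U) \<longrightarrow>
        (\<forall>x\<in>cl U I. Res X U V x \<in> cl V (extend_ideal X U V I)))"

definition ideal_radical :: "('r, 'm) ring_scheme \<Rightarrow> 'r set \<Rightarrow> 'r set" where
  "ideal_radical R I = {a \<in> carrier R. \<exists>n::nat. a [^]\<^bsub>R\<^esub> n \<in> I}"

text \<open>\<open>D(f)\<close> for \<open>f \<in> Sec X U\<close>: the points at which the germ of \<open>f\<close> is a unit, i.e. lies outside the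
  maximal ideal of the stalk. If \<open>U = Spec R\<close>, these are the primes not containing \<open>f\<close>, and
  \<open>Sec X (D(f))\<close>, with the restriction map, is the localization \<open>R\<^sub>f\<close>.\<close>

definition basic_open :: "('a, 'r) ringed_space \<Rightarrow> 'a set \<Rightarrow> 'r \<Rightarrow> 'a set" where
  "basic_open X U f = {x \<in> U. germ X x U f \<in> Units (stalk X x)}"

text \<open>With \<open>R = Sec X U\<close> and \<open>R\<^sub>f\<close> identified with the sections over \<open>D(f)\<close>, the image \<open>z/1\<close> is the
  restriction of \<open>z\<close> and \<open>J\<^sub>f\<close> is the extension of \<open>J\<close>.\<close>

definition glueable :: "('a, 'r) ringed_space \<Rightarrow> ('a set \<Rightarrow> 'r set \<Rightarrow> 'r set) \<Rightarrow> bool" where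
  "glueable X cl \<longleftrightarrow> openly_persistent X cl \<and>
     (\<forall>U I G g J z.
        affine_open X U \<and> ideal I (Sec X U) \<and> G \<subseteq> carrier (Sec X U) \<and> I = Idl\<^bsub>Sec X U\<^esub> G \<and>
        g \<in> ideal_radical (Sec X U) I \<and> ideal J (Sec X U) \<and> z \<in> carrier (Sec X U) \<and>
        (\<forall>f\<in>G. Res X U (basic_open X U f) z
                 \<in> cl (basic_open X U f) (extend_ideal X U (basic_open X U f) J)) \<longrightarrow>
        Res X U (basic_open X U g) z
          \<in> cl (basic_open X U g) (extend_ideal X U (basic_open X U g) J))"

definition cl_sheaf :: "('a, 'r) ringed_space \<Rightarrow> ('a set \<Rightarrow> 'r set \<Rightarrow> 'r set) \<Rightarrow> ('a set \<Rightarrow> 'r set) \<Rightarrow>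
    'a set \<Rightarrow> 'r set" where
  "cl_sheaf X cl \<I> U =
     {s \<in> carrier (Sec X U). \<forall>x\<in>U. \<exists>V. affine_open X V \<and> x \<in> V \<and> V \<subseteq> U \<and> Res X U V s \<in> cl V (\<I> V)}"

end

theory Submission
  imports Defs "HOL-Algebra.Ring_Divisibility"
begin

text \<open>
  Parts (2) and (3) follow formally from part (1), because a sheaf of ideals is determined by its sections
  over affine open sets, which form a basis of the topology. In part (1) only one implication has content:
  if a section \<open>s\<close> over \<open>U\<close> lies locally in the closure of \<open>\<I>\<close>, then it does so on every affine open
  \<open>V \<subseteq> U\<close> (\<open>closure_on_affine_open\<close>). Around each point of \<open>V\<close> there is a basic open set \<open>D(g)\<close> of \<open>V\<close> inside an
  affine open set \<open>W\<close> on which \<open>s\<close> lies in the closure of \<open>\<I>(W)\<close>. Open persistence moves this to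
  \<open>D(g)\<close>, monotonicity and \<open>\<I>(D(g)) = \<I>(V)\<^sub>g\<close> turn it into membership in the closure of \<open>\<I>(V)\<^sub>g\<close>, and
  glueability, applied to these \<open>g\<close> and to the element \<open>1\<close> of the ideal they generate, yields the claim.

  This argument uses three facts about schemes. Basic open subsets of affine open sets are affine and form a
  basis (\<open>affine_open_basic_open\<close>); sections without common zero on an affine open set generate the unit
  ideal (\<open>affine_open_covering_ideal\<close>); and \<open>\<I>(D(g)) \<subseteq> \<I>(V)\<^sub>g\<close> for every affine open \<open>V\<close>, not only for
  those on which \<open>\<I>\<close> is given as \<open>M\<^sup>~\<close> (\<open>quasi_coherent_basic_open_subset\<close>). They rest on the description of the
  sections of \<open>M\<^sup>~\<close> over \<open>D(a)\<close> as \<open>M\<^sub>a\<close> (\<open>frac_eq_on_spec_basic_openD\<close> for injectivity,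
  \<open>tilde_section_basic_open_is_fraction\<close> for surjectivity).

  To show that basic open sets are affine, affineness of \<open>U\<close> is characterized by properties of the ring
  \<open>\<O>(U)\<close> and of the sets \<open>D(g)\<close> (\<open>affine_open_iff_criterion\<close>): points are primes, the \<open>D(g)\<close> are a basis,
  and \<open>\<O>(D(f))\<close> is \<open>\<O>(U)\<^sub>f\<close>. The criterion passes from \<open>U\<close> to \<open>D(f)\<close> by clearing denominators, and it
  allows the isomorphism with \<open>Spec \<O>(U)\<close> to be constructed directly.

  Finite subcovers do not appear. Wherever quasi-compactness would be used, the elements \<open>g\<close> for which the desired
  assertion holds over \<open>D(g)\<close> are shown to form an ideal, which only needs gluing over two sets, and an ideal
  without common zero is the unit ideal, or contains a power of \<open>a\<close> if its zeros lie outside \<open>D(a)\<close>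
  (\<open>exists_primeideal_avoiding_powers\<close>).
\<close>

section \<open>Prime ideals\<close>

text \<open>An ideal that contains \<open>I\<close> and is maximal among those avoiding the powers of \<open>a\<close> is prime. In this form
  the fact that the radical is the intersection of the primes above \<open>I\<close> serves as the substitute for
  quasi-compactness throughout: to show that a property of elements \<open>g\<close> holds for a power of \<open>a\<close>, it
  suffices that the elements with the property form an ideal that is contained in no prime
  avoiding \<open>a\<close>.\<close>

lemma (in cring) exists_primeideal_avoiding_powers:
  assumes I: "ideal I R" and a: "a \<in> carrier R" and pow: "\<And>n::nat. a [^] n \<notin> I"
  obtains p where "primeideal p R" "I \<subseteq> p" "a \<notin> p"
proof -
  define S where "S = {J. ideal J R \<and> I \<subseteq> J \<and> (\<forall>n::nat. a [^] n \<notin> J)}"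
  have "\<Union>C \<in> S" if C: "C \<noteq> {}" "subset.chain S C" for C
  proof -
    have "subset.chain {J. ideal J R} C"
      using C(2) by (auto simp: subset.chain_def S_def)
    then have "ideal (\<Union>C) R" using chain_Union_is_ideal C(1) by presburger
    moreover have "C \<subseteq> S" using C(2) by (simp add: subset.chain_def)
    ultimately show ?thesis using C(1) unfolding S_def by blast
  qed
  moreover have "I \<in> S" using I pow by (simp add: S_def)
  ultimately obtain p where p: "p \<in> S" and max: "\<And>J. J \<in> S \<Longrightarrow> p \<subseteq> J \<Longrightarrow> J = p"
    using subset_Zorn_nonempty[of S] by blast
  interpret p: ideal p R using p by (simp add: S_def)
  \<comment> \<open>by maximality, adding any further element \<open>x\<close> to \<open>p\<close> admits a power of \<open>a\<close>\<close>
  have hit: "\<exists>n::nat. \<exists>i\<in>p. \<exists>r\<in>carrier R. a [^] n = i \<oplus> r \<otimes> x"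
    if x: "x \<in> carrier R" "x \<notin> p" for x
  proof -
    let ?J = "p <+>\<^bsub>R\<^esub> PIdl x"
    have J_iff: "y \<in> ?J \<longleftrightarrow> (\<exists>i\<in>p. \<exists>r\<in>carrier R. y = i \<oplus> r \<otimes> x)" for y
      by (auto simp: set_add_def' cgenideal_def)
    have J: "ideal ?J R" using add_ideals[OF p.ideal_axioms cgenideal_ideal[OF x(1)]] .
    have "i \<in> ?J" if "i \<in> p" for i
      unfolding J_iff using that p.Icarr x(1) by (intro bexI[of _ i] bexI[of _ \<zero>]) simp_all
    moreover have "x \<in> ?J"
      unfolding J_iff using p.zero_closed x(1) by (intro bexI[of _ \<zero>] bexI[of _ \<one>]) simp_all
    ultimately have "?J \<notin> S" and "I \<subseteq> ?J" using max[of ?J] x(2) p by (auto simp: S_def)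
    with J obtain n :: nat where "a [^] n \<in> ?J" by (auto simp: S_def)
    then show ?thesis unfolding J_iff by blast
  qed
  have "primeideal p R"
  proof (rule primeidealI[OF p.ideal_axioms is_cring])
    show "carrier R \<noteq> p" using p nat_pow_closed[OF a] by (auto simp: S_def)
    fix x y assume x: "x \<in> carrier R" and y: "y \<in> carrier R" and xy: "x \<otimes> y \<in> p"
    show "x \<in> p \<or> y \<in> p"
    proof (rule ccontr)
      assume "\<not> (x \<in> p \<or> y \<in> p)"
      then obtain m n :: nat and i j r s where
        i: "i \<in> p" "r \<in> carrier R" "a [^] m = i \<oplus> r \<otimes> x" and
        j: "j \<in> p" "s \<in> carrier R" "a [^] n = j \<oplus> s \<otimes> y"
        using hit[OF x] hit[OF y] by blast
      have c: "i \<in> carrier R" "j \<in> carrier R" using i(1) j(1) p.Icarr by auto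
      have "a [^] (m + n) = (i \<oplus> r \<otimes> x) \<otimes> (j \<oplus> s \<otimes> y)"
        using nat_pow_mult[OF a, of m n] i(3) j(3) by simp
      also have "\<dots> = i \<otimes> (j \<oplus> s \<otimes> y) \<oplus> ((r \<otimes> x) \<otimes> j \<oplus> (r \<otimes> s) \<otimes> (x \<otimes> y))"
        using c i(2) j(2) x y by algebra
      also have "\<dots> \<in> p"
        using p.a_closed[OF p.I_r_closed[OF i(1)] p.a_closed[OF p.I_l_closed[OF j(1)] p.I_l_closed[OF xy]]]
          c i(2) j(2) x y by simp
      finally show False using p by (simp add: S_def)
    qed
  qed
  moreover have "a \<notin> p" using p nat_pow_eone[OF a] unfolding S_def by (metis (no_types, lifting) mem_Collect_eq)
  ultimately show ?thesis using that p by (simp add: S_def)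
qed

lemma (in primeideal) submonoid_compl: "submonoid (carrier R - I) R"
proof
  show "\<one> \<in> carrier R - I" using I_notcarr one_imp_carrier by blast
qed (use I_prime in auto)

lemma (in primeideal) pow_notin:
  assumes "a \<in> carrier R" "a \<notin> I" shows "a [^] (n::nat) \<notin> I"
proof (induction n)
  case 0 show ?case using I_notcarr one_imp_carrier by auto
next
  case (Suc n) then show ?case using assms I_prime[of "a [^] n" a] by auto
qed

lemma (in primeideal) mult_notin_iff:
  assumes "a \<in> carrier R" "b \<in> carrier R"
  shows "a \<otimes> b \<notin> I \<longleftrightarrow> a \<notin> I \<and> b \<notin> I"
  using assms I_prime I_l_closed I_r_closed by blast

lemma (in cring) ideal_of_closed:
  assumes "I \<subseteq> carrier R" "\<zero> \<in> I" "\<And>x y. x \<in> I \<Longrightarrow> y \<in> I \<Longrightarrow> x \<oplus> y \<in> I"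
    and "\<And>r x. r \<in> carrier R \<Longrightarrow> x \<in> I \<Longrightarrow> r \<otimes> x \<in> I"
  shows "ideal I R"
proof (rule idealI[OF ring_axioms])
  show "subgroup I (add_monoid R)"
  proof (rule add.subgroupI)
    fix x assume x: "x \<in> I"
    then have "(\<ominus> \<one>) \<otimes> x \<in> I" using assms(4) by blast
    then show "\<ominus> x \<in> I" using assms(1) x by (simp add: l_minus subset_iff)
  qed (use assms in auto)
next
  fix x r assume "x \<in> I" "r \<in> carrier R"
  then show "r \<otimes> x \<in> I" "x \<otimes> r \<in> I" using assms(1,4) m_comm[of x r] by auto
qed

section \<open>Fractions\<close>

lemma self_module_simps [simp]:
  "carrier (ideal_as_module R I) = I" "monoid.mult (ideal_as_module R I) = monoid.mult R"
  "one (ideal_as_module R I) = one R" "zero (ideal_as_module R I) = zero R"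
  "add (ideal_as_module R I) = add R" "smult (ideal_as_module R I) = monoid.mult R"
  by (simp_all add: ideal_as_module_def)

text \<open>The operations on stalks and localizations are unions over all pairs of representatives; this evaluates
  them once the result is known not to depend on the representatives.\<close>

lemma UN_pairs_constant:
  assumes "(a, s) \<in> A" "(b, t) \<in> B"
    and "\<And>a' s' b' t'. (a', s') \<in> A \<Longrightarrow> (b', t') \<in> B \<Longrightarrow> F a' s' b' t' = c"
  shows "(\<Union>(a, s)\<in>A. \<Union>(b, t)\<in>B. F a s b t) = c"
proof -
  have "(\<Union>(a, s)\<in>A. \<Union>(b, t)\<in>B. F a s b t) = (\<Union>p\<in>A. \<Union>q\<in>B. c)"
    using assms(3) by (intro SUP_cong refl) (auto split: prod.splits)
  then show ?thesis using assms(1,2) by auto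
qed

lemma (in cring) module_self: "Module.module R (self_module R)"
proof (rule moduleI)
  show "abelian_group (self_module R)"
  proof (rule abelian_groupI)
    fix x assume "x \<in> carrier (self_module R)"
    then show "\<exists>y\<in>carrier (self_module R). y \<oplus>\<^bsub>self_module R\<^esub> x = \<zero>\<^bsub>self_module R\<^esub>"
      by (intro bexI[of _ "\<ominus> x"]) (simp_all add: l_neg)
  qed (simp_all add: a_assoc a_comm a_lcomm)
qed (simp_all add: is_cring l_distr r_distr m_assoc)

context
  fixes R :: "'r ring" (structure) and M :: "('r, 'm) module"
  assumes module: "Module.module R M"
begin

interpretation Module.module R M by (fact module)

lemma smult_left_commute:
  "\<lbrakk>a \<in> carrier R; b \<in> carrier R; x \<in> carrier M\<rbrakk> \<Longrightarrow> a \<odot>\<^bsub>M\<^esub> (b \<odot>\<^bsub>M\<^esub> x) = b \<odot>\<^bsub>M\<^esub> (a \<odot>\<^bsub>M\<^esub> x)"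
  by (metis R.m_comm smult_assoc1)

text \<open>The defining relation of fractions is an equivalence relation for every multiplicative set: transitivity
  clears the intermediate denominator.\<close>

lemma frac_eq_iff:
  assumes S: "submonoid S R" and m: "m \<in> carrier M" "m' \<in> carrier M" and s: "s \<in> S" "s' \<in> S"
  shows "frac M S m s = frac M S m' s' \<longleftrightarrow> (\<exists>u\<in>S. u \<odot>\<^bsub>M\<^esub> (s' \<odot>\<^bsub>M\<^esub> m) = u \<odot>\<^bsub>M\<^esub> (s \<odot>\<^bsub>M\<^esub> m'))"
    (is "_ \<longleftrightarrow> ?E m s m' s'")
proof -
  interpret S: submonoid S R by (fact S)
  have E_trans: "?E m1 s1 m3 s3" if E: "?E m1 s1 m2 s2" "?E m2 s2 m3 s3"
    and mm: "m1 \<in> carrier M" "m2 \<in> carrier M" "m3 \<in> carrier M" and ss: "s1 \<in> S" "s2 \<in> S" "s3 \<in> S"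
  for m1 s1 m2 s2 m3 s3
  proof -
    obtain u v where u: "u \<in> S" "u \<odot>\<^bsub>M\<^esub> (s2 \<odot>\<^bsub>M\<^esub> m1) = u \<odot>\<^bsub>M\<^esub> (s1 \<odot>\<^bsub>M\<^esub> m2)"
      and v: "v \<in> S" "v \<odot>\<^bsub>M\<^esub> (s3 \<odot>\<^bsub>M\<^esub> m2) = v \<odot>\<^bsub>M\<^esub> (s2 \<odot>\<^bsub>M\<^esub> m3)" using E by blast
    have c: "u \<in> carrier R" "v \<in> carrier R" "s1 \<in> carrier R" "s2 \<in> carrier R" "s3 \<in> carrier R"
      using u v ss S.subset by auto
    have "(u \<otimes> v \<otimes> s2) \<odot>\<^bsub>M\<^esub> (s3 \<odot>\<^bsub>M\<^esub> m1) = (v \<otimes> s3) \<odot>\<^bsub>M\<^esub> (u \<odot>\<^bsub>M\<^esub> (s2 \<odot>\<^bsub>M\<^esub> m1))"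
      using c mm by (simp add: smult_assoc1 smult_left_commute)
    also have "\<dots> = (u \<otimes> s1) \<odot>\<^bsub>M\<^esub> (v \<odot>\<^bsub>M\<^esub> (s3 \<odot>\<^bsub>M\<^esub> m2))"
      using c mm u by (simp add: smult_assoc1 smult_left_commute)
    also have "\<dots> = (u \<otimes> v \<otimes> s2) \<odot>\<^bsub>M\<^esub> (s1 \<odot>\<^bsub>M\<^esub> m3)"
      using c mm v by (simp add: smult_assoc1 smult_left_commute)
    finally show ?thesis using u v ss by (intro bexI[of _ "u \<otimes> v \<otimes> s2"]) auto
  qed
  have refl: "?E m' s' m' s'" using S.one_closed by blast
  show ?thesis
  proof
    assume "frac M S m s = frac M S m' s'"
    moreover have "(m', s') \<in> frac M S m' s'" using refl m s by (simp add: frac_def)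
    ultimately have "(m', s') \<in> frac M S m s" by simp
    then show "?E m s m' s'" unfolding frac_def by blast
  next
    assume E: "?E m s m' s'"
    then have E': "?E m' s' m s" by metis
    show "frac M S m s = frac M S m' s'"
      unfolding frac_def
    proof (intro Collect_cong prod.case_cong refl conj_cong)
      fix n t assume "n \<in> carrier M" "t \<in> S"
      then show "?E m s n t \<longleftrightarrow> ?E m' s' n t"
        using E_trans[OF E', of t n] E_trans[OF E, of t n] m s by argo
    qed simp_all
  qed
qed

lemma frac_self_mem:
  assumes "submonoid S R" "m \<in> carrier M" "s \<in> S" shows "(m, s) \<in> frac M S m s"
  using submonoid.one_closed[OF assms(1)] assms(2,3) by (auto simp: frac_def)

lemma frac_cancel:
  assumes S: "submonoid S R" and m: "m \<in> carrier M" and s: "s \<in> S" "t \<in> S"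
  shows "frac M S (t \<odot>\<^bsub>M\<^esub> m) (t \<otimes> s) = frac M S m s"
proof -
  interpret S: submonoid S R by (fact S)
  have c: "s \<in> carrier R" "t \<in> carrier R" using s S.subset by auto
  have "\<one> \<odot>\<^bsub>M\<^esub> (s \<odot>\<^bsub>M\<^esub> (t \<odot>\<^bsub>M\<^esub> m)) = \<one> \<odot>\<^bsub>M\<^esub> ((t \<otimes> s) \<odot>\<^bsub>M\<^esub> m)"
    using c m by (simp add: smult_assoc1 smult_left_commute)
  then show ?thesis
    using m s c by (subst frac_eq_iff[OF S]) (auto intro: bexI[of _ \<one>])
qed

lemma loc_module_smult_frac:
  assumes S: "submonoid S R" and a: "a \<in> carrier R" "s \<in> S" and m: "m \<in> carrier M" "t \<in> S"
  shows "frac (self_module R) S a s \<odot>\<^bsub>loc_module R M S\<^esub> frac M S m t = frac M S (a \<odot>\<^bsub>M\<^esub> m) (s \<otimes> t)"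
proof -
  interpret S: submonoid S R by (fact S)
  have "frac M S (a' \<odot>\<^bsub>M\<^esub> m') (s' \<otimes> t') = frac M S (a \<odot>\<^bsub>M\<^esub> m) (s \<otimes> t)"
    if as: "(a', s') \<in> frac (self_module R) S a s" and bt: "(m', t') \<in> frac M S m t" for a' s' m' t'
  proof -
    obtain u v where
      u: "u \<in> S" "u \<otimes> (s' \<otimes> a) = u \<otimes> (s \<otimes> a')" and
      v: "v \<in> S" "v \<odot>\<^bsub>M\<^esub> (t' \<odot>\<^bsub>M\<^esub> m) = v \<odot>\<^bsub>M\<^esub> (t \<odot>\<^bsub>M\<^esub> m')" and
      mem: "a' \<in> carrier R" "s' \<in> S" "m' \<in> carrier M" "t' \<in> S"
      using as bt unfolding frac_def self_module_simps by blast
    have c: "u \<in> carrier R" "v \<in> carrier R" "s \<in> carrier R" "s' \<in> carrier R" "t \<in> carrier R" "t' \<in> carrier R"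
      using u v a m mem S.subset by auto
    have "(u \<otimes> v) \<odot>\<^bsub>M\<^esub> ((s \<otimes> t) \<odot>\<^bsub>M\<^esub> (a' \<odot>\<^bsub>M\<^esub> m'))
        = (u \<otimes> (s \<otimes> a')) \<odot>\<^bsub>M\<^esub> (v \<odot>\<^bsub>M\<^esub> (t \<odot>\<^bsub>M\<^esub> m'))"
      using c a m mem by (simp add: smult_assoc1 smult_left_commute)
    also have "\<dots> = (u \<otimes> (s' \<otimes> a)) \<odot>\<^bsub>M\<^esub> (v \<odot>\<^bsub>M\<^esub> (t' \<odot>\<^bsub>M\<^esub> m))"
      using u v by simp
    also have "\<dots> = (u \<otimes> v) \<odot>\<^bsub>M\<^esub> ((s' \<otimes> t') \<odot>\<^bsub>M\<^esub> (a \<odot>\<^bsub>M\<^esub> m))"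
      using c a m mem by (simp add: smult_assoc1 smult_left_commute)
    finally show ?thesis
      using c a m mem u v by (subst frac_eq_iff[OF S]) (auto intro!: bexI[of _ "u \<otimes> v"])
  qed
  moreover have "(a, s) \<in> frac (self_module R) S a s" "(m, t) \<in> frac M S m t"
    using frac_self_mem[OF S, of m t] a m S.one_closed by (auto simp: frac_def)
  ultimately have "(\<Union>(a, s)\<in>frac (self_module R) S a s. \<Union>(m, t)\<in>frac M S m t.
      frac M S (a \<odot>\<^bsub>M\<^esub> m) (s \<otimes> t)) = frac M S (a \<odot>\<^bsub>M\<^esub> m) (s \<otimes> t)"
    by (intro UN_pairs_constant)
  then show ?thesis by (simp add: loc_module_def)
qed

end

context
  fixes R :: "'r ring" (structure)
  assumes R: "cring R"
begin

interpretation cring R by (fact R)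

lemma loc_ring_mult_frac:
  assumes S: "submonoid S R" and a: "a \<in> carrier R" "s \<in> S" and b: "b \<in> carrier R" "t \<in> S"
  shows "frac (self_module R) S a s \<otimes>\<^bsub>loc_ring R S\<^esub> frac (self_module R) S b t
    = frac (self_module R) S (a \<otimes> b) (s \<otimes> t)"
  using loc_module_smult_frac[OF module_self S a] b by (simp add: loc_ring_def loc_module_def)

lemma loc_ring_add_frac:
  assumes S: "submonoid S R" and a: "a \<in> carrier R" "s \<in> S" and b: "b \<in> carrier R" "t \<in> S"
  shows "frac (self_module R) S a s \<oplus>\<^bsub>loc_ring R S\<^esub> frac (self_module R) S b t
    = frac (self_module R) S (t \<otimes> a \<oplus> s \<otimes> b) (s \<otimes> t)"
proof -
  interpret S: submonoid S R by (fact S)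
  have "frac (self_module R) S (t' \<otimes> a' \<oplus> s' \<otimes> b') (s' \<otimes> t')
      = frac (self_module R) S (t \<otimes> a \<oplus> s \<otimes> b) (s \<otimes> t)"
    if as: "(a', s') \<in> frac (self_module R) S a s" and bt: "(b', t') \<in> frac (self_module R) S b t" for a' s' b' t'
  proof -
    obtain u v where
      u: "u \<in> S" "u \<otimes> (s' \<otimes> a) = u \<otimes> (s \<otimes> a')" and
      v: "v \<in> S" "v \<otimes> (t' \<otimes> b) = v \<otimes> (t \<otimes> b')" and
      mem: "a' \<in> carrier R" "s' \<in> S" "b' \<in> carrier R" "t' \<in> S"
      using as bt unfolding frac_def self_module_simps by blast
    have c: "u \<in> carrier R" "v \<in> carrier R" "s \<in> carrier R" "s' \<in> carrier R" "t \<in> carrier R" "t' \<in> carrier R"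
      using u v a b mem S.subset by auto
    have "(u \<otimes> v) \<otimes> ((s \<otimes> t) \<otimes> (t' \<otimes> a' \<oplus> s' \<otimes> b'))
        = (v \<otimes> t \<otimes> t') \<otimes> (u \<otimes> (s \<otimes> a')) \<oplus> (u \<otimes> s \<otimes> s') \<otimes> (v \<otimes> (t \<otimes> b'))"
      using c a b mem by algebra
    also have "\<dots> = (v \<otimes> t \<otimes> t') \<otimes> (u \<otimes> (s' \<otimes> a)) \<oplus> (u \<otimes> s \<otimes> s') \<otimes> (v \<otimes> (t' \<otimes> b))"
      using u v by simp
    also have "\<dots> = (u \<otimes> v) \<otimes> ((s' \<otimes> t') \<otimes> (t \<otimes> a \<oplus> s \<otimes> b))"
      using c a b mem by algebra
    finally show ?thesis
      using c a b mem u v by (subst frac_eq_iff[OF module_self, OF S]) (auto intro!: bexI[of _ "u \<otimes> v"])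
  qed
  moreover have "(a, s) \<in> frac (self_module R) S a s" "(b, t) \<in> frac (self_module R) S b t"
    using frac_self_mem[OF module_self, OF S, of a s] frac_self_mem[OF module_self, OF S, of b t] a b by simp_all
  ultimately have "(\<Union>(a, s)\<in>frac (self_module R) S a s. \<Union>(b, t)\<in>frac (self_module R) S b t.
      frac (self_module R) S (t \<otimes> a \<oplus> s \<otimes> b) (s \<otimes> t))
    = frac (self_module R) S (t \<otimes> a \<oplus> s \<otimes> b) (s \<otimes> t)"
    by (intro UN_pairs_constant)
  then show ?thesis by (simp add: loc_ring_def)
qed

end

section \<open>Sections over basic open sets of a spectrum\<close>

definition spec_basic_open :: "'r ring \<Rightarrow> 'r \<Rightarrow> 'r set set" where
  "spec_basic_open R f = {p. primeideal p R \<and> f \<notin> p}"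

lemma zariski_open_spec_basic_open: "f \<in> carrier R \<Longrightarrow> zariski_open R (spec_basic_open R f)"
  unfolding zariski_open_def spec_basic_open_def by (intro exI[of _ "{f}"]) auto

lemma spec_basic_open_basis:
  assumes "zariski_open R V" "p \<in> V"
  obtains h where "h \<in> carrier R" "p \<in> spec_basic_open R h" "spec_basic_open R h \<subseteq> V"
proof -
  obtain E where "E \<subseteq> carrier R" and V: "V = {p. primeideal p R \<and> \<not> E \<subseteq> p}"
    using assms(1) by (auto simp: zariski_open_def)
  then obtain h where "h \<in> E" "h \<notin> p" "h \<in> carrier R" using assms(2) by blast
  then show ?thesis
    using that[of h] assms(2) unfolding V spec_basic_open_def by blast
qed

lemma zariski_open_primeideal: "zariski_open R V \<Longrightarrow> p \<in> V \<Longrightarrow> primeideal p R"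
  by (auto simp: zariski_open_def)

context
  fixes R :: "'r ring" (structure)
  assumes R: "cring R"
begin

interpretation cring R by (fact R)

lemma spec_basic_open_mult:
  assumes "a \<in> carrier R" "b \<in> carrier R"
  shows "spec_basic_open R (a \<otimes> b) = spec_basic_open R a \<inter> spec_basic_open R b"
  using primeideal.mult_notin_iff[OF _ assms] unfolding spec_basic_open_def by blast

lemma spec_basic_open_pow: "a \<in> carrier R \<Longrightarrow> q \<in> spec_basic_open R a \<Longrightarrow> a [^] (n::nat) \<in> carrier R - q"
  using primeideal.pow_notin by (fastforce simp: spec_basic_open_def)

lemma spec_basic_open_zero: "spec_basic_open R \<zero> = {}"
  using additive_subgroup.zero_closed[OF ideal.axioms(1)[OF primeideal.axioms(1)]]
  unfolding spec_basic_open_def by blast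

lemma spec_basic_open_one: "spec_basic_open R \<one> = {p. primeideal p R}"
proof -
  have "\<one> \<notin> p" if "primeideal p R" for p
    using that by (metis ideal.one_imp_carrier primeideal.I_notcarr primeideal.axioms(1))
  then show ?thesis by (auto simp: spec_basic_open_def)
qed

end

context
  fixes R :: "'r ring" (structure) and M :: "('r, 'm) module"
  assumes module: "Module.module R M"
begin

interpretation Module.module R M by (fact module)

lemma submonoid_compl_prime: "q \<in> spec_basic_open R a \<Longrightarrow> submonoid (carrier R - q) R"
  by (simp add: spec_basic_open_def primeideal.submonoid_compl)

text \<open>The elements that equalize the two cross products form an ideal, and no prime in \<open>D(a)\<close> contains it,
  so some power of \<open>a\<close> lies in it. This is the injectivity of \<open>M\<^sub>a \<rightarrow> \<Gamma>(D(a), M\<^sup>~)\<close>.\<close>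

lemma frac_eq_on_spec_basic_openD:
  assumes a: "a \<in> carrier R" and m: "m \<in> carrier M" "m' \<in> carrier M" and s: "s \<in> carrier R" "s' \<in> carrier R"
    and eq: "\<And>q. q \<in> spec_basic_open R a \<Longrightarrow>
        s \<notin> q \<and> s' \<notin> q \<and> frac M (carrier R - q) m s = frac M (carrier R - q) m' s'"
  shows "\<exists>n::nat. a [^] n \<odot>\<^bsub>M\<^esub> (s' \<odot>\<^bsub>M\<^esub> m) = a [^] n \<odot>\<^bsub>M\<^esub> (s \<odot>\<^bsub>M\<^esub> m')"
proof (rule ccontr)
  assume neg: "\<not> ?thesis"
  define I where "I = {r \<in> carrier R. r \<odot>\<^bsub>M\<^esub> (s' \<odot>\<^bsub>M\<^esub> m) = r \<odot>\<^bsub>M\<^esub> (s \<odot>\<^bsub>M\<^esub> m')}"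
  have "ideal I R"
  proof (rule R.ideal_of_closed)
    show "\<zero> \<in> I" using m s by (simp add: I_def)
    show "x \<oplus> y \<in> I" if "x \<in> I" "y \<in> I" for x y
      using that m s by (simp add: I_def smult_l_distr)
    show "r \<otimes> x \<in> I" if "r \<in> carrier R" "x \<in> I" for r x
      using that m s by (simp add: I_def smult_assoc1)
  qed (auto simp: I_def)
  moreover have "\<And>n::nat. a [^] n \<notin> I" using neg a by (simp add: I_def)
  ultimately obtain q where q: "primeideal q R" "I \<subseteq> q" "a \<notin> q"
    using R.exists_primeideal_avoiding_powers[OF _ a] by metis
  then have "q \<in> spec_basic_open R a" by (simp add: spec_basic_open_def)
  note * = eq[OF this] submonoid_compl_prime[OF this]
  then obtain u where "u \<in> carrier R - q" "u \<odot>\<^bsub>M\<^esub> (s' \<odot>\<^bsub>M\<^esub> m) = u \<odot>\<^bsub>M\<^esub> (s \<odot>\<^bsub>M\<^esub> m')"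
    using frac_eq_iff[OF module *(2) m, of s s'] s by auto
  then show False using q(2) by (auto simp: I_def)
qed

lemma frac_in_loc_module:
  "m \<in> carrier M \<Longrightarrow> s \<in> S \<Longrightarrow> frac M S m s \<in> carrier (loc_module R M S)"
  by (auto simp: loc_module_def)

lemma fraction_tilde_section:
  assumes W: "zariski_open R W" and m: "m \<in> carrier M" and c: "c \<in> carrier R"
    and "\<And>q. q \<in> W \<Longrightarrow> c \<notin> q"
  shows "(\<lambda>q\<in>W. frac M (carrier R - q) m c) \<in> tilde_sections R M W"
  unfolding tilde_sections_def
proof (intro CollectI conjI ballI restrict_PiE)
  show "(\<lambda>q\<in>W. frac M (carrier R - q) m c) \<in> (\<Pi>\<^sub>E q\<in>W. carrier (loc_module R M (carrier R - q)))"
    using assms by (auto intro!: frac_in_loc_module)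
  fix p assume p: "p \<in> W"
  show "\<exists>V m' f. zariski_open R V \<and> p \<in> V \<and> V \<subseteq> W \<and> m' \<in> carrier M \<and> f \<in> carrier R \<and>
      (\<forall>q\<in>V. f \<notin> q \<and> (\<lambda>q\<in>W. frac M (carrier R - q) m c) q = frac M (carrier R - q) m' f)"
    using assms p by (intro exI[of _ W] exI[of _ m] exI[of _ c]) auto
qed

text \<open>Multiplying numerator and denominator of a local fraction by \<open>h\<close> allows the same element to serve as
  the denominator and to define the neighbourhood.\<close>

lemma tilde_section_local:
  assumes s: "s \<in> tilde_sections R M W" and p: "p \<in> W"
  obtains m h where "m \<in> carrier M" "h \<in> carrier R" "p \<in> spec_basic_open R h" "spec_basic_open R h \<subseteq> W"
    "\<And>q. q \<in> spec_basic_open R h \<Longrightarrow> s q = frac M (carrier R - q) m h"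
proof -
  obtain V m f where V: "zariski_open R V" "p \<in> V" "V \<subseteq> W" and m: "m \<in> carrier M" and f: "f \<in> carrier R"
    and sV: "\<And>q. q \<in> V \<Longrightarrow> f \<notin> q \<and> s q = frac M (carrier R - q) m f"
  proof -
    have "\<forall>p\<in>W. \<exists>V m f. zariski_open R V \<and> p \<in> V \<and> V \<subseteq> W \<and> m \<in> carrier M \<and> f \<in> carrier R \<and>
        (\<forall>q\<in>V. f \<notin> q \<and> s q = frac M (carrier R - q) m f)"
      using s by (simp add: tilde_sections_def)
    from bspec[OF this p] show thesis using that by blast
  qed
  obtain h where h: "h \<in> carrier R" "p \<in> spec_basic_open R h" "spec_basic_open R h \<subseteq> V"
    using spec_basic_open_basis[OF V(1,2)] by blast
  have hf: "spec_basic_open R (h \<otimes> f) = spec_basic_open R h"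
    unfolding spec_basic_open_mult[OF R.is_cring h(1) f]
    using h(3) sV unfolding spec_basic_open_def by blast
  show ?thesis
  proof (rule that[of "h \<odot>\<^bsub>M\<^esub> m" "h \<otimes> f"])
    fix q assume "q \<in> spec_basic_open R (h \<otimes> f)"
    then have q: "q \<in> spec_basic_open R h" unfolding hf .
    then show "s q = frac M (carrier R - q) (h \<odot>\<^bsub>M\<^esub> m) (h \<otimes> f)"
      using h f sV[of q] m frac_cancel[OF module submonoid_compl_prime[OF q] m, of f h]
      by (auto simp: spec_basic_open_def)
  qed (use h V m f in \<open>auto simp: hf\<close>)
qed

text \<open>On the overlap \<open>D(bb')\<close> the cross products agree up to a power of \<open>bb'\<close>; absorbing that power into
  both fractions makes them agree exactly: \<open>c' l = c l'\<close>. Some power of \<open>b + b'\<close> is a combination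
  \<open>x c + y c'\<close> because a prime containing \<open>c\<close> and \<open>c'\<close> contains \<open>b\<close> and \<open>b'\<close>, and then \<open>x l + y l'\<close>
  is the numerator over that power.\<close>

lemma glue_two_fractions:
  assumes b: "b \<in> carrier R" "b' \<in> carrier R" and m: "m \<in> carrier M" "m' \<in> carrier M"
    and s: "\<And>q. q \<in> spec_basic_open R b \<Longrightarrow> s q = frac M (carrier R - q) m (b [^] (n::nat))"
    and s': "\<And>q. q \<in> spec_basic_open R b' \<Longrightarrow> s q = frac M (carrier R - q) m' (b' [^] (n'::nat))"
  shows "\<exists>k::nat. \<exists>l\<in>carrier M. \<forall>q\<in>spec_basic_open R (b \<oplus> b').
      s q = frac M (carrier R - q) l ((b \<oplus> b') [^] k)"
proof -
  have bb: "b \<otimes> b' \<in> carrier R" using b by simp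
  obtain N :: nat where N: "(b \<otimes> b') [^] N \<odot>\<^bsub>M\<^esub> (b' [^] n' \<odot>\<^bsub>M\<^esub> m) = (b \<otimes> b') [^] N \<odot>\<^bsub>M\<^esub> (b [^] n \<odot>\<^bsub>M\<^esub> m')"
    using frac_eq_on_spec_basic_openD[OF bb m, of "b [^] n" "b' [^] n'"] b
      s s' spec_basic_open_pow[OF R.is_cring b(1)] spec_basic_open_pow[OF R.is_cring b(2)]
    by (force simp: spec_basic_open_mult[OF R.is_cring b])
  \<comment> \<open>the two fractions, rewritten so that the cross products agree without a further factor\<close>
  define c c' l l' where "c = b [^] N \<otimes> b [^] n" and "c' = b' [^] N \<otimes> b' [^] n'"
    and "l = b [^] N \<odot>\<^bsub>M\<^esub> m" and "l' = b' [^] N \<odot>\<^bsub>M\<^esub> m'"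
  have car: "c \<in> carrier R" "c' \<in> carrier R" "l \<in> carrier M" "l' \<in> carrier M"
    using b m by (auto simp: c_def c'_def l_def l'_def)
  have compat: "c' \<odot>\<^bsub>M\<^esub> l = c \<odot>\<^bsub>M\<^esub> l'"
    using N b m
    by (simp add: c_def c'_def l_def l'_def smult_assoc1 R.nat_pow_distrib smult_left_commute[OF module])
  have "\<exists>k::nat. (b \<oplus> b') [^] k \<in> PIdl c <+>\<^bsub>R\<^esub> PIdl c'"
  proof (rule ccontr)
    assume "\<not> ?thesis"
    then obtain p where p: "primeideal p R" "PIdl c <+>\<^bsub>R\<^esub> PIdl c' \<subseteq> p" "b \<oplus> b' \<notin> p"
      using R.exists_primeideal_avoiding_powers[of "PIdl c <+>\<^bsub>R\<^esub> PIdl c'" "b \<oplus> b'"]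
        R.add_ideals R.cgenideal_ideal car b by (metis R.a_closed)
    interpret p: primeideal p R by (fact p)
    have mem: "x \<otimes> c \<oplus> y \<otimes> c' \<in> p" if "x \<in> carrier R" "y \<in> carrier R" for x y
      using that p(2) by (auto simp: set_add_def' cgenideal_def)
    have "c \<in> p" "c' \<in> p" using mem[of \<one> \<zero>] mem[of \<zero> \<one>] car by simp_all
    then have "b \<in> p" "b' \<in> p"
      using p.pow_notin b p.mult_notin_iff unfolding c_def c'_def by (metis R.nat_pow_closed)+
    then show False using p(3) by simp
  qed
  then obtain k :: nat and x y where xy: "x \<in> carrier R" "y \<in> carrier R"
    and k: "(b \<oplus> b') [^] k = x \<otimes> c \<oplus> y \<otimes> c'"
    by (auto simp: set_add_def' cgenideal_def)
  let ?l = "x \<odot>\<^bsub>M\<^esub> l \<oplus>\<^bsub>M\<^esub> y \<odot>\<^bsub>M\<^esub> l'"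
  have l: "?l \<in> carrier M" using xy car by simp
  have eq1: "c \<odot>\<^bsub>M\<^esub> ?l = (b \<oplus> b') [^] k \<odot>\<^bsub>M\<^esub> l"
    using xy car compat unfolding k
    by (simp add: smult_l_distr smult_r_distr smult_assoc1 smult_left_commute[OF module, of c])
  have eq2: "c' \<odot>\<^bsub>M\<^esub> ?l = (b \<oplus> b') [^] k \<odot>\<^bsub>M\<^esub> l'"
    using xy car compat unfolding k
    by (simp add: smult_l_distr smult_r_distr smult_assoc1 smult_left_commute[OF module, of c'])
  have "s q = frac M (carrier R - q) ?l ((b \<oplus> b') [^] k)" if q: "q \<in> spec_basic_open R (b \<oplus> b')" for q
  proof -
    interpret q: primeideal q R using q by (simp add: spec_basic_open_def)
    note S = submonoid_compl_prime[OF q]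
    have pow: "(b \<oplus> b') [^] k \<in> carrier R - q"
      using spec_basic_open_pow[OF R.is_cring _ q] b by simp
    have "\<one> \<in> carrier R - q" using submonoid.one_closed[OF S] .
    then have eqI: "frac M (carrier R - q) l0 c0 = frac M (carrier R - q) ?l ((b \<oplus> b') [^] k)"
      if "c0 \<in> carrier R - q" "l0 \<in> carrier M" "c0 \<odot>\<^bsub>M\<^esub> ?l = (b \<oplus> b') [^] k \<odot>\<^bsub>M\<^esub> l0" for c0 l0
      using frac_eq_iff[OF module S that(2) l that(1) pow] that by auto
    have "b \<notin> q \<or> b' \<notin> q" using q by (auto simp: spec_basic_open_def)
    then show ?thesis
    proof
      assume "b \<notin> q"
      then have D: "q \<in> spec_basic_open R b" using q.primeideal by (simp add: spec_basic_open_def)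
      have "s q = frac M (carrier R - q) l c"
        using s[OF D] frac_cancel[OF module S m(1)] spec_basic_open_pow[OF R.is_cring b(1) D]
        unfolding l_def c_def by metis
      also have "\<dots> = frac M (carrier R - q) ?l ((b \<oplus> b') [^] k)"
        using eqI[OF _ car(3) eq1] submonoid.m_closed[OF S] spec_basic_open_pow[OF R.is_cring b(1) D]
        unfolding c_def by metis
      finally show ?thesis .
    next
      assume "b' \<notin> q"
      then have D: "q \<in> spec_basic_open R b'" using q.primeideal by (simp add: spec_basic_open_def)
      have "s q = frac M (carrier R - q) l' c'"
        using s'[OF D] frac_cancel[OF module S m(2)] spec_basic_open_pow[OF R.is_cring b(2) D]
        unfolding l'_def c'_def by metis
      also have "\<dots> = frac M (carrier R - q) ?l ((b \<oplus> b') [^] k)"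
        using eqI[OF _ car(4) eq2] submonoid.m_closed[OF S] spec_basic_open_pow[OF R.is_cring b(2) D]
        unfolding c'_def by metis
      finally show ?thesis .
    qed
  qed
  then show ?thesis using l by blast
qed

text \<open>The surjectivity of \<open>M\<^sub>a \<rightarrow> \<Gamma>(D(a), M\<^sup>~)\<close>. The elements \<open>g\<close> such that the section is a single fraction
  on \<open>D(ag)\<close> form an ideal, closure under addition being the gluing of two fractions. Since the
  section is locally a fraction, no prime in \<open>D(a)\<close> contains this ideal, so a power of \<open>a\<close> lies
  in it. Thus only two fractions at a time are ever glued.\<close>

theorem tilde_section_basic_open_is_fraction:
  assumes a: "a \<in> carrier R" and s: "s \<in> tilde_sections R M (spec_basic_open R a)"
  shows "\<exists>n::nat. \<exists>m\<in>carrier M. \<forall>q\<in>spec_basic_open R a. s q = frac M (carrier R - q) m (a [^] n)"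
proof -
  define B where "B = {g \<in> carrier R. \<exists>n::nat. \<exists>m\<in>carrier M.
    \<forall>q\<in>spec_basic_open R (a \<otimes> g). s q = frac M (carrier R - q) m ((a \<otimes> g) [^] n)}"
  have "ideal B R"
  proof (rule R.ideal_of_closed)
    have "spec_basic_open R (a \<otimes> \<zero>) = {}"
      using a by (simp add: spec_basic_open_zero[OF R.is_cring])
    then show "\<zero> \<in> B" unfolding B_def using M.zero_closed by blast
    show "g \<oplus> g' \<in> B" if gB: "g \<in> B" "g' \<in> B" for g g'
    proof -
      obtain n m n' m' where g: "g \<in> carrier R" "m \<in> carrier M" "g' \<in> carrier R" "m' \<in> carrier M"
        "\<And>q. q \<in> spec_basic_open R (a \<otimes> g) \<Longrightarrow> s q = frac M (carrier R - q) m ((a \<otimes> g) [^] (n::nat))"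
        "\<And>q. q \<in> spec_basic_open R (a \<otimes> g') \<Longrightarrow> s q = frac M (carrier R - q) m' ((a \<otimes> g') [^] (n'::nat))"
        using gB unfolding B_def by blast
      have "\<exists>k::nat. \<exists>l\<in>carrier M. \<forall>q\<in>spec_basic_open R (a \<otimes> g \<oplus> a \<otimes> g').
          s q = frac M (carrier R - q) l ((a \<otimes> g \<oplus> a \<otimes> g') [^] k)"
        using g a by (intro glue_two_fractions[where s = s]) auto
      then show ?thesis using g(1,3) a by (simp add: B_def R.r_distr)
    qed
    show "r \<otimes> g \<in> B" if r: "r \<in> carrier R" and g: "g \<in> B" for r g
    proof -
      obtain n :: nat and m where gm: "g \<in> carrier R" "m \<in> carrier M"
        "\<And>q. q \<in> spec_basic_open R (a \<otimes> g) \<Longrightarrow> s q = frac M (carrier R - q) m ((a \<otimes> g) [^] n)"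
        using g by (auto simp: B_def)
      have "s q = frac M (carrier R - q) (r [^] n \<odot>\<^bsub>M\<^esub> m) ((a \<otimes> (r \<otimes> g)) [^] n)"
        if q: "q \<in> spec_basic_open R (a \<otimes> (r \<otimes> g))" for q
      proof -
        have q': "q \<in> spec_basic_open R r" "q \<in> spec_basic_open R (a \<otimes> g)"
          using q a r gm(1) by (auto simp: spec_basic_open_mult[OF R.is_cring])
        have "(a \<otimes> (r \<otimes> g)) [^] n = r [^] n \<otimes> (a \<otimes> g) [^] n"
          using a r gm(1) by (simp add: R.nat_pow_distrib R.m_lcomm)
        then show ?thesis
          using gm(3)[OF q'(2)] frac_cancel[OF module submonoid_compl_prime[OF q] gm(2)]
            spec_basic_open_pow[OF R.is_cring r q'(1)] spec_basic_open_pow[OF R.is_cring _ q'(2)] a gm(1)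
          by simp
      qed
      then show ?thesis using r gm(1,2) by (auto simp: B_def)
    qed
  qed (auto simp: B_def)
  have "\<exists>k::nat. a [^] k \<in> B"
  proof (rule ccontr)
    assume "\<not> ?thesis"
    then obtain p where p: "primeideal p R" "B \<subseteq> p" "a \<notin> p"
      using R.exists_primeideal_avoiding_powers[OF \<open>ideal B R\<close> a] by metis
    then have "p \<in> spec_basic_open R a" by (simp add: spec_basic_open_def)
    from tilde_section_local[OF s this] obtain m h where
      m: "m \<in> carrier M" and h: "h \<in> carrier R" "p \<in> spec_basic_open R h" "spec_basic_open R h \<subseteq> spec_basic_open R a"
      and sh: "\<And>q. q \<in> spec_basic_open R h \<Longrightarrow> s q = frac M (carrier R - q) m h" by blast
    have "s q = frac M (carrier R - q) (a \<odot>\<^bsub>M\<^esub> m) ((a \<otimes> h) [^] (1::nat))"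
      if "q \<in> spec_basic_open R (a \<otimes> h)" for q
    proof -
      have q: "q \<in> spec_basic_open R a" "q \<in> spec_basic_open R h"
        using that a h by (auto simp: spec_basic_open_mult[OF R.is_cring])
      then show ?thesis
        using frac_cancel[OF module submonoid_compl_prime[OF q(1)] m, of h a] sh a h(1)
        by (auto simp: spec_basic_open_def)
    qed
    then have "h \<in> B" using m a h(1) unfolding B_def by blast
    then show False using p h(2) by (auto simp: spec_basic_open_def)
  qed
  then obtain k n :: nat and m where m: "m \<in> carrier M"
    and sm: "\<forall>q\<in>spec_basic_open R (a \<otimes> a [^] k). s q = frac M (carrier R - q) m ((a \<otimes> a [^] k) [^] n)"
    by (auto simp: B_def)
  have "(a \<otimes> a [^] k) [^] n = a [^] (Suc k * n)"
    using R.nat_pow_pow[OF a, of "Suc k" n] R.nat_pow_Suc2[OF a, of k] by simp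
  moreover have "q \<in> spec_basic_open R (a \<otimes> a [^] k)" if "q \<in> spec_basic_open R a" for q
    using that spec_basic_open_pow[OF R.is_cring a that, of k] a
    unfolding spec_basic_open_mult[OF R.is_cring a R.nat_pow_closed[OF a]] by (auto simp: spec_basic_open_def)
  ultimately have "\<forall>q\<in>spec_basic_open R a. s q = frac M (carrier R - q) m (a [^] (Suc k * n))"
    using sm by metis
  then show ?thesis using m by blast
qed

end

section \<open>Ringed spaces\<close>

lemma is_sheaf_separated:
  assumes sheaf: "is_sheaf T F r" and op: "\<forall>U\<in>\<U>. openin T U"
    and st: "s \<in> F (\<Union>\<U>)" "t \<in> F (\<Union>\<U>)" and eq: "\<forall>U\<in>\<U>. r (\<Union>\<U>) U s = r (\<Union>\<U>) U t"
  shows "s = t"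
proof -
  note * = mp[OF spec[OF conjunct2[OF sheaf[unfolded is_sheaf_def]], of \<U>] op]
  show ?thesis using mp[OF bspec[OF bspec[OF conjunct1[OF *] st(1)] st(2)] eq] .
qed

lemma is_sheaf_glue:
  assumes sheaf: "is_sheaf T F r" and op: "\<forall>U\<in>\<U>. openin T U"
    and s: "\<forall>U\<in>\<U>. s U \<in> F U" and compat: "\<forall>U\<in>\<U>. \<forall>V\<in>\<U>. r U (U \<inter> V) (s U) = r V (U \<inter> V) (s V)"
  shows "\<exists>t\<in>F (\<Union>\<U>). \<forall>U\<in>\<U>. r (\<Union>\<U>) U t = s U"
proof -
  note * = mp[OF spec[OF conjunct2[OF sheaf[unfolded is_sheaf_def]], of \<U>] op]
  show ?thesis using mp[OF spec[OF conjunct2[OF *], of s] conjI[OF s compat]] .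
qed

locale ringed_space_locale =
  fixes X :: "('a, 'r) ringed_space"
  assumes ringed_space: "is_ringed_space X"
begin

abbreviation opn :: "'a set \<Rightarrow> bool" where "opn U \<equiv> openin (Top X) U"

lemma cring_Sec: "opn U \<Longrightarrow> cring (Sec X U)"
  using ringed_space by (simp add: is_ringed_space_def)

lemma Res_hom: "\<lbrakk>opn U; opn V; V \<subseteq> U\<rbrakk> \<Longrightarrow> Res X U V \<in> ring_hom (Sec X U) (Sec X V)"
  using ringed_space by (simp add: is_ringed_space_def)

lemma Res_hom_cring: "\<lbrakk>opn U; opn V; V \<subseteq> U\<rbrakk> \<Longrightarrow> ring_hom_cring (Sec X U) (Sec X V) (Res X U V)"
  by (simp add: ring_hom_cring_def ring_hom_cring_axioms_def cring_Sec Res_hom)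

lemma sheaf_Sec: "is_sheaf (Top X) (\<lambda>U. carrier (Sec X U)) (Res X)"
  using ringed_space by (simp add: is_ringed_space_def)

lemma Res_id: "\<lbrakk>opn U; s \<in> carrier (Sec X U)\<rbrakk> \<Longrightarrow> Res X U U s = s"
  using sheaf_Sec by (simp add: is_sheaf_def is_presheaf_def)

lemma Res_Res:
  "\<lbrakk>opn U; opn V; opn W; W \<subseteq> V; V \<subseteq> U; s \<in> carrier (Sec X U)\<rbrakk> \<Longrightarrow> Res X V W (Res X U V s) = Res X U W s"
  using sheaf_Sec unfolding is_sheaf_def is_presheaf_def by blast

context
  fixes U V assumes UV: "opn U" "opn V" "V \<subseteq> U"
begin

interpretation h: ring_hom_cring "Sec X U" "Sec X V" "Res X U V"
  using UV by (rule Res_hom_cring)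

lemma Res_closed: "s \<in> carrier (Sec X U) \<Longrightarrow> Res X U V s \<in> carrier (Sec X V)"
  by simp

lemma Res_mult:
  "\<lbrakk>s \<in> carrier (Sec X U); t \<in> carrier (Sec X U)\<rbrakk> \<Longrightarrow>
    Res X U V (s \<otimes>\<^bsub>Sec X U\<^esub> t) = Res X U V s \<otimes>\<^bsub>Sec X V\<^esub> Res X U V t"
  by simp

lemma Res_add:
  "\<lbrakk>s \<in> carrier (Sec X U); t \<in> carrier (Sec X U)\<rbrakk> \<Longrightarrow>
    Res X U V (s \<oplus>\<^bsub>Sec X U\<^esub> t) = Res X U V s \<oplus>\<^bsub>Sec X V\<^esub> Res X U V t"
  by simp

lemma Res_minus:
  "\<lbrakk>s \<in> carrier (Sec X U); t \<in> carrier (Sec X U)\<rbrakk> \<Longrightarrow>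
    Res X U V (s \<ominus>\<^bsub>Sec X U\<^esub> t) = Res X U V s \<ominus>\<^bsub>Sec X V\<^esub> Res X U V t"
  by (simp add: a_minus_def)

lemma Res_one: "Res X U V \<one>\<^bsub>Sec X U\<^esub> = \<one>\<^bsub>Sec X V\<^esub>"
  by simp

lemma Res_zero: "Res X U V \<zero>\<^bsub>Sec X U\<^esub> = \<zero>\<^bsub>Sec X V\<^esub>"
  by simp

lemma Res_pow:
  "s \<in> carrier (Sec X U) \<Longrightarrow> Res X U V (s [^]\<^bsub>Sec X U\<^esub> (n::nat)) = Res X U V s [^]\<^bsub>Sec X V\<^esub> n"
  by simp

lemma Res_Units: "s \<in> Units (Sec X U) \<Longrightarrow> Res X U V s \<in> Units (Sec X V)"
proof -
  assume s: "s \<in> Units (Sec X U)"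
  then obtain t where t: "t \<in> carrier (Sec X U)" "t \<otimes>\<^bsub>Sec X U\<^esub> s = \<one>\<^bsub>Sec X U\<^esub>" "s \<otimes>\<^bsub>Sec X U\<^esub> t = \<one>\<^bsub>Sec X U\<^esub>"
    by (auto simp: Units_def)
  have "Res X U V t \<otimes>\<^bsub>Sec X V\<^esub> Res X U V s = \<one>\<^bsub>Sec X V\<^esub>" "Res X U V s \<otimes>\<^bsub>Sec X V\<^esub> Res X U V t = \<one>\<^bsub>Sec X V\<^esub>"
    using t s h.hom_mult h.hom_one by (metis h.R.Units_closed)+
  then show ?thesis using t(1) h.R.Units_closed[OF s] by (auto simp: Units_def)
qed

end

lemma section_eqI:
  assumes "opn U" "s \<in> carrier (Sec X U)" "t \<in> carrier (Sec X U)"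
    and "\<And>x. x \<in> U \<Longrightarrow> \<exists>W. opn W \<and> x \<in> W \<and> W \<subseteq> U \<and> Res X U W s = Res X U W t"
  shows "s = t"
proof -
  define \<U> where "\<U> = {W. opn W \<and> W \<subseteq> U \<and> Res X U W s = Res X U W t}"
  have Un: "\<Union>\<U> = U" using assms(4) unfolding \<U>_def by blast
  have "\<forall>W\<in>\<U>. opn W" by (simp add: \<U>_def)
  from is_sheaf_separated[OF sheaf_Sec this] show ?thesis
    using assms(2,3) unfolding Un by (simp add: \<U>_def)
qed

lemma glue_sections:
  assumes "\<And>W. W \<in> \<U> \<Longrightarrow> opn W" "\<And>W. W \<in> \<U> \<Longrightarrow> s W \<in> carrier (Sec X W)"
    and "\<And>V W. V \<in> \<U> \<Longrightarrow> W \<in> \<U> \<Longrightarrow> Res X V (V \<inter> W) (s V) = Res X W (V \<inter> W) (s W)"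
  obtains t where "t \<in> carrier (Sec X (\<Union>\<U>))" "\<And>W. W \<in> \<U> \<Longrightarrow> Res X (\<Union>\<U>) W t = s W"
  using is_sheaf_glue[OF sheaf_Sec, of \<U> s] assms that by blast

lemma germ_eqI:
  assumes UV: "opn U" "opn V" and s: "s \<in> carrier (Sec X U)" and t: "t \<in> carrier (Sec X V)"
    and W: "opn W" "x \<in> W" "W \<subseteq> U \<inter> V" "Res X U W s = Res X V W t"
  shows "germ X x U s = germ X x V t"
proof -
  have *: "germ X x U s \<subseteq> germ X x V t"
    if UV: "opn U" "opn V" and s: "s \<in> carrier (Sec X U)" and t: "t \<in> carrier (Sec X V)"
      and W: "W \<subseteq> U \<inter> V" "Res X U W s = Res X V W t" for U V s t
  proof
    fix p assume "p \<in> germ X x U s"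
    then obtain V' t' W' where p: "p = (V', t')" "opn V'" "x \<in> V'" "t' \<in> carrier (Sec X V')"
      and W': "opn W'" "x \<in> W'" "W' \<subseteq> U \<inter> V'" "Res X U W' s = Res X V' W' t'"
      by (auto simp: germ_def)
    let ?W = "W \<inter> W'"
    have op: "opn ?W" using assms(5) W'(1) by (rule openin_Int)
    have "Res X V ?W t = Res X W ?W (Res X V W t)"
      using Res_Res[OF UV(2) assms(5) op _ _ t] W by simp
    also have "\<dots> = Res X U ?W s"
      using Res_Res[OF UV(1) assms(5) op _ _ s] W by simp
    also have "\<dots> = Res X W' ?W (Res X U W' s)"
      using Res_Res[OF UV(1) W'(1) op _ _ s] W' by simp
    also have "\<dots> = Res X V' ?W t'"
      using Res_Res[OF p(2) W'(1) op _ _ p(4)] W' by simp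
    finally show "p \<in> germ X x V t"
      unfolding p(1) germ_def using p op assms(6) W W' by blast
  qed
  show ?thesis
    using *[OF UV s t W(3,4)] *[OF UV(2,1) t s _ W(4)[symmetric]] W(3) by blast
qed

lemma germ_self_mem: "\<lbrakk>opn U; x \<in> U; s \<in> carrier (Sec X U)\<rbrakk> \<Longrightarrow> (U, s) \<in> germ X x U s"
  unfolding germ_def by blast

lemma germ_eqD:
  assumes "opn V" "x \<in> V" "t \<in> carrier (Sec X V)" "germ X x U s = germ X x V t"
  obtains W where "opn W" "x \<in> W" "W \<subseteq> U \<inter> V" "Res X U W s = Res X V W t"
proof -
  have "(V, t) \<in> germ X x U s" using germ_self_mem[OF assms(1-3)] assms(4) by simp
  then show ?thesis using that unfolding germ_def by blast
qed

lemma germ_Res: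
  assumes "opn U" "opn V" "V \<subseteq> U" "x \<in> V" "s \<in> carrier (Sec X U)"
  shows "germ X x V (Res X U V s) = germ X x U s"
  using assms Res_closed[OF assms(1-3)] Res_Res[OF assms(1,2,2) _ assms(3,5)]
  by (intro germ_eqI[where W = V]) auto

lemma stalk_mult_germ:
  assumes U: "opn U" "x \<in> U" "s \<in> carrier (Sec X U)" and V: "opn V" "x \<in> V" "t \<in> carrier (Sec X V)"
  shows "germ X x U s \<otimes>\<^bsub>stalk X x\<^esub> germ X x V t
    = germ X x (U \<inter> V) (Res X U (U \<inter> V) s \<otimes>\<^bsub>Sec X (U \<inter> V)\<^esub> Res X V (U \<inter> V) t)"
proof -
  have "germ X x (U' \<inter> V') (Res X U' (U' \<inter> V') s' \<otimes>\<^bsub>Sec X (U' \<inter> V')\<^esub> Res X V' (U' \<inter> V') t')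
      = germ X x (U \<inter> V) (Res X U (U \<inter> V) s \<otimes>\<^bsub>Sec X (U \<inter> V)\<^esub> Res X V (U \<inter> V) t)"
    if s': "(U', s') \<in> germ X x U s" and t': "(V', t') \<in> germ X x V t" for U' s' V' t'
  proof -
    obtain W where U': "opn U'" "x \<in> U'" "s' \<in> carrier (Sec X U')"
      and W: "opn W" "x \<in> W" "W \<subseteq> U \<inter> U'" "Res X U W s = Res X U' W s'"
      using s' unfolding germ_def by blast
    obtain W' where V': "opn V'" "x \<in> V'" "t' \<in> carrier (Sec X V')"
      and W': "opn W'" "x \<in> W'" "W' \<subseteq> V \<inter> V'" "Res X V W' t = Res X V' W' t'"
      using t' unfolding germ_def by blast
    let ?W = "W \<inter> W'"
    have op: "opn ?W" "opn (U \<inter> V)" "opn (U' \<inter> V')" using U V U' V' W W' by auto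
    have sub: "?W \<subseteq> U \<inter> V" "?W \<subseteq> U' \<inter> V'" using W(3) W'(3) by auto
    have Rs: "Res X U ?W s = Res X U' ?W s'"
      using Res_Res[OF U(1) W(1) op(1) _ _ U(3)] Res_Res[OF U'(1) W(1) op(1) _ _ U'(3)] W(3,4) by simp
    have Rt: "Res X V ?W t = Res X V' ?W t'"
      using Res_Res[OF V(1) W'(1) op(1) _ _ V(3)] Res_Res[OF V'(1) W'(1) op(1) _ _ V'(3)] W'(3,4) by simp
    have prod: "Res X (U \<inter> V) ?W (Res X U (U \<inter> V) s \<otimes>\<^bsub>Sec X (U \<inter> V)\<^esub> Res X V (U \<inter> V) t)
        = Res X U ?W s \<otimes>\<^bsub>Sec X ?W\<^esub> Res X V ?W t"
      if "opn U" "opn V" "opn (U \<inter> V)" "?W \<subseteq> U \<inter> V" "s \<in> carrier (Sec X U)" "t \<in> carrier (Sec X V)" for U V s t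
      using that op(1) by (simp add: Res_mult Res_closed Res_Res)
    show ?thesis
      using prod[OF U(1) V(1) op(2) sub(1) U(3) V(3)] prod[OF U'(1) V'(1) op(3) sub(2) U'(3) V'(3)]
        Rs Rt op sub U V U' V' W(2) W'(2) monoid.m_closed[OF comm_monoid.axioms(1)] cring_Sec
      by (intro germ_eqI[where W = ?W])
        (auto intro!: cring.cring_simprules(5)[OF cring_Sec] Res_closed)
  qed
  then have "(\<Union>(U', s')\<in>germ X x U s. \<Union>(V', t')\<in>germ X x V t.
      germ X x (U' \<inter> V') (Res X U' (U' \<inter> V') s' \<otimes>\<^bsub>Sec X (U' \<inter> V')\<^esub> Res X V' (U' \<inter> V') t'))
    = germ X x (U \<inter> V) (Res X U (U \<inter> V) s \<otimes>\<^bsub>Sec X (U \<inter> V)\<^esub> Res X V (U \<inter> V) t)"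
    by (rule UN_pairs_constant[OF germ_self_mem[OF U] germ_self_mem[OF V]])
  then show ?thesis by (simp add: stalk_def)
qed

text \<open>An inverse of the germ of \<open>f\<close> has a representative, and a germ is the unit element exactly if the section
  equals \<open>1\<close> near \<open>x\<close>. All later arguments about \<open>D(f)\<close> use these local inverses instead of stalks.\<close>

lemma basic_open_iff:
  assumes U: "opn U" and f: "f \<in> carrier (Sec X U)"
  shows "x \<in> basic_open X U f \<longleftrightarrow> (\<exists>W t. opn W \<and> x \<in> W \<and> W \<subseteq> U \<and> t \<in> carrier (Sec X W) \<and>
    Res X U W f \<otimes>\<^bsub>Sec X W\<^esub> t = \<one>\<^bsub>Sec X W\<^esub>)"
proof -
  let ?T = "topspace (Top X)"
  have T: "opn ?T" by simp
  have one: "\<one>\<^bsub>stalk X x\<^esub> = germ X x ?T \<one>\<^bsub>Sec X ?T\<^esub>" by (simp add: stalk_def)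
  have oneT: "\<one>\<^bsub>Sec X V\<^esub> \<in> carrier (Sec X V)" if "opn V" for V
    using cring_Sec[OF that] by (simp add: cring.cring_simprules(6))
  have mult: "s \<otimes>\<^bsub>Sec X V\<^esub> t \<in> carrier (Sec X V)"
    if "opn V" "s \<in> carrier (Sec X V)" "t \<in> carrier (Sec X V)" for V s t
    using that cring.cring_simprules(5)[OF cring_Sec] by simp
  show ?thesis
  proof
    assume "x \<in> basic_open X U f"
    then have x: "x \<in> U" and "germ X x U f \<in> Units (stalk X x)" by (auto simp: basic_open_def)
    then obtain g where "g \<in> carrier (stalk X x)" "germ X x U f \<otimes>\<^bsub>stalk X x\<^esub> g = \<one>\<^bsub>stalk X x\<^esub>"
      by (auto simp: Units_def)
    then obtain V t where V: "opn V" "x \<in> V" "t \<in> carrier (Sec X V)"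
      and eq: "germ X x U f \<otimes>\<^bsub>stalk X x\<^esub> germ X x V t = \<one>\<^bsub>stalk X x\<^esub>"
      by (auto simp: stalk_def)
    let ?p = "Res X U (U \<inter> V) f \<otimes>\<^bsub>Sec X (U \<inter> V)\<^esub> Res X V (U \<inter> V) t"
    have op: "opn (U \<inter> V)" using U V(1) by (rule openin_Int)
    have "germ X x (U \<inter> V) ?p = germ X x ?T \<one>\<^bsub>Sec X ?T\<^esub>"
      using eq stalk_mult_germ[OF U x f V] one by simp
    moreover have "x \<in> ?T" using x U openin_subset by blast
    ultimately obtain W where W: "opn W" "x \<in> W" "W \<subseteq> U \<inter> V \<inter> ?T"
      and eqW: "Res X (U \<inter> V) W ?p = Res X ?T W \<one>\<^bsub>Sec X ?T\<^esub>"
      using germ_eqD[OF T _ oneT[OF T]] by metis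
    have "Res X U W f \<otimes>\<^bsub>Sec X W\<^esub> Res X V W t = \<one>\<^bsub>Sec X W\<^esub>"
      using eqW W U V op f by (simp add: Res_mult Res_closed Res_Res Res_one)
    then show "\<exists>W t. opn W \<and> x \<in> W \<and> W \<subseteq> U \<and> t \<in> carrier (Sec X W) \<and>
        Res X U W f \<otimes>\<^bsub>Sec X W\<^esub> t = \<one>\<^bsub>Sec X W\<^esub>"
      using W V Res_closed[OF V(1) W(1) _ V(3)] by blast
  next
    assume "\<exists>W t. opn W \<and> x \<in> W \<and> W \<subseteq> U \<and> t \<in> carrier (Sec X W) \<and>
        Res X U W f \<otimes>\<^bsub>Sec X W\<^esub> t = \<one>\<^bsub>Sec X W\<^esub>"
    then obtain W t where W: "opn W" "x \<in> W" "W \<subseteq> U" and t: "t \<in> carrier (Sec X W)"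
      and eq: "Res X U W f \<otimes>\<^bsub>Sec X W\<^esub> t = \<one>\<^bsub>Sec X W\<^esub>" by blast
    have fW: "Res X U W f \<in> carrier (Sec X W)" using Res_closed U W f by simp
    have WT: "W \<subseteq> ?T" using W(1) openin_subset by blast
    have one_germ: "germ X x W \<one>\<^bsub>Sec X W\<^esub> = \<one>\<^bsub>stalk X x\<^esub>"
      using germ_Res[OF T W(1) WT W(2) oneT[OF T]] Res_one[OF T W(1) WT] one by simp
    have "germ X x W (Res X U W f) \<otimes>\<^bsub>stalk X x\<^esub> germ X x W t = \<one>\<^bsub>stalk X x\<^esub>"
      using stalk_mult_germ[OF W(1,2) fW W(1,2) t] eq one_germ W(1) fW t by (simp add: Res_id)
    moreover have "germ X x W t \<otimes>\<^bsub>stalk X x\<^esub> germ X x W (Res X U W f) = \<one>\<^bsub>stalk X x\<^esub>"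
      using stalk_mult_germ[OF W(1,2) t W(1,2) fW] eq one_germ W(1) fW t
        cring.cring_simprules(14)[OF cring_Sec[OF W(1)] fW t] by (simp add: Res_id)
    moreover have "germ X x V s \<in> carrier (stalk X x)" if "opn V" "x \<in> V" "s \<in> carrier (Sec X V)" for V s
      using that by (auto simp: stalk_def)
    ultimately have "germ X x W (Res X U W f) \<in> Units (stalk X x)"
      using W fW t unfolding Units_def by blast
    then show "x \<in> basic_open X U f"
      using germ_Res[OF U W(1,3,2) f] W by (auto simp: basic_open_def)
  qed
qed

lemma basic_open_subset: "basic_open X U f \<subseteq> U"
  by (auto simp: basic_open_def)

lemma basic_openI:
  assumes "opn U" "f \<in> carrier (Sec X U)" "opn W" "x \<in> W" "W \<subseteq> U" "Res X U W f \<in> Units (Sec X W)"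
  shows "x \<in> basic_open X U f"
  using assms unfolding basic_open_iff[OF assms(1,2)] Units_def by blast

lemma basic_openE:
  assumes "opn U" "f \<in> carrier (Sec X U)" "x \<in> basic_open X U f"
  obtains W where "opn W" "x \<in> W" "W \<subseteq> U" "Res X U W f \<in> Units (Sec X W)"
proof -
  obtain W t where W: "opn W" "x \<in> W" "W \<subseteq> U" and t: "t \<in> carrier (Sec X W)"
    "Res X U W f \<otimes>\<^bsub>Sec X W\<^esub> t = \<one>\<^bsub>Sec X W\<^esub>"
    using assms(3) unfolding basic_open_iff[OF assms(1,2)] by blast
  have fW: "Res X U W f \<in> carrier (Sec X W)" using Res_closed assms(1,2) W by simp
  have "Res X U W f \<in> Units (Sec X W)"
    using fW t cring.cring_simprules(14)[OF cring_Sec[OF W(1)] fW t(1)] unfolding Units_def by force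
  then show ?thesis using that W by blast
qed

lemma basic_open_open:
  assumes "opn U" "f \<in> carrier (Sec X U)"
  shows "opn (basic_open X U f)"
proof (subst openin_subopen, intro ballI)
  fix x assume "x \<in> basic_open X U f"
  from basic_openE[OF assms this] obtain W where
    W: "opn W" "x \<in> W" "W \<subseteq> U" "Res X U W f \<in> Units (Sec X W)" .
  then show "\<exists>T. opn T \<and> x \<in> T \<and> T \<subseteq> basic_open X U f"
    using basic_openI[OF assms W(1) _ W(3,4)] by blast
qed

lemma basic_open_Res:
  assumes U: "opn U" and V: "opn V" "V \<subseteq> U" and f: "f \<in> carrier (Sec X U)"
  shows "basic_open X V (Res X U V f) = basic_open X U f \<inter> V"
proof (intro equalityI subsetI)
  have fV: "Res X U V f \<in> carrier (Sec X V)" using Res_closed U V f by simp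
  {
    fix x assume x: "x \<in> basic_open X V (Res X U V f)"
    from basic_openE[OF V(1) fV x] obtain W where "opn W" "x \<in> W" "W \<subseteq> V"
      "Res X V W (Res X U V f) \<in> Units (Sec X W)" by blast
    then show "x \<in> basic_open X U f \<inter> V"
      using Res_Res U V f by (auto intro!: basic_openI[where W = W])
  next
    fix x assume x: "x \<in> basic_open X U f \<inter> V"
    then obtain W where W: "opn W" "x \<in> W" "W \<subseteq> U" "Res X U W f \<in> Units (Sec X W)"
      using basic_openE[OF U f] by blast
    have op: "opn (V \<inter> W)" using V(1) W(1) by (rule openin_Int)
    have "Res X V (V \<inter> W) (Res X U V f) = Res X W (V \<inter> W) (Res X U W f)"
      using Res_Res U V W op f by simp
    then show "x \<in> basic_open X V (Res X U V f)"
      using x W op Res_Units[OF W(1) op _ W(4)] by (intro basic_openI[OF V(1) fV op]) auto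
  }
qed

text \<open>Local inverses are unique, so they glue.\<close>

lemma Res_basic_open_Units:
  assumes U: "opn U" and f: "f \<in> carrier (Sec X U)"
  shows "Res X U (basic_open X U f) f \<in> Units (Sec X (basic_open X U f))"
proof -
  let ?D = "basic_open X U f"
  define \<U> where "\<U> = {W. opn W \<and> W \<subseteq> U \<and> Res X U W f \<in> Units (Sec X W)}"
  define i where "i W = inv\<^bsub>Sec X W\<^esub> Res X U W f" for W
  have D: "opn ?D" using basic_open_open U f .
  have UnD: "\<Union>\<U> = ?D"
  proof (intro equalityI subsetI)
    fix x assume "x \<in> \<Union>\<U>"
    then show "x \<in> ?D" using basic_openI[OF U f] by (auto simp: \<U>_def)
  next
    fix x assume "x \<in> ?D"
    from basic_openE[OF U f this] show "x \<in> \<Union>\<U>" by (auto simp: \<U>_def)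
  qed
  have i: "i W \<in> carrier (Sec X W)" "Res X U W f \<otimes>\<^bsub>Sec X W\<^esub> i W = \<one>\<^bsub>Sec X W\<^esub>" if "W \<in> \<U>" for W
  proof -
    interpret cring "Sec X W" using that cring_Sec by (simp add: \<U>_def)
    show "i W \<in> carrier (Sec X W)" "Res X U W f \<otimes>\<^bsub>Sec X W\<^esub> i W = \<one>\<^bsub>Sec X W\<^esub>"
      using that by (simp_all add: \<U>_def i_def)
  qed
  have compat: "Res X V (V \<inter> W) (i V) = Res X W (V \<inter> W) (i W)" if V: "V \<in> \<U>" and W: "W \<in> \<U>" for V W
  proof -
    have op: "opn (V \<inter> W)" and VW: "opn V" "opn W" "V \<subseteq> U" "W \<subseteq> U" using V W by (auto simp: \<U>_def)
    interpret cring "Sec X (V \<inter> W)" using op by (rule cring_Sec)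
    let ?f = "Res X U (V \<inter> W) f"
    have "?f = Res X V (V \<inter> W) (Res X U V f)" "?f = Res X W (V \<inter> W) (Res X U W f)"
      using Res_Res U VW op f by auto
    then have "?f \<otimes>\<^bsub>Sec X (V \<inter> W)\<^esub> Res X V (V \<inter> W) (i V) = \<one>\<^bsub>Sec X (V \<inter> W)\<^esub>"
      "?f \<otimes>\<^bsub>Sec X (V \<inter> W)\<^esub> Res X W (V \<inter> W) (i W) = \<one>\<^bsub>Sec X (V \<inter> W)\<^esub>"
      using i[OF V] i[OF W] U VW op f
      by (metis Int_lower1 Int_lower2 Res_mult Res_one Res_closed)+
    moreover have "?f \<in> carrier (Sec X (V \<inter> W))" using Res_closed U VW op f by auto
    ultimately show ?thesis
      using Res_closed[OF VW(1) op _ i(1)[OF V]] Res_closed[OF VW(2) op _ i(1)[OF W]]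
      by (metis Int_lower1 Int_lower2 inv_unique m_comm)
  qed
  obtain t where t: "t \<in> carrier (Sec X ?D)" "\<And>W. W \<in> \<U> \<Longrightarrow> Res X ?D W t = i W"
    using glue_sections[of \<U> i] i(1) compat unfolding UnD by (metis (mono_tags, lifting) \<U>_def mem_Collect_eq)
  have fD: "Res X U ?D f \<in> carrier (Sec X ?D)" using Res_closed U D basic_open_subset f by blast
  interpret D: cring "Sec X ?D" using D by (rule cring_Sec)
  have "Res X U ?D f \<otimes>\<^bsub>Sec X ?D\<^esub> t = \<one>\<^bsub>Sec X ?D\<^esub>"
  proof (rule section_eqI[OF D])
    fix x assume "x \<in> ?D"
    then obtain W where W: "W \<in> \<U>" "x \<in> W" using UnD by blast
    then have op: "opn W" "W \<subseteq> ?D" "W \<subseteq> U" using UnD by (auto simp: \<U>_def)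
    have "Res X ?D W (Res X U ?D f \<otimes>\<^bsub>Sec X ?D\<^esub> t) = Res X U W f \<otimes>\<^bsub>Sec X W\<^esub> i W"
      using op D U f fD t W by (simp add: Res_mult Res_Res basic_open_subset)
    then show "\<exists>W. opn W \<and> x \<in> W \<and> W \<subseteq> ?D \<and>
        Res X ?D W (Res X U ?D f \<otimes>\<^bsub>Sec X ?D\<^esub> t) = Res X ?D W \<one>\<^bsub>Sec X ?D\<^esub>"
      using op W D i(2)[OF W(1)] Res_one[OF D op(1,2)] by auto
  qed (use fD t in auto)
  then show ?thesis using fD t(1) D.m_comm unfolding Units_def by force
qed

lemma basic_open_mult:
  assumes U: "opn U" and f: "f \<in> carrier (Sec X U)" and g: "g \<in> carrier (Sec X U)"
  shows "basic_open X U (f \<otimes>\<^bsub>Sec X U\<^esub> g) = basic_open X U f \<inter> basic_open X U g"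
proof (intro equalityI subsetI)
  interpret cring "Sec X U" using U by (rule cring_Sec)
  {
    fix x assume x: "x \<in> basic_open X U (f \<otimes>\<^bsub>Sec X U\<^esub> g)"
    have fg: "f \<otimes>\<^bsub>Sec X U\<^esub> g \<in> carrier (Sec X U)" using f g by simp
    from basic_openE[OF U fg x] obtain W where
      W: "opn W" "x \<in> W" "W \<subseteq> U" "Res X U W (f \<otimes>\<^bsub>Sec X U\<^esub> g) \<in> Units (Sec X W)" .
    interpret W: cring "Sec X W" using W(1) by (rule cring_Sec)
    have "Res X U W f \<otimes>\<^bsub>Sec X W\<^esub> Res X U W g \<in> Units (Sec X W)"
      using W U f g by (simp add: Res_mult)
    then have "Res X U W f \<in> Units (Sec X W)" "Res X U W g \<in> Units (Sec X W)"
      using W.unit_factor Res_closed[OF U W(1,3)] f g W.m_comm by metis+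
    then show "x \<in> basic_open X U f \<inter> basic_open X U g"
      using basic_openI[OF U _ W(1,2,3)] f g by blast
  next
    fix x assume x: "x \<in> basic_open X U f \<inter> basic_open X U g"
    let ?W = "basic_open X U f \<inter> basic_open X U g"
    have op: "opn (basic_open X U f)" "opn (basic_open X U g)" using basic_open_open U f g by auto
    then have opW: "opn ?W" by (rule openin_Int)
    have sub: "basic_open X U f \<subseteq> U" "basic_open X U g \<subseteq> U" using basic_open_subset by auto
    interpret W: cring "Sec X ?W" using opW by (rule cring_Sec)
    have "Res X U ?W f \<in> Units (Sec X ?W)"
      using Res_Units[OF op(1) opW _ Res_basic_open_Units[OF U f]] Res_Res[OF U op(1) opW _ sub(1) f] by simp
    moreover have "Res X U ?W g \<in> Units (Sec X ?W)"
      using Res_Units[OF op(2) opW _ Res_basic_open_Units[OF U g]] Res_Res[OF U op(2) opW _ sub(2) g] by simp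
    ultimately have "Res X U ?W (f \<otimes>\<^bsub>Sec X U\<^esub> g) \<in> Units (Sec X ?W)"
      using U opW sub f g by (simp add: Res_mult le_infI1)
    then show "x \<in> basic_open X U (f \<otimes>\<^bsub>Sec X U\<^esub> g)"
      using basic_openI[OF U _ opW x] f g sub by auto
  }
qed

lemma basic_open_Units:
  assumes U: "opn U" and f: "f \<in> Units (Sec X U)"
  shows "basic_open X U f = U"
proof -
  interpret cring "Sec X U" using U by (rule cring_Sec)
  show ?thesis
    using basic_openI[OF U _ U] f Res_id[OF U] basic_open_subset by (metis Units_closed subsetI subset_antisym)
qed

lemma basic_open_pow_subset:
  assumes U: "opn U" and f: "f \<in> carrier (Sec X U)"
  shows "basic_open X U f \<subseteq> basic_open X U (f [^]\<^bsub>Sec X U\<^esub> (n::nat))"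
proof (induction n)
  interpret cring "Sec X U" using U by (rule cring_Sec)
  {
    case 0 show ?case using basic_open_Units[OF U] basic_open_subset by (simp add: Units_one_closed)
  next
    case (Suc n) then show ?case using basic_open_mult[OF U _ f] f by simp
  }
qed

end

section \<open>An intrinsic criterion for affineness\<close>

context ringed_space_locale
begin

text \<open>For \<open>U = Spec A\<close> this is the prime ideal of \<open>A\<close> corresponding to the point \<open>x\<close>, expressed through the
  sets \<open>D(g)\<close> so that it makes sense on every open set.\<close>

definition prime_at :: "'a set \<Rightarrow> 'a \<Rightarrow> 'r set" where
  "prime_at U x = {g \<in> carrier (Sec X U). x \<notin> basic_open X U g}"

text \<open>Conditions on \<open>U\<close> in terms of \<open>A = \<O>(U)\<close> and the sets \<open>D(g)\<close> alone: the points of \<open>U\<close> are the primes of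
  \<open>A\<close>, the sets \<open>D(g)\<close> are a basis, and a section vanishing on \<open>D(f)\<close> is killed by a power of \<open>f\<close>.
  Unlike the existence of an isomorphism with a spectrum, they are easily inherited by \<open>D(f)\<close>.\<close>

definition affine_like :: "'a set \<Rightarrow> bool" where
  "affine_like U \<longleftrightarrow> opn U \<and>
     (\<forall>x\<in>U. primeideal (prime_at U x) (Sec X U)) \<and>
     (\<forall>p. primeideal p (Sec X U) \<longrightarrow> (\<exists>x\<in>U. p = prime_at U x)) \<and>
     inj_on (prime_at U) U \<and>
     (\<forall>W x. opn W \<and> W \<subseteq> U \<and> x \<in> W \<longrightarrow>
        (\<exists>g\<in>carrier (Sec X U). x \<in> basic_open X U g \<and> basic_open X U g \<subseteq> W)) \<and>
     (\<forall>f\<in>carrier (Sec X U). \<forall>b\<in>carrier (Sec X U).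
        Res X U (basic_open X U f) b = \<zero>\<^bsub>Sec X (basic_open X U f)\<^esub> \<longrightarrow>
        (\<exists>n::nat. f [^]\<^bsub>Sec X U\<^esub> n \<otimes>\<^bsub>Sec X U\<^esub> b = \<zero>\<^bsub>Sec X U\<^esub>))"

text \<open>For \<open>F = \<O>\<close> this is the surjectivity of \<open>A\<^sub>f \<rightarrow> \<O>(D(f))\<close>; for a sheaf of ideals \<open>F\<close> it says that
  \<open>F(D(f))\<close> is generated by the image of \<open>F(U)\<close>, which is what quasi-coherence provides.\<close>

definition extends_up_to_powers :: "('a set \<Rightarrow> 'r set) \<Rightarrow> 'a set \<Rightarrow> bool" where
  "extends_up_to_powers F U \<longleftrightarrow>
     (\<forall>f\<in>carrier (Sec X U). \<forall>t\<in>F (basic_open X U f). \<exists>n::nat. \<exists>c\<in>F U.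
        Res X U (basic_open X U f) (f [^]\<^bsub>Sec X U\<^esub> n) \<otimes>\<^bsub>Sec X (basic_open X U f)\<^esub> t
          = Res X U (basic_open X U f) c)"

end

text \<open>An open set \<open>U\<close> with a chosen identification with \<open>Spec R\<close>, along which the two facts about sections of
  \<open>M\<^sup>~\<close> over basic open sets are transported to \<open>U\<close>.\<close>

locale spec_chart = ringed_space_locale X
  for X :: "('a, 'r) ringed_space" +
  fixes U :: "'a set" and R :: "'r ring" (structure) and \<phi> :: "'a \<Rightarrow> 'r set"
    and \<psi> :: "'r set set \<Rightarrow> ('r set \<Rightarrow> ('r \<times> 'r) set) \<Rightarrow> 'r"
  assumes U: "openin (Top X) U"
    and cringR: "cring R"
    and iso: "ringed_space_iso (open_subspace X U) (Spec R) \<phi> \<psi>"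
begin

interpretation cring R by (fact cringR)

abbreviation primes :: "'r set set" where "primes \<equiv> {p. primeideal p R}"

abbreviation pre :: "'r set set \<Rightarrow> 'a set" where "pre V \<equiv> preim (open_subspace X U) \<phi> V"

lemma pre_eq: "pre V = {x \<in> U. \<phi> x \<in> V}"
  using openin_subset[OF U] by (auto simp: preim_def open_subspace_def)

lemma zariski_open_primes: "zariski_open R primes"
  using zariski_open_spec_basic_open[OF one_closed] spec_basic_open_one[OF cringR] by simp

lemma topspace_zariski: "topspace (zariski R) = primes"
  unfolding topspace_def openin_zariski
  using zariski_open_primes zariski_open_primeideal by blast

lemma homeo: "homeomorphic_map (subtopology (Top X) U) (zariski R) \<phi>"
  using iso by (simp add: ringed_space_iso_def open_subspace_def Spec_def)

lemma topspace_U: "topspace (subtopology (Top X) U) = U"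
  using openin_subset[OF U] by auto

lemma chart_bij: "bij_betw \<phi> U primes"
  using homeomorphic_imp_injective_map[OF homeo] homeomorphic_imp_surjective_map[OF homeo]
  unfolding bij_betw_def topspace_U topspace_zariski by blast

lemma pre_subset: "pre V \<subseteq> U" by (auto simp: pre_eq)

lemma pre_open: "zariski_open R V \<Longrightarrow> opn (pre V)"
  using homeomorphic_imp_continuous_map[OF homeo] U openin_trans_full
  unfolding continuous_map_def topspace_U openin_zariski pre_eq by blast

lemma image_open: "opn W \<Longrightarrow> W \<subseteq> U \<Longrightarrow> zariski_open R (\<phi> ` W)"
  using homeomorphic_imp_open_map[OF homeo] unfolding open_map_def openin_zariski
  by (simp add: openin_open_subtopology U)

lemma pre_image: "W \<subseteq> U \<Longrightarrow> pre (\<phi> ` W) = W"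
  using chart_bij by (auto simp: pre_eq bij_betw_def inj_on_def)

lemma pre_primes: "pre primes = U"
  using chart_bij by (auto simp: pre_eq bij_betw_def)

lemma chart_iso: "zariski_open R W \<Longrightarrow> \<psi> W \<in> ring_iso (Sec (Spec R) W) (Sec X (pre W))"
  using iso by (simp add: ringed_space_iso_def open_subspace_def Spec_def openin_zariski)

lemma Sec_Spec_simps:
  "carrier (Sec (Spec R) W) = tilde_sections R (self_module R) W"
  "s \<otimes>\<^bsub>Sec (Spec R) W\<^esub> t = (\<lambda>p\<in>W. s p \<otimes>\<^bsub>loc_ring R (carrier R - p)\<^esub> t p)"
  "s \<oplus>\<^bsub>Sec (Spec R) W\<^esub> t = (\<lambda>p\<in>W. s p \<oplus>\<^bsub>loc_ring R (carrier R - p)\<^esub> t p)"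
  "\<one>\<^bsub>Sec (Spec R) W\<^esub> = (\<lambda>p\<in>W. frac (self_module R) (carrier R - p) \<one> \<one>)"
  by (simp_all add: Spec_def loc_ring_def)

lemma chart_bij_betw:
  "zariski_open R W \<Longrightarrow> bij_betw (\<psi> W) (tilde_sections R (self_module R) W) (carrier (Sec X (pre W)))"
  using chart_iso by (simp add: ring_iso_def Sec_Spec_simps)

lemma chart_restrict:
  "\<lbrakk>zariski_open R W; zariski_open R V; V \<subseteq> W; s \<in> tilde_sections R (self_module R) W\<rbrakk> \<Longrightarrow>
    \<psi> V (restrict s V) = Res X (pre W) (pre V) (\<psi> W s)"
  using iso by (simp add: ringed_space_iso_def open_subspace_def Spec_def openin_zariski)

definition global_fraction :: "'r \<Rightarrow> 'r set \<Rightarrow> ('r \<times> 'r) set" where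
  "global_fraction a = (\<lambda>q\<in>primes. frac (self_module R) (carrier R - q) a \<one>)"

lemma compl_submonoid: "zariski_open R W \<Longrightarrow> q \<in> W \<Longrightarrow> submonoid (carrier R - q) R"
  by (rule primeideal.submonoid_compl) (rule zariski_open_primeideal)

lemma one_notin: "zariski_open R W \<Longrightarrow> q \<in> W \<Longrightarrow> \<one> \<in> carrier R - q"
  using compl_submonoid submonoid.one_closed by blast

lemma global_fraction_section:
  "a \<in> carrier R \<Longrightarrow> global_fraction a \<in> tilde_sections R (self_module R) primes"
  unfolding global_fraction_def
  using one_notin[OF zariski_open_primes] one_closed
  by (intro fraction_tilde_section[OF module_self zariski_open_primes]) simp_all

lemma restrict_global_fraction:
  "W \<subseteq> primes \<Longrightarrow> restrict (global_fraction a) W = (\<lambda>q\<in>W. frac (self_module R) (carrier R - q) a \<one>)"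
  unfolding global_fraction_def by (intro ext) (auto simp: restrict_def)

text \<open>The composite of the canonical map from \<open>R\<close> to the global sections of \<open>Spec R\<close> with the chart.\<close>

definition chart_section :: "'r \<Rightarrow> 'r" where
  "chart_section a = \<psi> primes (global_fraction a)"

lemma Res_chart_section:
  assumes "zariski_open R W" "a \<in> carrier R"
  shows "Res X U (pre W) (chart_section a) = \<psi> W (\<lambda>q\<in>W. frac (self_module R) (carrier R - q) a \<one>)"
proof -
  have W: "W \<subseteq> primes" using zariski_open_primeideal[OF assms(1)] by blast
  show ?thesis
    using chart_restrict[OF zariski_open_primes assms(1) W global_fraction_section[OF assms(2)]]
    by (simp add: restrict_global_fraction[OF W] chart_section_def pre_primes)
qed

text \<open>Every section over \<open>Spec R = D(1)\<close> is a fraction with denominator a power of \<open>1\<close>, and two elements of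
  \<open>R\<close> that agree in all localizations agree after multiplication by a power of \<open>1\<close>.\<close>

lemma chart_section_ring_iso: "chart_section \<in> ring_iso R (Sec X U)"
proof -
  note iso = chart_iso[OF zariski_open_primes, unfolded pre_primes]
  then have hom: "\<psi> primes \<in> ring_hom (Sec (Spec R) primes) (Sec X U)" by (simp add: ring_iso_def)
  note bij = chart_bij_betw[OF zariski_open_primes, unfolded pre_primes]
  note S = compl_submonoid[OF zariski_open_primes]
  note one = one_notin[OF zariski_open_primes]
  have mult: "global_fraction (a \<otimes> b) = global_fraction a \<otimes>\<^bsub>Sec (Spec R) primes\<^esub> global_fraction b"
    if "a \<in> carrier R" "b \<in> carrier R" for a b
    using that S one loc_ring_mult_frac[OF cringR] unfolding global_fraction_def Sec_Spec_simps
    by (intro restrict_ext) simp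
  have add: "global_fraction (a \<oplus> b) = global_fraction a \<oplus>\<^bsub>Sec (Spec R) primes\<^esub> global_fraction b"
    if "a \<in> carrier R" "b \<in> carrier R" for a b
    using that S one loc_ring_add_frac[OF cringR] unfolding global_fraction_def Sec_Spec_simps
    by (intro restrict_ext) simp
  have "chart_section \<in> ring_hom R (Sec X U)"
  proof (rule ring_hom_memI)
    have one: "global_fraction \<one> = \<one>\<^bsub>Sec (Spec R) primes\<^esub>"
      by (simp add: global_fraction_def Sec_Spec_simps(4))
    show "chart_section \<one> = \<one>\<^bsub>Sec X U\<^esub>"
      unfolding chart_section_def one by (rule ring_hom_one[OF hom])
    fix a b assume ab: "a \<in> carrier R" "b \<in> carrier R"
    then have sec: "global_fraction a \<in> carrier (Sec (Spec R) primes)" "global_fraction b \<in> carrier (Sec (Spec R) primes)"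
      using global_fraction_section by (simp_all add: Sec_Spec_simps(1))
    show "chart_section a \<in> carrier (Sec X U)"
      unfolding chart_section_def by (rule ring_hom_closed[OF hom sec(1)])
    show "chart_section (a \<otimes> b) = chart_section a \<otimes>\<^bsub>Sec X U\<^esub> chart_section b"
      unfolding chart_section_def mult[OF ab] by (rule ring_hom_mult[OF hom sec])
    show "chart_section (a \<oplus> b) = chart_section a \<oplus>\<^bsub>Sec X U\<^esub> chart_section b"
      unfolding chart_section_def add[OF ab] by (rule ring_hom_add[OF hom sec])
  qed
  moreover have "bij_betw global_fraction (carrier R) (tilde_sections R (self_module R) primes)"
  proof (intro bij_betw_imageI inj_onI equalityI subsetI)
    fix a b assume ab: "a \<in> carrier R" "b \<in> carrier R" and eq: "global_fraction a = global_fraction b"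
    have "\<exists>n::nat. \<one> [^] n \<odot>\<^bsub>self_module R\<^esub> (\<one> \<odot>\<^bsub>self_module R\<^esub> a)
        = \<one> [^] n \<odot>\<^bsub>self_module R\<^esub> (\<one> \<odot>\<^bsub>self_module R\<^esub> b)"
    proof (rule frac_eq_on_spec_basic_openD[OF module_self])
      fix q assume "q \<in> spec_basic_open R \<one>"
      then have q: "q \<in> primes" by (simp add: spec_basic_open_def)
      show "\<one> \<notin> q \<and> \<one> \<notin> q \<and> frac (self_module R) (carrier R - q) a \<one> = frac (self_module R) (carrier R - q) b \<one>"
        using one[OF q] fun_cong[OF eq, of q] q by (simp add: global_fraction_def)
    qed (use ab in auto)
    then show "a = b" using ab by simp
  next
    fix s assume s: "s \<in> tilde_sections R (self_module R) primes"
    then obtain n :: nat and m where m: "m \<in> carrier R"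
      "\<forall>q\<in>primes. s q = frac (self_module R) (carrier R - q) m (\<one> [^] n)"
      using tilde_section_basic_open_is_fraction[OF module_self one_closed, of s]
      by (auto simp: spec_basic_open_one[OF cringR])
    have "s \<in> extensional primes" using s by (auto simp: tilde_sections_def PiE_def)
    then have "s = global_fraction m"
      using m(2) by (intro extensionalityI[where A = primes]) (auto simp: global_fraction_def)
    then show "s \<in> global_fraction ` carrier R" using m(1) by blast
  qed (auto simp: global_fraction_section)
  moreover have "chart_section = \<psi> primes \<circ> global_fraction"
    by (simp add: fun_eq_iff chart_section_def)
  ultimately show ?thesis
    using bij_betw_trans[OF _ bij] by (simp add: ring_iso_def)
qed

lemma chart_section_hom: "chart_section \<in> ring_hom R (Sec X U)"
  using chart_section_ring_iso by (simp add: ring_iso_def)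

lemma chart_section_bij: "bij_betw chart_section (carrier R) (carrier (Sec X U))"
  using chart_section_ring_iso by (simp add: ring_iso_def)

text \<open>If \<open>a\<close> is outside the prime, then \<open>1/a\<close> is an inverse on \<open>D(a)\<close>. Conversely an inverse near the point
  may be taken to be a single fraction \<open>m/h\<close>, and \<open>am/h = 1\<close> in the localization at the point
  forces \<open>a\<close> to be outside the prime.\<close>

lemma basic_open_chart_section:
  assumes a: "a \<in> carrier R"
  shows "basic_open X U (chart_section a) = pre (spec_basic_open R a)"
proof (intro equalityI subsetI)
  have ca: "chart_section a \<in> carrier (Sec X U)" using chart_section_bij a by (auto simp: bij_betw_def)
  let ?M = "self_module R"
  {
    fix x assume x: "x \<in> basic_open X U (chart_section a)"
    then obtain W t where W: "opn W" "x \<in> W" "W \<subseteq> U" and t: "t \<in> carrier (Sec X W)"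
      and eq: "Res X U W (chart_section a) \<otimes>\<^bsub>Sec X W\<^esub> t = \<one>\<^bsub>Sec X W\<^esub>"
      using basic_open_iff[OF U ca] by blast
    have V: "zariski_open R (\<phi> ` W)" using image_open W by blast
    \<comment> \<open>the inverse \<open>t\<close>, seen on the spectrum, is shrunk until it is a single fraction \<open>m/h\<close>\<close>
    obtain s where s: "s \<in> tilde_sections R ?M (\<phi> ` W)" "t = \<psi> (\<phi> ` W) s"
      using chart_bij_betw[OF V] t unfolding pre_image[OF W(3)] bij_betw_def by blast
    obtain m h where m: "m \<in> carrier ?M" and h: "h \<in> carrier R" "\<phi> x \<in> spec_basic_open R h"
      "spec_basic_open R h \<subseteq> \<phi> ` W"
      and sh: "\<And>q. q \<in> spec_basic_open R h \<Longrightarrow> s q = frac ?M (carrier R - q) m h"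
      by (rule tilde_section_local[OF module_self s(1) imageI[OF W(2)]]) (rule that)
    then have m: "m \<in> carrier R" by simp
    let ?V = "spec_basic_open R h"
    have V': "zariski_open R ?V" using zariski_open_spec_basic_open h(1) .
    have hq: "h \<in> carrier R - q" if "q \<in> ?V" for q using that h(1) by (simp add: spec_basic_open_def)
    have sub: "pre ?V \<subseteq> W" using h(3) pre_image[OF W(3)] by (auto simp: pre_eq)
    note op = pre_open[OF V']
    have sV: "restrict s ?V = (\<lambda>q\<in>?V. frac ?M (carrier R - q) m h)"
      using sh by (intro restrict_ext)
    have tV: "Res X W (pre ?V) t = \<psi> ?V (\<lambda>q\<in>?V. frac ?M (carrier R - q) m h)"
      using chart_restrict[OF V V' h(3) s(1)] s(2) sV pre_image[OF W(3)] by simp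
    have aV: "Res X U (pre ?V) (chart_section a) = \<psi> ?V (\<lambda>q\<in>?V. frac ?M (carrier R - q) a \<one>)"
      using Res_chart_section[OF V' a] .
    have sec: "(\<lambda>q\<in>?V. frac ?M (carrier R - q) b c) \<in> tilde_sections R ?M ?V"
      if "b \<in> carrier R" "\<And>q. q \<in> ?V \<Longrightarrow> c \<in> carrier R - q" "c \<in> carrier R" for b c
      using that by (intro fraction_tilde_section[OF module_self V']) auto
    note hom = chart_iso[OF V', THEN ring_iso_memE(2)] ring_iso_memE(4)[OF chart_iso[OF V']]
    have "\<psi> ?V (\<lambda>q\<in>?V. frac ?M (carrier R - q) (a \<otimes> m) (\<one> \<otimes> h))
      = \<psi> ?V ((\<lambda>q\<in>?V. frac ?M (carrier R - q) a \<one>) \<otimes>\<^bsub>Sec (Spec R) ?V\<^esub> (\<lambda>q\<in>?V. frac ?M (carrier R - q) m h))"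
      using loc_ring_mult_frac[OF cringR compl_submonoid[OF V']] a m hq one_notin[OF V']
      unfolding Sec_Spec_simps by (intro arg_cong[where f = "\<psi> ?V"] restrict_ext) simp
    also have "\<dots> = Res X U (pre ?V) (chart_section a) \<otimes>\<^bsub>Sec X (pre ?V)\<^esub> Res X W (pre ?V) t"
      unfolding tV aV
      by (rule ring_iso_memE(2)[OF chart_iso[OF V']])
        (use sec[OF a one_notin[OF V']] sec[OF m hq] h(1) in \<open>simp_all add: Sec_Spec_simps(1)\<close>)
    also have "\<dots> = Res X W (pre ?V) (Res X U W (chart_section a) \<otimes>\<^bsub>Sec X W\<^esub> t)"
      using W U op sub t ca by (simp add: Res_mult Res_Res Res_closed)
    also have "\<dots> = \<psi> ?V (\<lambda>q\<in>?V. frac ?M (carrier R - q) \<one> \<one>)"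
      using eq Res_one[OF W(1) op sub] hom(2) by (simp add: Sec_Spec_simps)
    finally have "(\<lambda>q\<in>?V. frac ?M (carrier R - q) (a \<otimes> m) h) = (\<lambda>q\<in>?V. frac ?M (carrier R - q) \<one> \<one>)"
      using chart_bij_betw[OF V'] sec[OF _ hq, of "a \<otimes> m"] sec[OF _ one_notin[OF V'], of \<one>] a m h(1)
      by (simp add: bij_betw_def inj_on_def)
    from fun_cong[OF this, of "\<phi> x"] have "frac ?M (carrier R - \<phi> x) (a \<otimes> m) h = frac ?M (carrier R - \<phi> x) \<one> \<one>"
      using h(2) by simp
    then obtain u where u: "u \<in> carrier R - \<phi> x" "u \<otimes> (a \<otimes> m) = u \<otimes> h"
      using frac_eq_iff[OF module_self compl_submonoid[OF V' h(2)], of "a \<otimes> m" \<one> h \<one>]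
        hq[OF h(2)] one_notin[OF V' h(2)] a m h(1) by auto
    interpret p: primeideal "\<phi> x" R using zariski_open_primeideal[OF V' h(2)] .
    have "a \<notin> \<phi> x"
    proof
      assume "a \<in> \<phi> x"
      then have "u \<otimes> h \<in> \<phi> x" using u m p.I_r_closed p.I_l_closed by (metis DiffE)
      then show False using u(1) hq[OF h(2)] p.I_prime by blast
    qed
    then show "x \<in> pre (spec_basic_open R a)"
      using x basic_open_subset p.primeideal unfolding pre_eq spec_basic_open_def by blast
  next
    let ?V = "spec_basic_open R a"
    fix x assume x: "x \<in> pre ?V"
    have V: "zariski_open R ?V" using zariski_open_spec_basic_open a .
    have aq: "a \<in> carrier R - q" if "q \<in> ?V" for q using that a by (simp add: spec_basic_open_def)
    let ?s = "\<lambda>q\<in>?V. frac ?M (carrier R - q) \<one> a" and ?a = "\<lambda>q\<in>?V. frac ?M (carrier R - q) a \<one>"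
    have sec: "?s \<in> tilde_sections R ?M ?V" "?a \<in> tilde_sections R ?M ?V"
      using aq one_notin[OF V] a by (auto intro!: fraction_tilde_section[OF module_self V])
    note iso = chart_iso[OF V]
    have t: "\<psi> ?V ?s \<in> carrier (Sec X (pre ?V))"
      using ring_iso_memE(1)[OF iso] sec(1) by (simp add: Sec_Spec_simps)
    have "frac ?M (carrier R - q) (a \<otimes> \<one>) (\<one> \<otimes> a) = frac ?M (carrier R - q) \<one> \<one>" if q: "q \<in> ?V" for q
      using frac_cancel[OF module_self compl_submonoid[OF V q], of \<one> \<one> a] aq[OF q] one_notin[OF V q] by simp
    then have "?a \<otimes>\<^bsub>Sec (Spec R) ?V\<^esub> ?s = \<one>\<^bsub>Sec (Spec R) ?V\<^esub>"
      unfolding Sec_Spec_simps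
      using loc_ring_mult_frac[OF cringR compl_submonoid[OF V]] a aq one_notin[OF V]
      by (intro restrict_ext) simp
    then have "\<psi> ?V (?a \<otimes>\<^bsub>Sec (Spec R) ?V\<^esub> ?s) = \<one>\<^bsub>Sec X (pre ?V)\<^esub>"
      using ring_iso_memE(4)[OF iso] by (simp only:)
    moreover have "\<psi> ?V (?a \<otimes>\<^bsub>Sec (Spec R) ?V\<^esub> ?s) = \<psi> ?V ?a \<otimes>\<^bsub>Sec X (pre ?V)\<^esub> \<psi> ?V ?s"
      by (rule ring_iso_memE(2)[OF iso]) (simp_all only: sec Sec_Spec_simps(1))
    ultimately have "Res X U (pre ?V) (chart_section a) \<otimes>\<^bsub>Sec X (pre ?V)\<^esub> \<psi> ?V ?s = \<one>\<^bsub>Sec X (pre ?V)\<^esub>"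
      unfolding Res_chart_section[OF V a] by (simp only:)
    then show "x \<in> basic_open X U (chart_section a)"
      using basic_open_iff[OF U ca] pre_open[OF V] x pre_subset t by blast
  }
qed

text \<open>A section over \<open>D(a)\<close> is a fraction \<open>m/a\<^sup>n\<close>, and \<open>m\<close> itself is a global section. The sheaf is described
  through its isomorphism \<open>\<eta>\<close> with \<open>M\<^sup>~\<close> so that the statement covers both the structure sheaf and
  a quasi-coherent sheaf of ideals.\<close>

lemma extends_up_to_powers_chart:
  fixes M :: "('r, 'm) module" and \<eta> :: "'r set set \<Rightarrow> ('r set \<Rightarrow> ('m \<times> 'r) set) \<Rightarrow> 'r" and F :: "'a set \<Rightarrow> 'r set"
  assumes M: "Module.module R M"
    and bij: "\<And>W. zariski_open R W \<Longrightarrow> bij_betw (\<eta> W) (tilde_sections R M W) (F (pre W))"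
    and smult: "\<And>W a s. \<lbrakk>zariski_open R W; a \<in> tilde_sections R (self_module R) W; s \<in> tilde_sections R M W\<rbrakk>
      \<Longrightarrow> \<eta> W (\<lambda>q\<in>W. a q \<odot>\<^bsub>loc_module R M (carrier R - q)\<^esub> s q) = \<psi> W a \<otimes>\<^bsub>Sec X (pre W)\<^esub> \<eta> W s"
    and restr: "\<And>V W s. \<lbrakk>zariski_open R W; zariski_open R V; V \<subseteq> W; s \<in> tilde_sections R M W\<rbrakk>
      \<Longrightarrow> \<eta> V (restrict s V) = Res X (pre W) (pre V) (\<eta> W s)"
  shows "extends_up_to_powers F U"
  unfolding extends_up_to_powers_def
proof (intro ballI)
  interpret M: Module.module R M by (fact M)
  fix f t assume f: "f \<in> carrier (Sec X U)" and t: "t \<in> F (basic_open X U f)"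
  obtain a where a: "a \<in> carrier R" "f = chart_section a"
    using f chart_section_bij unfolding bij_betw_def by blast
  let ?V = "spec_basic_open R a"
  have V: "zariski_open R ?V" using zariski_open_spec_basic_open a(1) .
  have VP: "?V \<subseteq> primes" by (auto simp: spec_basic_open_def)
  have D: "basic_open X U f = pre ?V" using basic_open_chart_section a by simp
  obtain s where s: "s \<in> tilde_sections R M ?V" "t = \<eta> ?V s"
    using t bij[OF V] unfolding D bij_betw_def by blast
  obtain n :: nat and m where m: "m \<in> carrier M"
    and sm: "\<And>q. q \<in> ?V \<Longrightarrow> s q = frac M (carrier R - q) m (a [^] n)"
    using tilde_section_basic_open_is_fraction[OF M a(1) s(1)] by blast
  let ?m = "\<lambda>q\<in>primes. frac M (carrier R - q) m \<one>"
  have msec: "?m \<in> tilde_sections R M primes"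
    using one_notin[OF zariski_open_primes]
    by (intro fraction_tilde_section[OF M zariski_open_primes m]) auto
  let ?c = "\<eta> primes ?m"
  have c: "?c \<in> F U" using bij[OF zariski_open_primes] msec unfolding pre_primes bij_betw_def by blast
  have an: "a [^] n \<in> carrier R" using a(1) by simp
  have "chart_section (a [^] n) = f [^]\<^bsub>Sec X U\<^esub> n"
  proof -
    interpret h: ring_hom_cring R "Sec X U" chart_section
      using chart_section_hom cringR cring_Sec[OF U] by (simp add: ring_hom_cring_def ring_hom_cring_axioms_def)
    show ?thesis using a by simp
  qed
  then have fn: "Res X U (pre ?V) (f [^]\<^bsub>Sec X U\<^esub> n) = \<psi> ?V (\<lambda>q\<in>?V. frac (self_module R) (carrier R - q) (a [^] n) \<one>)"
    using Res_chart_section[OF V an] by simp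
  have asec: "(\<lambda>q\<in>?V. frac (self_module R) (carrier R - q) (a [^] n) \<one>) \<in> tilde_sections R (self_module R) ?V"
    using one_notin[OF V] an by (intro fraction_tilde_section[OF module_self V]) auto
  have "frac (self_module R) (carrier R - q) (a [^] n) \<one> \<odot>\<^bsub>loc_module R M (carrier R - q)\<^esub> s q
      = frac M (carrier R - q) m \<one>" if q: "q \<in> ?V" for q
    using loc_module_smult_frac[OF M compl_submonoid[OF V q] an, of \<one> m "a [^] n"] m sm[OF q] an
      one_notin[OF V q] spec_basic_open_pow[OF cringR a(1) q, of n]
      frac_cancel[OF M compl_submonoid[OF V q] m, of \<one> "a [^] n"] by simp
  then have "(\<lambda>q\<in>?V. (\<lambda>q\<in>?V. frac (self_module R) (carrier R - q) (a [^] n) \<one>) q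
      \<odot>\<^bsub>loc_module R M (carrier R - q)\<^esub> s q) = restrict ?m ?V"
    using VP by (intro ext) (auto simp: restrict_def)
  then have "Res X U (pre ?V) (f [^]\<^bsub>Sec X U\<^esub> n) \<otimes>\<^bsub>Sec X (pre ?V)\<^esub> t = Res X U (pre ?V) ?c"
    using smult[OF V asec s(1)] restr[OF zariski_open_primes V VP msec] fn s(2) pre_primes by simp
  then show "\<exists>n::nat. \<exists>c\<in>F U. Res X U (basic_open X U f) (f [^]\<^bsub>Sec X U\<^esub> n) \<otimes>\<^bsub>Sec X (basic_open X U f)\<^esub> t
      = Res X U (basic_open X U f) c"
    using c unfolding D by blast
qed

lemma extends_up_to_powers_Sec: "extends_up_to_powers (\<lambda>V. carrier (Sec X V)) U"
proof (rule extends_up_to_powers_chart[OF module_self, where \<eta> = \<psi>])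
  fix W a s assume W: "zariski_open R W" and a: "a \<in> tilde_sections R (self_module R) W"
    and s: "s \<in> tilde_sections R (self_module R) W"
  have "(\<lambda>q\<in>W. a q \<odot>\<^bsub>loc_module R (self_module R) (carrier R - q)\<^esub> s q) = a \<otimes>\<^bsub>Sec (Spec R) W\<^esub> s"
    by (simp add: Sec_Spec_simps loc_module_def loc_ring_def)
  then show "\<psi> W (\<lambda>q\<in>W. a q \<odot>\<^bsub>loc_module R (self_module R) (carrier R - q)\<^esub> s q)
      = \<psi> W a \<otimes>\<^bsub>Sec X (pre W)\<^esub> \<psi> W s"
    using ring_iso_memE(2)[OF chart_iso[OF W]] a s by (simp add: Sec_Spec_simps(1))
qed (fact chart_bij_betw chart_restrict)+

lemma prime_at_chart:
  assumes "x \<in> U" shows "prime_at U x = chart_section ` \<phi> x"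
proof -
  have prime: "primeideal (\<phi> x) R" using chart_bij assms by (auto simp: bij_betw_def)
  then have sub: "\<phi> x \<subseteq> carrier R"
    by (meson additive_subgroup.a_subset ideal.axioms(1) primeideal.axioms(1))
  have "chart_section a \<in> prime_at U x \<longleftrightarrow> a \<in> \<phi> x" if a: "a \<in> carrier R" for a
    using assms prime bij_betwE[OF chart_section_bij] a
    by (simp add: prime_at_def basic_open_chart_section[OF a] pre_eq spec_basic_open_def)
  note iff = this
  show ?thesis
  proof (intro equalityI subsetI)
    fix g assume g: "g \<in> prime_at U x"
    then have "g \<in> chart_section ` carrier R"
      using chart_section_bij by (simp add: bij_betw_def prime_at_def)
    then show "g \<in> chart_section ` \<phi> x" using iff g by blast
  qed (use iff sub in blast)
qed

theorem affine_like_chart: "affine_like U"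
  unfolding affine_like_def
proof (intro conjI ballI allI impI)
  interpret S: cring "Sec X U" using U by (rule cring_Sec)
  interpret h: ring_hom_cring R "Sec X U" chart_section
    using chart_section_hom cringR cring_Sec[OF U] by (simp add: ring_hom_cring_def ring_hom_cring_axioms_def)
  have inj: "inj_on chart_section (carrier R)" and surj: "chart_section ` carrier R = carrier (Sec X U)"
    using chart_section_bij by (auto simp: bij_betw_def)
  let ?inv = "inv_into (carrier R) chart_section"
  have prime_sub: "p \<subseteq> carrier R" if "primeideal p R" for p
    using that by (meson additive_subgroup.a_subset ideal.axioms(1) primeideal.axioms(1))
  have prime: "primeideal (\<phi> x) R" if "x \<in> U" for x
    using chart_bij that by (auto simp: bij_betw_def)
  show "opn U" by (fact U)
  show "primeideal (prime_at U x) (Sec X U)" if x: "x \<in> U" for x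
  proof -
    have "?inv \<in> ring_hom (Sec X U) R"
      using ring_iso_set_sym[OF ring_axioms chart_section_ring_iso] by (simp add: ring_iso_def)
    then have "ring_hom_ring (Sec X U) R ?inv"
      by (simp add: ring_hom_ring_def ring_hom_ring_axioms_def S.ring_axioms ring_axioms)
    from ring_hom_ring.primeideal_vimage[OF this S.is_cring prime[OF x]]
    have "primeideal {r \<in> carrier (Sec X U). ?inv r \<in> \<phi> x} (Sec X U)" .
    moreover have "{r \<in> carrier (Sec X U). ?inv r \<in> \<phi> x} = chart_section ` \<phi> x"
    proof (intro equalityI subsetI)
      fix r assume r: "r \<in> {r \<in> carrier (Sec X U). ?inv r \<in> \<phi> x}"
      then have "r = chart_section (?inv r)" using f_inv_into_f[of r chart_section] surj by simp
      then show "r \<in> chart_section ` \<phi> x" using r by blast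
    next
      fix r assume "r \<in> chart_section ` \<phi> x"
      then obtain a where a: "a \<in> \<phi> x" "a \<in> carrier R" "r = chart_section a"
        using prime_sub[OF prime[OF x]] by blast
      then show "r \<in> {r \<in> carrier (Sec X U). ?inv r \<in> \<phi> x}"
        using inv_into_f_f[OF inj a(2)] by simp
    qed
    ultimately show ?thesis using prime_at_chart[OF x] by simp
  qed
  show "\<exists>x\<in>U. p = prime_at U x" if p: "primeideal p (Sec X U)" for p
  proof -
    have "ring_hom_ring R (Sec X U) chart_section"
      using chart_section_hom by (simp add: ring_hom_ring_def ring_hom_ring_axioms_def S.ring_axioms ring_axioms)
    from ring_hom_ring.primeideal_vimage[OF this is_cring p]
    have "{r \<in> carrier R. chart_section r \<in> p} \<in> \<phi> ` U" using chart_bij by (simp add: bij_betw_def)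
    then obtain x where x: "x \<in> U" "\<phi> x = {r \<in> carrier R. chart_section r \<in> p}" by force
    have sub: "p \<subseteq> carrier (Sec X U)"
      using p by (meson additive_subgroup.a_subset ideal.axioms(1) primeideal.axioms(1))
    have "chart_section ` \<phi> x = p"
    proof (intro equalityI subsetI)
      fix g assume g: "g \<in> p"
      then have "g \<in> chart_section ` carrier R" using surj sub by blast
      then show "g \<in> chart_section ` \<phi> x" using g x(2) by auto
    qed (auto simp: x(2))
    then show ?thesis using prime_at_chart[OF x(1)] x(1) by blast
  qed
  show "inj_on (prime_at U) U"
  proof (rule inj_onI)
    fix x y assume xy: "x \<in> U" "y \<in> U" "prime_at U x = prime_at U y"
    then have "chart_section ` \<phi> x = chart_section ` \<phi> y" using prime_at_chart by simp
    then have "\<phi> x = \<phi> y"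
      using inj_on_image_eq_iff[OF inj prime_sub[OF prime] prime_sub[OF prime]] xy by blast
    then show "x = y" using chart_bij xy by (auto simp: bij_betw_def inj_on_def)
  qed
  show "\<exists>g\<in>carrier (Sec X U). x \<in> basic_open X U g \<and> basic_open X U g \<subseteq> W"
    if W: "opn W \<and> W \<subseteq> U \<and> x \<in> W" for W x
  proof -
    obtain h where h: "h \<in> carrier R" "\<phi> x \<in> spec_basic_open R h" "spec_basic_open R h \<subseteq> \<phi> ` W"
      using spec_basic_open_basis[OF image_open[of W], of "\<phi> x"] W by blast
    have "pre (spec_basic_open R h) \<subseteq> W" using h(3) pre_image[of W] W by (auto simp: pre_eq)
    moreover have "x \<in> pre (spec_basic_open R h)" using h(2) W by (auto simp: pre_eq)
    ultimately show ?thesis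
      using basic_open_chart_section[OF h(1)] h(1) surj by (intro bexI[of _ "chart_section h"]) auto
  qed
  show "\<exists>n::nat. f [^]\<^bsub>Sec X U\<^esub> n \<otimes>\<^bsub>Sec X U\<^esub> b = \<zero>\<^bsub>Sec X U\<^esub>"
    if f: "f \<in> carrier (Sec X U)" and b: "b \<in> carrier (Sec X U)"
      and eq: "Res X U (basic_open X U f) b = \<zero>\<^bsub>Sec X (basic_open X U f)\<^esub>" for f b
  proof -
    obtain a r where a: "a \<in> carrier R" "f = chart_section a" and r: "r \<in> carrier R" "b = chart_section r"
      using f b surj by blast
    let ?V = "spec_basic_open R a"
    have V: "zariski_open R ?V" using zariski_open_spec_basic_open a(1) .
    have D: "basic_open X U f = pre ?V" using basic_open_chart_section a by simp
    have sec: "(\<lambda>q\<in>?V. frac (self_module R) (carrier R - q) c \<one>) \<in> tilde_sections R (self_module R) ?V"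
      if "c \<in> carrier R" for c
      using one_notin[OF V] that by (intro fraction_tilde_section[OF module_self V]) auto
    have "Res X U (pre ?V) (chart_section r) = Res X U (pre ?V) (chart_section \<zero>)"
      using eq r Res_zero[OF U pre_open[OF V] pre_subset] by (simp add: D)
    then have "\<psi> ?V (\<lambda>q\<in>?V. frac (self_module R) (carrier R - q) r \<one>)
        = \<psi> ?V (\<lambda>q\<in>?V. frac (self_module R) (carrier R - q) \<zero> \<one>)"
      unfolding Res_chart_section[OF V r(1)] Res_chart_section[OF V zero_closed] .
    then have eq_fun: "(\<lambda>q\<in>?V. frac (self_module R) (carrier R - q) r \<one>)
        = (\<lambda>q\<in>?V. frac (self_module R) (carrier R - q) \<zero> \<one>)"
      using chart_bij_betw[OF V] sec[OF r(1)] sec[OF zero_closed] by (simp add: bij_betw_def inj_on_def)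
    have "\<exists>n::nat. a [^] n \<odot>\<^bsub>self_module R\<^esub> (\<one> \<odot>\<^bsub>self_module R\<^esub> r)
        = a [^] n \<odot>\<^bsub>self_module R\<^esub> (\<one> \<odot>\<^bsub>self_module R\<^esub> \<zero>)"
    proof (rule frac_eq_on_spec_basic_openD[OF module_self])
      fix q assume q: "q \<in> ?V"
      show "\<one> \<notin> q \<and> \<one> \<notin> q \<and> frac (self_module R) (carrier R - q) r \<one> = frac (self_module R) (carrier R - q) \<zero> \<one>"
        using one_notin[OF V q] fun_cong[OF eq_fun, of q] q by simp
    qed (use a r in auto)
    then obtain n :: nat where "a [^] n \<otimes> r = \<zero>" using a r by auto
    then have "chart_section (a [^] n \<otimes> r) = \<zero>\<^bsub>Sec X U\<^esub>" by simp
    then show ?thesis using a r by (intro exI[of _ n]) simp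
  qed
qed

end

section \<open>Affineness of basic open sets\<close>

lemma (in cring) Units_mult_eq_zero:
  assumes "\<zero> = u \<otimes> a" "u \<in> Units R" "a \<in> carrier R"
  shows "a = \<zero>"
  using Units_l_cancel[OF assms(2,3) zero_closed] assms(1)[symmetric] r_null[OF Units_closed[OF assms(2)]] by simp

lemma (in cring) m_interchange:
  assumes "a \<in> carrier R" "b \<in> carrier R" "c \<in> carrier R" "d \<in> carrier R"
  shows "(a \<otimes> b) \<otimes> (c \<otimes> d) = (a \<otimes> c) \<otimes> (b \<otimes> d)"
  using assms by (simp add: m_ac)

lemma (in cring) nat_pow_mult_mult:
  assumes "u \<in> carrier R" "v \<in> carrier R" "g \<in> carrier R"
  shows "(u \<otimes> (v \<otimes> g)) [^] (n::nat) = (u [^] n \<otimes> v [^] n) \<otimes> g [^] n"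
  using assms by (simp add: nat_pow_distrib m_assoc)

context ringed_space_locale
begin

lemma affine_like_torsion:
  assumes "affine_like U" "f \<in> carrier (Sec X U)" "b \<in> carrier (Sec X U)"
    and "Res X U (basic_open X U f) b = \<zero>\<^bsub>Sec X (basic_open X U f)\<^esub>"
  obtains n :: nat where "f [^]\<^bsub>Sec X U\<^esub> n \<otimes>\<^bsub>Sec X U\<^esub> b = \<zero>\<^bsub>Sec X U\<^esub>"
  using assms unfolding affine_like_def by meson

lemma affine_like_basis:
  assumes "affine_like U" "opn W" "W \<subseteq> U" "x \<in> W"
  obtains g where "g \<in> carrier (Sec X U)" "x \<in> basic_open X U g" "basic_open X U g \<subseteq> W"
  using assms unfolding affine_like_def by meson

lemma extends_up_to_powersE:
  assumes "extends_up_to_powers F U" "f \<in> carrier (Sec X U)" "t \<in> F (basic_open X U f)"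
  obtains n :: nat and c where "c \<in> F U"
    "Res X U (basic_open X U f) (f [^]\<^bsub>Sec X U\<^esub> n) \<otimes>\<^bsub>Sec X (basic_open X U f)\<^esub> t
      = Res X U (basic_open X U f) c"
  using assms unfolding extends_up_to_powers_def by meson

lemma section_Units_cancel:
  assumes "opn W" "u \<in> Units (Sec X W)" "s \<in> carrier (Sec X W)" "t \<in> carrier (Sec X W)"
    and "u \<otimes>\<^bsub>Sec X W\<^esub> s = u \<otimes>\<^bsub>Sec X W\<^esub> t"
  shows "s = t"
proof -
  interpret cring "Sec X W" using assms(1) by (rule cring_Sec)
  show ?thesis using assms by simp
qed

definition ideal_presheaf :: "('a set \<Rightarrow> 'r set) \<Rightarrow> bool" where
  "ideal_presheaf F \<longleftrightarrow> (\<forall>V. opn V \<longrightarrow> ideal (F V) (Sec X V)) \<and>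
     (\<forall>V W s. opn V \<and> opn W \<and> W \<subseteq> V \<and> s \<in> F V \<longrightarrow> Res X V W s \<in> F W)"

lemma ideal_presheaf_Sec: "ideal_presheaf (\<lambda>V. carrier (Sec X V))"
  unfolding ideal_presheaf_def
  using ring.oneideal[OF cring.axioms(1)[OF cring_Sec]] Res_closed by blast

text \<open>Affineness in intrinsic terms; \<open>affine_open_iff_criterion\<close> shows that it agrees with \<open>affine_open\<close>.\<close>

definition affine_criterion :: "'a set \<Rightarrow> bool" where
  "affine_criterion U \<longleftrightarrow> affine_like U \<and> extends_up_to_powers (\<lambda>V. carrier (Sec X V)) U"

end

locale affine_basic_open = ringed_space_locale X
  for X :: "('a, 'r) ringed_space" +
  fixes U :: "'a set" and f :: 'r
  assumes crit: "affine_criterion U" and f: "f \<in> carrier (Sec X U)"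
begin

abbreviation D where "D \<equiv> basic_open X U f"

lemma affU: "affine_like U" and extU: "extends_up_to_powers (\<lambda>V. carrier (Sec X V)) U"
  using crit by (simp_all add: affine_criterion_def)

lemma U: "opn U" using affU by (simp add: affine_like_def)

lemma D: "opn D" using basic_open_open U f .

lemma DU: "D \<subseteq> U" by (rule basic_open_subset)

sublocale A: cring "Sec X U" using U by (rule cring_Sec)
sublocale B: cring "Sec X D" using D by (rule cring_Sec)
sublocale h: ring_hom_cring "Sec X U" "Sec X D" "Res X U D" using U D DU by (rule Res_hom_cring)

lemma unit: "Res X U D f \<in> Units (Sec X D)" using Res_basic_open_Units U f .

lemma unit_pow: "Res X U D f [^]\<^bsub>Sec X D\<^esub> (n::nat) \<in> Units (Sec X D)"
  using unit by (rule B.Units_pow_closed)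

lemma basic_open_inside:
  "g \<in> carrier (Sec X U) \<Longrightarrow> basic_open X D (Res X U D g) = basic_open X U g \<inter> D"
  using basic_open_Res U D DU by blast

text \<open>The relation \<open>b = r / f\<^sup>n\<close> in \<open>\<O>(D(f))\<close>, with the denominator cleared.\<close>

definition numerator :: "'r \<Rightarrow> nat \<Rightarrow> 'r \<Rightarrow> bool" where
  "numerator b n r \<longleftrightarrow> b \<in> carrier (Sec X D) \<and> r \<in> carrier (Sec X U) \<and>
     Res X U D f [^]\<^bsub>Sec X D\<^esub> n \<otimes>\<^bsub>Sec X D\<^esub> b = Res X U D r"

lemma numerator_ex:
  assumes "b \<in> carrier (Sec X D)"
  obtains n r where "numerator b n r"
  using extU f assms unfolding extends_up_to_powers_def numerator_def by (metis Res_pow[OF U D DU])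

lemma numerator_Res: "g \<in> carrier (Sec X U) \<Longrightarrow> numerator (Res X U D g) 0 g"
  by (simp add: numerator_def)

lemma numerator_add:
  assumes "numerator b n r" "numerator b' n' r'"
  shows "numerator (b \<oplus>\<^bsub>Sec X D\<^esub> b') (n + n')
    (f [^]\<^bsub>Sec X U\<^esub> n' \<otimes>\<^bsub>Sec X U\<^esub> r \<oplus>\<^bsub>Sec X U\<^esub> f [^]\<^bsub>Sec X U\<^esub> n \<otimes>\<^bsub>Sec X U\<^esub> r')"
proof -
  have c: "b \<in> carrier (Sec X D)" "b' \<in> carrier (Sec X D)" "r \<in> carrier (Sec X U)" "r' \<in> carrier (Sec X U)"
    and e: "Res X U D r = Res X U D f [^]\<^bsub>Sec X D\<^esub> n \<otimes>\<^bsub>Sec X D\<^esub> b"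
      "Res X U D r' = Res X U D f [^]\<^bsub>Sec X D\<^esub> n' \<otimes>\<^bsub>Sec X D\<^esub> b'"
    using assms by (auto simp: numerator_def)
  show ?thesis
    unfolding numerator_def using c f
    by (simp add: e B.nat_pow_mult[symmetric] B.l_distr B.r_distr B.m_ac)
qed

lemma numerator_mult:
  assumes "numerator b n r" "numerator b' n' r'"
  shows "numerator (b \<otimes>\<^bsub>Sec X D\<^esub> b') (n + n') (r \<otimes>\<^bsub>Sec X U\<^esub> r')"
proof -
  have c: "b \<in> carrier (Sec X D)" "b' \<in> carrier (Sec X D)" "r \<in> carrier (Sec X U)" "r' \<in> carrier (Sec X U)"
    and e: "Res X U D r = Res X U D f [^]\<^bsub>Sec X D\<^esub> n \<otimes>\<^bsub>Sec X D\<^esub> b"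
      "Res X U D r' = Res X U D f [^]\<^bsub>Sec X D\<^esub> n' \<otimes>\<^bsub>Sec X D\<^esub> b'"
    using assms by (auto simp: numerator_def)
  show ?thesis
    unfolding numerator_def using c f
    by (simp add: e B.nat_pow_mult[symmetric] B.m_ac)
qed

lemma basic_open_numerator:
  assumes "numerator b n r"
  shows "basic_open X D b = basic_open X U r \<inter> D"
proof -
  have b: "b \<in> carrier (Sec X D)" and r: "r \<in> carrier (Sec X U)"
    and e: "Res X U D r = Res X U D f [^]\<^bsub>Sec X D\<^esub> n \<otimes>\<^bsub>Sec X D\<^esub> b"
    using assms by (auto simp: numerator_def)
  have "basic_open X D (Res X U D r) = basic_open X D (Res X U D f [^]\<^bsub>Sec X D\<^esub> n) \<inter> basic_open X D b"
    unfolding e using basic_open_mult[OF D _ b] f by simp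
  also have "\<dots> = basic_open X D b"
    using basic_open_Units[OF D unit_pow] basic_open_subset by blast
  finally show ?thesis using basic_open_inside[OF r] by simp
qed

lemma basic_open_numerator_product:
  assumes "numerator b n r"
  shows "basic_open X D b = basic_open X U (f \<otimes>\<^bsub>Sec X U\<^esub> r)"
  using basic_open_numerator[OF assms] basic_open_mult[OF U f] assms by (auto simp: numerator_def)

text \<open>As \<open>f\<close> is invertible on \<open>D(f)\<close>, a fraction vanishes at a point if and only if its numerator does.\<close>

lemma numerator_prime_at:
  assumes "x \<in> D" "numerator b n r"
  shows "b \<in> prime_at D x \<longleftrightarrow> r \<in> prime_at U x"
  using assms(1) basic_open_numerator[OF assms(2)] assms(2) by (auto simp: prime_at_def numerator_def)

lemma prime_at_basic_open:
  assumes x: "x \<in> D"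
  shows "primeideal (prime_at D x) (Sec X D)"
proof -
  have "primeideal (prime_at U x) (Sec X U)" using x DU affU by (auto simp: affine_like_def)
  then interpret p: primeideal "prime_at U x" "Sec X U" .
  note mem = numerator_prime_at[OF x]
  show ?thesis
  proof (rule primeidealI[OF B.ideal_of_closed B.is_cring])
    show sub: "prime_at D x \<subseteq> carrier (Sec X D)" by (auto simp: prime_at_def)
    show "\<zero>\<^bsub>Sec X D\<^esub> \<in> prime_at D x"
      using mem[OF numerator_Res[OF A.zero_closed]] p.zero_closed by simp
    show "carrier (Sec X D) \<noteq> prime_at D x"
      using mem[OF numerator_Res[OF A.one_closed]] p.I_notcarr p.one_imp_carrier by auto
    show "a \<oplus>\<^bsub>Sec X D\<^esub> b \<in> prime_at D x" if ab: "a \<in> prime_at D x" "b \<in> prime_at D x" for a b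
    proof -
      obtain n r n' r' where nr: "numerator a n r" "numerator b n' r'"
        using ab sub numerator_ex by (metis subsetD)
      have r: "r \<in> prime_at U x" "r' \<in> prime_at U x" using mem[OF nr(1)] mem[OF nr(2)] ab by auto
      have "f [^]\<^bsub>Sec X U\<^esub> n' \<otimes>\<^bsub>Sec X U\<^esub> r \<oplus>\<^bsub>Sec X U\<^esub> f [^]\<^bsub>Sec X U\<^esub> n \<otimes>\<^bsub>Sec X U\<^esub> r' \<in> prime_at U x"
        using p.a_closed[OF p.I_l_closed[OF r(1)] p.I_l_closed[OF r(2)]] f by simp
      then show ?thesis using mem[OF numerator_add[OF nr]] by simp
    qed
    show "c \<otimes>\<^bsub>Sec X D\<^esub> b \<in> prime_at D x" if c: "c \<in> carrier (Sec X D)" and b: "b \<in> prime_at D x" for c b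
    proof -
      obtain n r n' r' where nr: "numerator c n r" "numerator b n' r'"
        using c b sub numerator_ex by (metis subsetD)
      have "r \<otimes>\<^bsub>Sec X U\<^esub> r' \<in> prime_at U x"
        using p.I_l_closed mem[OF nr(2)] b nr(1) by (simp add: numerator_def)
      then show ?thesis using mem[OF numerator_mult[OF nr]] by simp
    qed
    show "a \<in> prime_at D x \<or> b \<in> prime_at D x"
      if ab: "a \<in> carrier (Sec X D)" "b \<in> carrier (Sec X D)" "a \<otimes>\<^bsub>Sec X D\<^esub> b \<in> prime_at D x" for a b
    proof -
      obtain n r n' r' where nr: "numerator a n r" "numerator b n' r'"
        using ab numerator_ex by metis
      have "r \<otimes>\<^bsub>Sec X U\<^esub> r' \<in> prime_at U x" using mem[OF numerator_mult[OF nr]] ab(3) by simp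
      then show ?thesis using p.I_prime mem[OF nr(1)] mem[OF nr(2)] nr by (auto simp: numerator_def)
    qed
  qed
qed

text \<open>The contraction of \<open>q\<close> to \<open>\<O>(U)\<close> is the prime of a point \<open>x\<close>. It does not contain \<open>f\<close>, so \<open>x \<in> D(f)\<close>,
  and \<open>q\<close> is recovered from the contraction through numerators.\<close>

lemma prime_is_prime_at_basic_open:
  assumes q: "primeideal q (Sec X D)"
  shows "\<exists>x\<in>D. q = prime_at D x"
proof -
  interpret q: primeideal q "Sec X D" by (fact q)
  have "ring_hom_ring (Sec X U) (Sec X D) (Res X U D)" using Res_hom[OF U D DU] A.ring_axioms B.ring_axioms by (simp add: ring_hom_ring_def ring_hom_ring_axioms_def)
  from ring_hom_ring.primeideal_vimage[OF this A.is_cring q]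
  obtain x where x: "x \<in> U" and px: "{r \<in> carrier (Sec X U). Res X U D r \<in> q} = prime_at U x"
    using affU unfolding affine_like_def by meson
  have notin: "v \<notin> q" if v: "v \<in> Units (Sec X D)" for v
  proof
    assume "v \<in> q"
    then have "\<one>\<^bsub>Sec X D\<^esub> \<in> q"
      using q.I_l_closed[OF _ B.Units_inv_closed[OF v]] B.Units_l_inv[OF v] by metis
    then show False using q.one_imp_carrier q.I_notcarr by simp
  qed
  have "f \<notin> prime_at U x" using px notin[OF unit] by blast
  then have xD: "x \<in> D" using f by (simp add: prime_at_def)
  have "b \<in> q \<longleftrightarrow> b \<in> prime_at D x" if b: "b \<in> carrier (Sec X D)" for b
  proof -
    obtain n r where nr: "numerator b n r" using numerator_ex b .
    then have "Res X U D f [^]\<^bsub>Sec X D\<^esub> n \<otimes>\<^bsub>Sec X D\<^esub> b = Res X U D r" "r \<in> carrier (Sec X U)"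
      by (auto simp: numerator_def)
    moreover have "Res X U D f [^]\<^bsub>Sec X D\<^esub> n \<otimes>\<^bsub>Sec X D\<^esub> b \<in> q \<longleftrightarrow> b \<in> q"
      using q.mult_notin_iff[OF B.Units_closed[OF unit_pow] b] notin[OF unit_pow] by blast
    ultimately have "b \<in> q \<longleftrightarrow> r \<in> prime_at U x" using px by auto
    then show ?thesis using numerator_prime_at[OF xD nr] by simp
  qed
  then show ?thesis using xD q.a_subset by (intro bexI[of _ x]) (auto simp: prime_at_def)
qed

lemma affine_like_basic_open: "affine_like D"
  unfolding affine_like_def
proof (intro conjI ballI allI impI)
  show "opn D" by (fact D)
  show "primeideal (prime_at D x) (Sec X D)" if "x \<in> D" for x using prime_at_basic_open that .
  show "\<exists>x\<in>D. q = prime_at D x" if "primeideal q (Sec X D)" for q using prime_is_prime_at_basic_open that .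
  show "inj_on (prime_at D) D"
  proof (rule inj_onI)
    fix x y assume xy: "x \<in> D" "y \<in> D" "prime_at D x = prime_at D y"
    have "g \<in> prime_at U x \<longleftrightarrow> g \<in> prime_at U y" if "g \<in> carrier (Sec X U)" for g
      using numerator_prime_at[OF _ numerator_Res[OF that]] xy by blast
    then have "prime_at U x = prime_at U y" by (auto simp: prime_at_def)
    moreover have "inj_on (prime_at U) U" using affU by (simp add: affine_like_def)
    ultimately show "x = y" using DU xy by (meson inj_onD subsetD)
  qed
  show "\<exists>g\<in>carrier (Sec X D). x \<in> basic_open X D g \<and> basic_open X D g \<subseteq> W"
    if W: "opn W \<and> W \<subseteq> D \<and> x \<in> W" for W x
  proof -
    obtain g where g: "g \<in> carrier (Sec X U)" "x \<in> basic_open X U g" "basic_open X U g \<subseteq> W"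
      using affU DU W unfolding affine_like_def by (meson order_trans)
    then show ?thesis using W by (intro bexI[of _ "Res X U D g"]) (auto simp: basic_open_inside)
  qed
  show "\<exists>n::nat. g [^]\<^bsub>Sec X D\<^esub> n \<otimes>\<^bsub>Sec X D\<^esub> b = \<zero>\<^bsub>Sec X D\<^esub>"
    if g: "g \<in> carrier (Sec X D)" and b: "b \<in> carrier (Sec X D)"
      and eq: "Res X D (basic_open X D g) b = \<zero>\<^bsub>Sec X (basic_open X D g)\<^esub>" for g b
  proof -
    obtain n k m r where gk: "numerator g n k" and br: "numerator b m r" using numerator_ex g b by metis
    let ?u = "Res X U D f" and ?E = "basic_open X D g"
    have k: "k \<in> carrier (Sec X U)" "?u [^]\<^bsub>Sec X D\<^esub> n \<otimes>\<^bsub>Sec X D\<^esub> g = Res X U D k"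
      and r: "r \<in> carrier (Sec X U)" "?u [^]\<^bsub>Sec X D\<^esub> m \<otimes>\<^bsub>Sec X D\<^esub> b = Res X U D r"
      using gk br by (auto simp: numerator_def)
    have E: "?E = basic_open X U (f \<otimes>\<^bsub>Sec X U\<^esub> k)" using basic_open_numerator_product[OF gk] .
    have opE: "opn ?E" using basic_open_open D g .
    have ED: "?E \<subseteq> D" by (rule basic_open_subset)
    interpret E: cring "Sec X ?E" using opE by (rule cring_Sec)
    have "Res X U ?E r = Res X D ?E (?u [^]\<^bsub>Sec X D\<^esub> m \<otimes>\<^bsub>Sec X D\<^esub> b)"
      using Res_Res[OF U D opE ED DU r(1)] r(2) by simp
    also have "\<dots> = \<zero>\<^bsub>Sec X ?E\<^esub>"
      using Res_mult[OF D opE ED _ b] eq Res_closed[OF D opE ED] f by simp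
    finally obtain N :: nat where
      N: "(f \<otimes>\<^bsub>Sec X U\<^esub> k) [^]\<^bsub>Sec X U\<^esub> N \<otimes>\<^bsub>Sec X U\<^esub> r = \<zero>\<^bsub>Sec X U\<^esub>"
      using affine_like_torsion[OF affU A.m_closed[OF f k(1)] r(1)] unfolding E by metis
    have "\<zero>\<^bsub>Sec X D\<^esub> = (?u \<otimes>\<^bsub>Sec X D\<^esub> Res X U D k) [^]\<^bsub>Sec X D\<^esub> N \<otimes>\<^bsub>Sec X D\<^esub> Res X U D r"
      using arg_cong[OF N, of "Res X U D"] f k(1) r(1) by simp
    also have "\<dots> = (?u [^]\<^bsub>Sec X D\<^esub> N \<otimes>\<^bsub>Sec X D\<^esub> (?u [^]\<^bsub>Sec X D\<^esub> n) [^]\<^bsub>Sec X D\<^esub> N \<otimes>\<^bsub>Sec X D\<^esub> ?u [^]\<^bsub>Sec X D\<^esub> m)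
        \<otimes>\<^bsub>Sec X D\<^esub> (g [^]\<^bsub>Sec X D\<^esub> N \<otimes>\<^bsub>Sec X D\<^esub> b)"
      unfolding k(2)[symmetric] r(2)[symmetric]
        B.nat_pow_mult_mult[OF B.Units_closed[OF unit] B.Units_closed[OF unit_pow] g]
      by (rule B.m_interchange)
        (use B.Units_closed[OF unit] B.Units_closed[OF unit_pow] g b in simp_all)
    finally have "g [^]\<^bsub>Sec X D\<^esub> N \<otimes>\<^bsub>Sec X D\<^esub> b = \<zero>\<^bsub>Sec X D\<^esub>"
      by (rule B.Units_mult_eq_zero)
        (use unit_pow B.Units_pow_closed[OF unit_pow] g b in auto)
    then show ?thesis by blast
  qed
qed

text \<open>Write \<open>g = k / f\<^sup>n\<close>; then \<open>D(g)\<close>, taken in \<open>D(f)\<close>, is \<open>D(fk)\<close>, taken in \<open>U\<close>. A section over it extends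
  after multiplication by a power of \<open>fk\<close>, that is, of \<open>g\<close> up to a unit of \<open>\<O>(D(f))\<close>.\<close>

lemma extends_up_to_powers_basic_open:
  assumes F: "ideal_presheaf F" and ext: "extends_up_to_powers F U"
  shows "extends_up_to_powers F D"
  unfolding extends_up_to_powers_def
proof (intro ballI)
  fix g t assume g: "g \<in> carrier (Sec X D)" and t: "t \<in> F (basic_open X D g)"
  let ?u = "Res X U D f" and ?E = "basic_open X D g"
  obtain n k where gk: "numerator g n k" using numerator_ex g .
  have k: "k \<in> carrier (Sec X U)" "?u [^]\<^bsub>Sec X D\<^esub> n \<otimes>\<^bsub>Sec X D\<^esub> g = Res X U D k"
    using gk by (auto simp: numerator_def)
  have E: "?E = basic_open X U (f \<otimes>\<^bsub>Sec X U\<^esub> k)" using basic_open_numerator_product[OF gk] .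
  have opE: "opn ?E" using basic_open_open D g .
  have ED: "?E \<subseteq> D" by (rule basic_open_subset)
  interpret E: cring "Sec X ?E" using opE by (rule cring_Sec)
  interpret FD: ideal "F D" "Sec X D" using F D by (simp add: ideal_presheaf_def)
  interpret FU: ideal "F U" "Sec X U" using F U by (simp add: ideal_presheaf_def)
  interpret FE: ideal "F ?E" "Sec X ?E" using F opE by (simp add: ideal_presheaf_def)
  have tE: "t \<in> carrier (Sec X ?E)" using t FE.Icarr by blast
  have fk: "f \<otimes>\<^bsub>Sec X U\<^esub> k \<in> carrier (Sec X U)" using f k(1) by simp
  obtain N :: nat and c where c: "c \<in> F U"
    and N: "Res X U ?E ((f \<otimes>\<^bsub>Sec X U\<^esub> k) [^]\<^bsub>Sec X U\<^esub> N) \<otimes>\<^bsub>Sec X ?E\<^esub> t = Res X U ?E c"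
    using ext fk t unfolding extends_up_to_powers_def E by blast
  have cU: "c \<in> carrier (Sec X U)" using c FU.Icarr by blast
  \<comment> \<open>the unit by which the powers of \<open>fk\<close> and \<open>g\<close> differ on \<open>D(f)\<close>\<close>
  let ?w = "?u [^]\<^bsub>Sec X D\<^esub> N \<otimes>\<^bsub>Sec X D\<^esub> (?u [^]\<^bsub>Sec X D\<^esub> n) [^]\<^bsub>Sec X D\<^esub> N"
  have w: "?w \<in> Units (Sec X D)" using unit_pow B.Units_pow_closed[OF unit_pow] by simp
  have wc: "inv\<^bsub>Sec X D\<^esub> ?w \<otimes>\<^bsub>Sec X D\<^esub> Res X U D c \<in> F D"
    using F U D DU c w by (intro FD.I_l_closed) (auto simp: ideal_presheaf_def)
  have gN: "g [^]\<^bsub>Sec X D\<^esub> N \<in> carrier (Sec X D)" using g by simp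
  have "Res X U ?E ((f \<otimes>\<^bsub>Sec X U\<^esub> k) [^]\<^bsub>Sec X U\<^esub> N)
      = Res X D ?E (Res X U D ((f \<otimes>\<^bsub>Sec X U\<^esub> k) [^]\<^bsub>Sec X U\<^esub> N))"
    using Res_Res[OF U D opE ED DU A.nat_pow_closed[OF fk]] by simp
  also have "Res X U D ((f \<otimes>\<^bsub>Sec X U\<^esub> k) [^]\<^bsub>Sec X U\<^esub> N) = (?u \<otimes>\<^bsub>Sec X D\<^esub> Res X U D k) [^]\<^bsub>Sec X D\<^esub> N"
    using f k(1) by simp
  also have "\<dots> = ?w \<otimes>\<^bsub>Sec X D\<^esub> g [^]\<^bsub>Sec X D\<^esub> N"
    unfolding k(2)[symmetric]
    by (rule B.nat_pow_mult_mult[OF B.Units_closed[OF unit] B.Units_closed[OF unit_pow] g])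
  also have "Res X D ?E \<dots> = Res X D ?E ?w \<otimes>\<^bsub>Sec X ?E\<^esub> Res X D ?E (g [^]\<^bsub>Sec X D\<^esub> N)"
    using Res_mult[OF D opE ED B.Units_closed[OF w] gN] .
  finally have "Res X D ?E ?w \<otimes>\<^bsub>Sec X ?E\<^esub> (Res X D ?E (g [^]\<^bsub>Sec X D\<^esub> N) \<otimes>\<^bsub>Sec X ?E\<^esub> t) = Res X D ?E (Res X U D c)"
    using N Res_Res[OF U D opE ED DU cU] E.m_assoc Res_closed[OF D opE ED] B.Units_closed[OF w] gN tE by simp
  also have "Res X U D c = ?w \<otimes>\<^bsub>Sec X D\<^esub> (inv\<^bsub>Sec X D\<^esub> ?w \<otimes>\<^bsub>Sec X D\<^esub> Res X U D c)"
    using B.m_assoc[OF B.Units_closed[OF w] B.Units_inv_closed[OF w] h.hom_closed[OF cU]]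
      B.Units_r_inv[OF w] B.l_one[OF h.hom_closed[OF cU]] by metis
  also have "Res X D ?E \<dots> = Res X D ?E ?w \<otimes>\<^bsub>Sec X ?E\<^esub> Res X D ?E (inv\<^bsub>Sec X D\<^esub> ?w \<otimes>\<^bsub>Sec X D\<^esub> Res X U D c)"
    using Res_mult[OF D opE ED B.Units_closed[OF w] FD.Icarr[OF wc]] .
  finally have "Res X D ?E (g [^]\<^bsub>Sec X D\<^esub> N) \<otimes>\<^bsub>Sec X ?E\<^esub> t
      = Res X D ?E (inv\<^bsub>Sec X D\<^esub> ?w \<otimes>\<^bsub>Sec X D\<^esub> Res X U D c)"
    by (rule section_Units_cancel[OF opE Res_Units[OF D opE ED w], rotated -1])
      (use Res_closed[OF D opE ED] gN tE FD.Icarr[OF wc] in auto)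
  then show "\<exists>n::nat. \<exists>c\<in>F D. Res X D ?E (g [^]\<^bsub>Sec X D\<^esub> n) \<otimes>\<^bsub>Sec X ?E\<^esub> t = Res X D ?E c"
    using wc by blast
qed

lemma affine_criterion_basic_open: "affine_criterion D"
  unfolding affine_criterion_def
  using affine_like_basic_open extends_up_to_powers_basic_open[OF ideal_presheaf_Sec extU] by blast

end

section \<open>The criterion implies affineness\<close>

lemma tilde_sectionI:
  fixes R :: "'r ring" and M :: "('r, 'm) module"
  assumes M: "Module.module R M" and ext: "s \<in> extensional W"
    and loc: "\<And>p. p \<in> W \<Longrightarrow> \<exists>h\<in>carrier R. \<exists>m\<in>carrier M. p \<in> spec_basic_open R h \<and>
        spec_basic_open R h \<subseteq> W \<and> (\<forall>q\<in>spec_basic_open R h. s q = frac M (carrier R - q) m h)"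
  shows "s \<in> tilde_sections R M W"
  unfolding tilde_sections_def
proof (intro CollectI conjI ballI PiE_I)
  fix p assume p: "p \<in> W"
  then obtain h m where h: "h \<in> carrier R" "p \<in> spec_basic_open R h" "spec_basic_open R h \<subseteq> W"
    and m: "m \<in> carrier M" "\<And>q. q \<in> spec_basic_open R h \<Longrightarrow> s q = frac M (carrier R - q) m h"
    using loc by meson
  have hq: "h \<in> carrier R - q" if "q \<in> spec_basic_open R h" for q
    using that h(1) by (simp add: spec_basic_open_def)
  show "s p \<in> carrier (loc_module R M (carrier R - p))"
    unfolding m(2)[OF h(2)] using frac_in_loc_module[OF M m(1) hq[OF h(2)]] .
  show "\<exists>V m f. zariski_open R V \<and> p \<in> V \<and> V \<subseteq> W \<and> m \<in> carrier M \<and> f \<in> carrier R \<and>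
      (\<forall>q\<in>V. f \<notin> q \<and> s q = frac M (carrier R - q) m f)"
    using zariski_open_spec_basic_open[OF h(1)] h m hq
    by (intro exI[of _ "spec_basic_open R h"] exI[of _ m] exI[of _ h]) auto
qed (use ext in \<open>auto simp: extensional_def\<close>)

text \<open>Construction of the isomorphism with \<open>Spec \<O>(U)\<close>, starting from the criterion.\<close>

locale affine_space_criterion = ringed_space_locale X
  for X :: "('a, 'r) ringed_space" +
  fixes U :: "'a set"
  assumes crit: "affine_criterion U"
begin

lemma affU: "affine_like U" and extU: "extends_up_to_powers (\<lambda>V. carrier (Sec X V)) U"
  using crit by (simp_all add: affine_criterion_def)

lemma U: "opn U" using affU by (simp add: affine_like_def)

abbreviation A where "A \<equiv> Sec X U"

sublocale A: cring A using U by (rule cring_Sec)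

abbreviation D where "D g \<equiv> basic_open X U g"
abbreviation pt where "pt x \<equiv> prime_at U x"

lemma D_open: "g \<in> carrier A \<Longrightarrow> opn (D g)" using basic_open_open U .

lemma D_subset: "D g \<subseteq> U" by (rule basic_open_subset)

lemma pt_prime: "x \<in> U \<Longrightarrow> primeideal (pt x) A"
  using affU by (simp add: affine_like_def)

lemma pt_inj: "inj_on pt U"
  using affU by (simp add: affine_like_def)

lemma pt_image: "pt ` U = {p. primeideal p A}"
proof -
  have "\<forall>p. primeideal p A \<longrightarrow> (\<exists>x\<in>U. p = pt x)" using affU by (simp add: affine_like_def)
  then show ?thesis using pt_prime by blast
qed

lemma notin_pt: "g \<in> carrier A \<Longrightarrow> g \<notin> pt x \<longleftrightarrow> x \<in> D g"
  by (simp add: prime_at_def)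

lemma pt_image_D:
  assumes "g \<in> carrier A" shows "pt ` D g = spec_basic_open A g"
proof (intro equalityI subsetI)
  fix p assume "p \<in> pt ` D g"
  then show "p \<in> spec_basic_open A g"
    using D_subset pt_prime notin_pt[OF assms] unfolding spec_basic_open_def by blast
next
  fix p assume p: "p \<in> spec_basic_open A g"
  then obtain x where "x \<in> U" "p = pt x" using pt_image unfolding spec_basic_open_def by blast
  then show "p \<in> pt ` D g" using p assms notin_pt by (auto simp: spec_basic_open_def)
qed

lemma pt_submonoid: "x \<in> U \<Longrightarrow> submonoid (carrier A - pt x) A"
  using primeideal.submonoid_compl pt_prime by blast

lemma pt_homeo: "homeomorphic_map (subtopology (Top X) U) (zariski A) pt"
proof (rule bijective_open_imp_homeomorphic_map)
  have top: "topspace (subtopology (Top X) U) = U" using openin_subset[OF U] by auto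
  have topA: "topspace (zariski A) = {p. primeideal p A}"
  proof -
    have "zariski_open A {p. primeideal p A}"
      using zariski_open_spec_basic_open[OF A.one_closed] spec_basic_open_one[OF A.is_cring] by simp
    then show ?thesis
      unfolding topspace_def openin_zariski using zariski_open_primeideal by blast
  qed
  show "open_map (subtopology (Top X) U) (zariski A) pt"
    unfolding open_map_def
  proof (intro allI impI)
    fix W assume "openin (subtopology (Top X) U) W"
    then have W: "opn W" "W \<subseteq> U" using U by (auto simp: openin_open_subtopology)
    show "openin (zariski A) (pt ` W)"
    proof (subst openin_subopen, intro ballI)
      fix p assume "p \<in> pt ` W"
      then obtain x where x: "x \<in> W" "p = pt x" by blast
      obtain g where g: "g \<in> carrier A" "x \<in> D g" "D g \<subseteq> W" using affine_like_basis affU W x(1) .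
      have "zariski_open A (pt ` D g)" using zariski_open_spec_basic_open[OF g(1)] pt_image_D[OF g(1)] by simp
      then show "\<exists>T. openin (zariski A) T \<and> p \<in> T \<and> T \<subseteq> pt ` W"
        using x g(2,3) unfolding openin_zariski by blast
    qed
  qed
  show "continuous_map (subtopology (Top X) U) (zariski A) pt"
    unfolding continuous_map_def top topA openin_zariski
  proof (intro conjI allI impI)
    show "pt \<in> U \<rightarrow> {p. primeideal p A}" using pt_prime by blast
    fix V assume V: "zariski_open A V"
    have "opn {x \<in> U. pt x \<in> V}"
    proof (subst openin_subopen, intro ballI)
      fix x assume x: "x \<in> {x \<in> U. pt x \<in> V}"
      obtain g where g: "g \<in> carrier A" "pt x \<in> spec_basic_open A g" "spec_basic_open A g \<subseteq> V"
        by (rule spec_basic_open_basis[OF V, of "pt x"]) (use x in auto)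
      have "x \<in> D g" using g(1,2) notin_pt by (simp add: spec_basic_open_def)
      moreover have "D g \<subseteq> {x \<in> U. pt x \<in> V}" using pt_image_D[OF g(1)] g(3) D_subset by blast
      ultimately show "\<exists>T. opn T \<and> x \<in> T \<and> T \<subseteq> {x \<in> U. pt x \<in> V}" using D_open[OF g(1)] by blast
    qed
    then show "openin (subtopology (Top X) U) {x \<in> U. pt x \<in> V}"
      using U by (auto simp: openin_open_subtopology)
  qed
  show "pt ` topspace (subtopology (Top X) U) = topspace (zariski A)"
    unfolding top topA by (rule pt_image)
  show "inj_on pt (topspace (subtopology (Top X) U))" unfolding top by (rule pt_inj)
qed

text \<open>The germ of \<open>t\<close> at \<open>x\<close> as an element of the localization of \<open>\<O>(U)\<close> at the prime of \<open>x\<close>: all fractions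
  \<open>m/g\<close> that represent it.\<close>

definition germ_fractions :: "'a set \<Rightarrow> 'r \<Rightarrow> 'a \<Rightarrow> ('r \<times> 'r) set" where
  "germ_fractions N t x = {(m, g). m \<in> carrier A \<and> g \<in> carrier A - pt x \<and>
     (\<exists>V. opn V \<and> x \<in> V \<and> V \<subseteq> N \<and> Res X U V g \<otimes>\<^bsub>Sec X V\<^esub> Res X N V t = Res X U V m)}"

text \<open>A relation between global sections that holds near \<open>x\<close> holds on some \<open>D(h)\<close> containing \<open>x\<close>, and there
  it holds in \<open>\<O>(U)\<close> up to a power of \<open>h\<close>, which is invertible in the localization.\<close>

lemma germ_fractions_eq_frac:
  assumes N: "opn N" "N \<subseteq> U" and t: "t \<in> carrier (Sec X N)"
    and m: "m \<in> carrier A" and g: "g \<in> carrier A" "x \<in> D g"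
    and V: "opn V" "x \<in> V" "V \<subseteq> N" and eq: "Res X U V g \<otimes>\<^bsub>Sec X V\<^esub> Res X N V t = Res X U V m"
  shows "germ_fractions N t x = frac (self_module A) (carrier A - pt x) m g"
proof (intro equalityI subsetI)
  have x: "x \<in> U" using N V by blast
  interpret p: primeideal "pt x" A using pt_prime x .
  {
    fix z assume "z \<in> germ_fractions N t x"
    then obtain m' g' V' where z: "z = (m', g')" and m': "m' \<in> carrier A" and g': "g' \<in> carrier A - pt x"
      and V': "opn V'" "x \<in> V'" "V' \<subseteq> N"
      and eq': "Res X U V' g' \<otimes>\<^bsub>Sec X V'\<^esub> Res X N V' t = Res X U V' m'"
      by (auto simp: germ_fractions_def)
    have g'c: "g' \<in> carrier A" using g' by blast
    have op: "opn (V \<inter> V')" and sub: "V \<inter> V' \<subseteq> U" using V V' N by auto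
    obtain h where h: "h \<in> carrier A" "x \<in> D h" "D h \<subseteq> V \<inter> V'"
      using affine_like_basis[OF affU op sub] V(2) V'(2) by blast
    note opD = D_open[OF h(1)]
    interpret E: cring "Sec X (D h)" using opD by (rule cring_Sec)
    have hN: "D h \<subseteq> N" "D h \<subseteq> V" "D h \<subseteq> V'" using h(3) V V' by auto
    have VU: "V \<subseteq> U" "V' \<subseteq> U" using V V' N by auto
    have tD: "Res X N (D h) t \<in> carrier (Sec X (D h))" using Res_closed[OF N(1) opD hN(1) t] .
    have cD: "Res X U (D h) a \<in> carrier (Sec X (D h))" if "a \<in> carrier A" for a
      using Res_closed[OF U opD D_subset that] .
    have push: "Res X U (D h) b \<otimes>\<^bsub>Sec X (D h)\<^esub> Res X N (D h) t = Res X U (D h) a"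
      if W: "opn W" "W \<subseteq> N" "D h \<subseteq> W" and ab: "a \<in> carrier A" "b \<in> carrier A"
        and e: "Res X U W b \<otimes>\<^bsub>Sec X W\<^esub> Res X N W t = Res X U W a" for W a b
    proof -
      have WU: "W \<subseteq> U" using W N by blast
      have "Res X U (D h) a = Res X W (D h) (Res X U W b \<otimes>\<^bsub>Sec X W\<^esub> Res X N W t)"
        unfolding e using Res_Res[OF U W(1) opD W(3) WU ab(1)] by simp
      also have "\<dots> = Res X U (D h) b \<otimes>\<^bsub>Sec X (D h)\<^esub> Res X N (D h) t"
        using Res_mult[OF W(1) opD W(3) Res_closed[OF U W(1) WU ab(2)] Res_closed[OF N(1) W(1,2) t]]
          Res_Res[OF U W(1) opD W(3) WU ab(2)] Res_Res[OF N(1) W(1) opD W(3,2) t] by simp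
      finally show ?thesis by simp
    qed
    note e1 = push[OF V(1,3) hN(2) m g(1) eq] and e2 = push[OF V'(1,3) hN(3) m' g'c eq']
    have gm: "g' \<otimes>\<^bsub>A\<^esub> m \<in> carrier A" "g \<otimes>\<^bsub>A\<^esub> m' \<in> carrier A" using m m' g g'c by auto
    have "Res X U (D h) (g' \<otimes>\<^bsub>A\<^esub> m) = Res X U (D h) (g \<otimes>\<^bsub>A\<^esub> m')"
      using Res_mult[OF U opD D_subset g'c m] Res_mult[OF U opD D_subset g(1) m']
        e1[symmetric] e2[symmetric] E.m_lcomm[OF cD[OF g'c] cD[OF g(1)] tD] by simp
    then have "Res X U (D h) (g' \<otimes>\<^bsub>A\<^esub> m \<ominus>\<^bsub>A\<^esub> g \<otimes>\<^bsub>A\<^esub> m') = \<zero>\<^bsub>Sec X (D h)\<^esub>"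
      using Res_minus[OF U opD D_subset gm] cD[OF gm(2)] by (simp add: E.r_neg E.minus_eq)
    then obtain n :: nat where n: "h [^]\<^bsub>A\<^esub> n \<otimes>\<^bsub>A\<^esub> (g' \<otimes>\<^bsub>A\<^esub> m \<ominus>\<^bsub>A\<^esub> g \<otimes>\<^bsub>A\<^esub> m') = \<zero>\<^bsub>A\<^esub>"
      using affine_like_torsion[OF affU h(1) A.minus_closed[OF gm]] by blast
    have hn: "h [^]\<^bsub>A\<^esub> n \<in> carrier A - pt x"
      using p.pow_notin[OF h(1)] notin_pt[OF h(1)] h by simp
    have "h [^]\<^bsub>A\<^esub> n \<otimes>\<^bsub>A\<^esub> (g' \<otimes>\<^bsub>A\<^esub> m) \<ominus>\<^bsub>A\<^esub> h [^]\<^bsub>A\<^esub> n \<otimes>\<^bsub>A\<^esub> (g \<otimes>\<^bsub>A\<^esub> m') = \<zero>\<^bsub>A\<^esub>"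
      using n gm hn by (simp add: A.minus_eq A.r_distr A.r_minus)
    then have "h [^]\<^bsub>A\<^esub> n \<otimes>\<^bsub>A\<^esub> (g' \<otimes>\<^bsub>A\<^esub> m) = h [^]\<^bsub>A\<^esub> n \<otimes>\<^bsub>A\<^esub> (g \<otimes>\<^bsub>A\<^esub> m')"
      using gm hn by (metis A.m_closed A.r_right_minus_eq DiffD1)
    then show "z \<in> frac (self_module A) (carrier A - pt x) m g"
      unfolding z frac_def using m' g' hn by auto
  next
    fix z assume "z \<in> frac (self_module A) (carrier A - pt x) m g"
    then obtain m' g' u where z: "z = (m', g')" and m': "m' \<in> carrier A" and g': "g' \<in> carrier A" "g' \<notin> pt x"
      and u: "u \<in> carrier A" "u \<notin> pt x" "u \<otimes>\<^bsub>A\<^esub> (g' \<otimes>\<^bsub>A\<^esub> m) = u \<otimes>\<^bsub>A\<^esub> (g \<otimes>\<^bsub>A\<^esub> m')"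
      by (auto simp: frac_def)
    \<comment> \<open>on this neighbourhood both the denominator \<open>g\<close> and the witness \<open>u\<close> can be cancelled\<close>
    let ?W = "V \<inter> D (u \<otimes>\<^bsub>A\<^esub> g)"
    have ug: "u \<otimes>\<^bsub>A\<^esub> g \<in> carrier A" using u g by simp
    have op: "opn ?W" using V(1) D_open[OF ug] by (rule openin_Int)
    have WU: "?W \<subseteq> U" and WN: "?W \<subseteq> N" using V N by auto
    have VU: "V \<subseteq> U" using V N by blast
    interpret E: cring "Sec X ?W" using op by (rule cring_Sec)
    have xW: "x \<in> ?W" using V(2) basic_open_mult[OF U u(1) g(1)] u notin_pt g(2) by auto
    have tW: "Res X N ?W t \<in> carrier (Sec X ?W)" using Res_closed[OF N(1) op WN t] .
    have cW: "Res X U ?W a \<in> carrier (Sec X ?W)" if "a \<in> carrier A" for a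
      using Res_closed[OF U op WU that] .
    have mW: "Res X U ?W (a \<otimes>\<^bsub>A\<^esub> b) = Res X U ?W a \<otimes>\<^bsub>Sec X ?W\<^esub> Res X U ?W b"
      if "a \<in> carrier A" "b \<in> carrier A" for a b using Res_mult[OF U op WU that] .
    have unit: "Res X U ?W (u \<otimes>\<^bsub>A\<^esub> g) \<in> Units (Sec X ?W)"
      using Res_Units[OF D_open[OF ug] op _ Res_basic_open_Units[OF U ug]]
        Res_Res[OF U D_open[OF ug] op _ D_subset ug] by simp
    have eqW: "Res X U ?W g \<otimes>\<^bsub>Sec X ?W\<^esub> Res X N ?W t = Res X U ?W m"
    proof -
      have "Res X U ?W m = Res X V ?W (Res X U V g \<otimes>\<^bsub>Sec X V\<^esub> Res X N V t)"
        unfolding eq using Res_Res[OF U V(1) op _ VU m] by simp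
      also have "\<dots> = Res X U ?W g \<otimes>\<^bsub>Sec X ?W\<^esub> Res X N ?W t"
        using Res_mult[OF V(1) op _ Res_closed[OF U V(1) VU g(1)] Res_closed[OF N(1) V(1,3) t]]
          Res_Res[OF U V(1) op _ VU g(1)] Res_Res[OF N(1) V(1) op _ V(3) t] by simp
      finally show ?thesis by simp
    qed
    have "Res X U ?W (u \<otimes>\<^bsub>A\<^esub> g) \<otimes>\<^bsub>Sec X ?W\<^esub> (Res X U ?W g' \<otimes>\<^bsub>Sec X ?W\<^esub> Res X N ?W t)
        = Res X U ?W (u \<otimes>\<^bsub>A\<^esub> (g' \<otimes>\<^bsub>A\<^esub> m))"
      using u(1) g(1) g'(1) m cW tW by (simp add: mW eqW[symmetric] E.m_ac)
    also have "\<dots> = Res X U ?W (u \<otimes>\<^bsub>A\<^esub> g) \<otimes>\<^bsub>Sec X ?W\<^esub> Res X U ?W m'"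
      unfolding u(3) using u(1) g(1) m' cW by (simp add: mW E.m_assoc)
    finally have "Res X U ?W g' \<otimes>\<^bsub>Sec X ?W\<^esub> Res X N ?W t = Res X U ?W m'"
      by (rule section_Units_cancel[OF op unit, rotated -1]) (use cW g' m' tW in auto)
    then show "z \<in> germ_fractions N t x"
      unfolding z germ_fractions_def using m' g' op xW WN by blast
  }
qed

text \<open>The section extends from \<open>D(h)\<close> after multiplication by \<open>h\<^sup>n\<close>. One further factor \<open>h\<close> excludes the
  exponent \<open>0\<close>, so that the denominator defines the same basic open set.\<close>

lemma germ_fractions_local:
  assumes N: "opn N" "N \<subseteq> U" and t: "t \<in> carrier (Sec X N)" and x: "x \<in> N"
  obtains m g where "m \<in> carrier A" "g \<in> carrier A" "x \<in> D g" "D g \<subseteq> N"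
    "Res X U (D g) g \<otimes>\<^bsub>Sec X (D g)\<^esub> Res X N (D g) t = Res X U (D g) m"
proof -
  obtain h where h: "h \<in> carrier A" "x \<in> D h" "D h \<subseteq> N" using affine_like_basis[OF affU N x] .
  note op = D_open[OF h(1)]
  interpret E: cring "Sec X (D h)" using op by (rule cring_Sec)
  have tD: "Res X N (D h) t \<in> carrier (Sec X (D h))" using Res_closed[OF N(1) op h(3) t] .
  obtain n :: nat and c where c: "c \<in> carrier A"
    and e: "Res X U (D h) (h [^]\<^bsub>A\<^esub> n) \<otimes>\<^bsub>Sec X (D h)\<^esub> Res X N (D h) t = Res X U (D h) c"
    using extends_up_to_powersE[OF extU h(1) tD] .
  let ?g = "h \<otimes>\<^bsub>A\<^esub> h [^]\<^bsub>A\<^esub> n"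
  have hn: "h [^]\<^bsub>A\<^esub> n \<in> carrier A" using h(1) by simp
  have g: "D ?g = D h"
    using basic_open_mult[OF U h(1) hn] basic_open_pow_subset[OF U h(1)] by blast
  have cD: "Res X U (D h) a \<in> carrier (Sec X (D h))" if "a \<in> carrier A" for a
    using Res_closed[OF U op D_subset that] .
  have "Res X U (D h) ?g \<otimes>\<^bsub>Sec X (D h)\<^esub> Res X N (D h) t = Res X U (D h) (h \<otimes>\<^bsub>A\<^esub> c)"
    using Res_mult[OF U op D_subset h(1) hn] Res_mult[OF U op D_subset h(1) c] e[symmetric]
      E.m_assoc[OF cD[OF h(1)] cD[OF hn] tD] by simp
  then show ?thesis using that[of "h \<otimes>\<^bsub>A\<^esub> c" ?g] h hn c unfolding g by simp
qed

lemma germ_fractions_on_basic_open: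
  assumes N: "opn N" "N \<subseteq> U" and t: "t \<in> carrier (Sec X N)"
    and m: "m \<in> carrier A" and g: "g \<in> carrier A" "D g \<subseteq> N"
    and eq: "Res X U (D g) g \<otimes>\<^bsub>Sec X (D g)\<^esub> Res X N (D g) t = Res X U (D g) m" and x: "x \<in> D g"
  shows "germ_fractions N t x = frac (self_module A) (carrier A - pt x) m g"
  using germ_fractions_eq_frac[OF N t m g(1) x D_open[OF g(1)] x g(2) eq] .

lemma germ_fractions_Res:
  assumes N: "opn N" "N \<subseteq> U" and V: "opn V" "V \<subseteq> N" and t: "t \<in> carrier (Sec X N)" and x: "x \<in> V"
  shows "germ_fractions V (Res X N V t) x = germ_fractions N t x"
proof -
  have VU: "V \<subseteq> U" using V N by blast
  have tV: "Res X N V t \<in> carrier (Sec X V)" using Res_closed[OF N(1) V t] .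
  obtain m g where m: "m \<in> carrier A" and g: "g \<in> carrier A" "x \<in> D g" "D g \<subseteq> V"
    and eq: "Res X U (D g) g \<otimes>\<^bsub>Sec X (D g)\<^esub> Res X V (D g) (Res X N V t) = Res X U (D g) m"
    using germ_fractions_local[OF V(1) VU tV x] .
  have gN: "D g \<subseteq> N" using g(3) V(2) by blast
  have "Res X U (D g) g \<otimes>\<^bsub>Sec X (D g)\<^esub> Res X N (D g) t = Res X U (D g) m"
    using eq Res_Res[OF N(1) V(1) D_open[OF g(1)] g(3) V(2) t] by simp
  then show ?thesis
    using germ_fractions_on_basic_open[OF V(1) VU tV m g(1,3) eq g(2)]
      germ_fractions_on_basic_open[OF N t m g(1) gN _ g(2)] by simp
qed

definition to_tilde :: "'a set \<Rightarrow> 'r \<Rightarrow> 'r set \<Rightarrow> ('r \<times> 'r) set" where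
  "to_tilde N t = (\<lambda>p\<in>pt ` N. germ_fractions N t (inv_into U pt p))"

lemma to_tilde_pt: "N \<subseteq> U \<Longrightarrow> x \<in> N \<Longrightarrow> to_tilde N t (pt x) = germ_fractions N t x"
  using pt_inj by (simp add: to_tilde_def inv_into_f_f subset_iff)

lemma to_tilde_section:
  assumes N: "opn N" "N \<subseteq> U" and t: "t \<in> carrier (Sec X N)"
  shows "to_tilde N t \<in> tilde_sections A (self_module A) (pt ` N)"
proof (rule tilde_sectionI[OF A.module_self])
  show "to_tilde N t \<in> extensional (pt ` N)" by (simp add: to_tilde_def)
  fix p assume "p \<in> pt ` N"
  then obtain x where x: "x \<in> N" "p = pt x" by blast
  obtain m g where m: "m \<in> carrier A" and g: "g \<in> carrier A" "x \<in> D g" "D g \<subseteq> N"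
    and eq: "Res X U (D g) g \<otimes>\<^bsub>Sec X (D g)\<^esub> Res X N (D g) t = Res X U (D g) m"
    using germ_fractions_local[OF N t x(1)] .
  have "to_tilde N t q = frac (self_module A) (carrier A - q) m g" if "q \<in> pt ` D g" for q
    using that germ_fractions_on_basic_open[OF N t m g(1,3) eq] to_tilde_pt[OF N(2)] g(3) by auto
  then show "\<exists>h\<in>carrier A. \<exists>m\<in>carrier (self_module A). p \<in> spec_basic_open A h \<and>
      spec_basic_open A h \<subseteq> pt ` N \<and> (\<forall>q\<in>spec_basic_open A h. to_tilde N t q = frac (self_module A) (carrier A - q) m h)"
    using g m x
    by (intro bexI[of _ g] bexI[of _ m]) (auto simp: pt_image_D[OF g(1), symmetric])
qed

lemma to_tilde_Res:
  assumes N: "opn N" "N \<subseteq> U" and V: "opn V" "V \<subseteq> N" and t: "t \<in> carrier (Sec X N)"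
  shows "to_tilde V (Res X N V t) = restrict (to_tilde N t) (pt ` V)"
proof (rule extensionalityI[where A = "pt ` V"])
  fix p assume "p \<in> pt ` V"
  then obtain x where x: "x \<in> V" "p = pt x" by blast
  then show "to_tilde V (Res X N V t) p = restrict (to_tilde N t) (pt ` V) p"
    using germ_fractions_Res[OF N V t x(1)] to_tilde_pt[of V x] to_tilde_pt[of N x] V N by auto
qed (simp_all only: to_tilde_def restrict_extensional)

lemma to_tilde_inj:
  assumes N: "opn N" "N \<subseteq> U"
  shows "inj_on (to_tilde N) (carrier (Sec X N))"
proof (rule inj_onI)
  fix t t' assume t: "t \<in> carrier (Sec X N)" "t' \<in> carrier (Sec X N)" and eq: "to_tilde N t = to_tilde N t'"
  show "t = t'"
  proof (rule section_eqI[OF N(1) t])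
    fix x assume x: "x \<in> N"
    obtain m g where m: "m \<in> carrier A" and g: "g \<in> carrier A" "x \<in> D g" "D g \<subseteq> N"
      and e: "Res X U (D g) g \<otimes>\<^bsub>Sec X (D g)\<^esub> Res X N (D g) t = Res X U (D g) m"
      using germ_fractions_local[OF N t(1) x] .
    have "(m, g) \<in> germ_fractions N t x"
      unfolding germ_fractions_def using m g e D_open[OF g(1)] notin_pt[OF g(1)] by blast
    also have "germ_fractions N t x = germ_fractions N t' x"
      using eq to_tilde_pt[OF N(2) x] by metis
    finally obtain V where V: "opn V" "x \<in> V" "V \<subseteq> N"
      and e': "Res X U V g \<otimes>\<^bsub>Sec X V\<^esub> Res X N V t' = Res X U V m"
      by (auto simp: germ_fractions_def)
    let ?W = "V \<inter> D g"
    have op: "opn ?W" using V(1) D_open[OF g(1)] by (rule openin_Int)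
    have WN: "?W \<subseteq> N" and VU: "V \<subseteq> U" using V N by auto
    have "Res X U ?W g \<otimes>\<^bsub>Sec X ?W\<^esub> Res X N ?W t = Res X (D g) ?W (Res X U (D g) m)"
      unfolding e[symmetric]
      using Res_mult[OF D_open[OF g(1)] op _ Res_closed[OF U D_open[OF g(1)] D_subset g(1)] Res_closed[OF N(1) D_open[OF g(1)] g(3) t(1)]]
        Res_Res[OF U D_open[OF g(1)] op _ D_subset g(1)] Res_Res[OF N(1) D_open[OF g(1)] op _ g(3) t(1)] by simp
    also have "\<dots> = Res X V ?W (Res X U V m)"
      using Res_Res[OF U D_open[OF g(1)] op _ D_subset m] Res_Res[OF U V(1) op _ VU m] by simp
    also have "\<dots> = Res X U ?W g \<otimes>\<^bsub>Sec X ?W\<^esub> Res X N ?W t'"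
      unfolding e'[symmetric]
      using Res_mult[OF V(1) op _ Res_closed[OF U V(1) VU g(1)] Res_closed[OF N(1) V(1,3) t(2)]]
        Res_Res[OF U V(1) op _ VU g(1)] Res_Res[OF N(1) V(1) op _ V(3) t(2)] by simp
    finally have "Res X N ?W t = Res X N ?W t'"
    proof (rule section_Units_cancel[OF op, rotated -1])
      show "Res X U ?W g \<in> Units (Sec X ?W)"
        using Res_Units[OF D_open[OF g(1)] op _ Res_basic_open_Units[OF U g(1)]]
          Res_Res[OF U D_open[OF g(1)] op _ D_subset g(1)] by simp
    qed (use Res_closed[OF N(1) op WN] t in auto)
    then show "\<exists>W. opn W \<and> x \<in> W \<and> W \<subseteq> N \<and> Res X N W t = Res X N W t'"
      using op V(2) g(2) WN by blast
  qed
qed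

text \<open>The map is injective over every open set, so sections with prescribed images on the members of a cover
  agree on overlaps automatically, and it suffices to find preimages locally, where the given
  section is a fraction \<open>m/h\<close>.\<close>

lemma to_tilde_surj:
  assumes N: "opn N" "N \<subseteq> U" and s: "s \<in> tilde_sections A (self_module A) (pt ` N)"
  shows "\<exists>t\<in>carrier (Sec X N). to_tilde N t = s"
proof -
  define P where "P V t \<longleftrightarrow> t \<in> carrier (Sec X V) \<and> to_tilde V t = restrict s (pt ` V)" for V t
  define \<U> where "\<U> = {V. opn V \<and> V \<subseteq> N \<and> (\<exists>t. P V t)}"
  define l where "l V = (SOME t. P V t)" for V
  have l: "P V (l V)" if "V \<in> \<U>" for V
    using that someI_ex[of "P V"] by (simp add: \<U>_def l_def)
  have "\<exists>V\<in>\<U>. x \<in> V" if x: "x \<in> N" for x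
  proof -
    obtain m h where m: "m \<in> carrier (self_module A)" and h: "h \<in> carrier A" "pt x \<in> spec_basic_open A h"
      "spec_basic_open A h \<subseteq> pt ` N"
      and sh: "\<And>q. q \<in> spec_basic_open A h \<Longrightarrow> s q = frac (self_module A) (carrier A - q) m h"
      by (rule tilde_section_local[OF A.module_self s imageI[OF x]]) (rule that)
    then have m: "m \<in> carrier A" by simp
    note op = D_open[OF h(1)]
    interpret E: cring "Sec X (D h)" using op by (rule cring_Sec)
    have xD: "x \<in> D h" using h(1,2) notin_pt by (simp add: spec_basic_open_def)
    have DN: "D h \<subseteq> N"
    proof
      fix y assume y: "y \<in> D h"
      then have "pt y \<in> pt ` N" using h(3) pt_image_D[OF h(1)] by blast
      then obtain z where "z \<in> N" "pt y = pt z" by blast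
      then show "y \<in> N" using inj_onD[OF pt_inj] y D_subset N(2) by (metis subsetD)
    qed
    note unit = Res_basic_open_Units[OF U h(1)]
    have mD: "Res X U (D h) m \<in> carrier (Sec X (D h))" using Res_closed[OF U op D_subset m] .
    let ?t = "inv\<^bsub>Sec X (D h)\<^esub> (Res X U (D h) h) \<otimes>\<^bsub>Sec X (D h)\<^esub> Res X U (D h) m"
    have t: "?t \<in> carrier (Sec X (D h))" using unit mD by simp
    have e: "Res X U (D h) h \<otimes>\<^bsub>Sec X (D h)\<^esub> Res X (D h) (D h) ?t = Res X U (D h) m"
      using E.m_assoc[OF E.Units_closed[OF unit] E.Units_inv_closed[OF unit] mD] E.Units_r_inv[OF unit]
        Res_id[OF op t] mD by simp
    have "to_tilde (D h) ?t = restrict s (pt ` D h)"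
    proof (rule extensionalityI[where A = "pt ` D h"])
      fix q assume "q \<in> pt ` D h"
      then obtain y where y: "y \<in> D h" "q = pt y" by blast
      then have "s q = frac (self_module A) (carrier A - q) m h" using sh pt_image_D[OF h(1)] by blast
      then show "to_tilde (D h) ?t q = restrict s (pt ` D h) q"
        using y to_tilde_pt[OF D_subset y(1)] germ_fractions_on_basic_open[OF op D_subset t m h(1) order_refl e y(1)]
        by simp
    qed (simp_all add: to_tilde_def)
    then have "D h \<in> \<U>" using t op DN unfolding \<U>_def P_def by blast
    then show ?thesis using xD by blast
  qed
  then have Un: "\<Union>\<U> = N" by (auto simp: \<U>_def)
  have compat: "Res X V (V \<inter> W) (l V) = Res X W (V \<inter> W) (l W)" if V: "V \<in> \<U>" and W: "W \<in> \<U>" for V W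
  proof -
    have op: "opn V" "opn W" "opn (V \<inter> W)" and sub: "V \<subseteq> U" "W \<subseteq> U" "V \<inter> W \<subseteq> U"
      using V W N by (auto simp: \<U>_def)
    have lV: "l V \<in> carrier (Sec X V)" "to_tilde V (l V) = restrict s (pt ` V)"
      and lW: "l W \<in> carrier (Sec X W)" "to_tilde W (l W) = restrict s (pt ` W)"
      using l V W by (auto simp: P_def)
    have "to_tilde (V \<inter> W) (Res X V (V \<inter> W) (l V)) = to_tilde (V \<inter> W) (Res X W (V \<inter> W) (l W))"
      using to_tilde_Res[OF op(1) sub(1) op(3) _ lV(1)] to_tilde_Res[OF op(2) sub(2) op(3) _ lW(1)] lV(2) lW(2)
      by (auto simp: restrict_def fun_eq_iff)
    then show ?thesis
      by (rule inj_onD[OF to_tilde_inj[OF op(3) sub(3)]])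
        (use Res_closed[OF op(1,3) _ lV(1)] Res_closed[OF op(2,3) _ lW(1)] in auto)
  qed
  have opU: "\<forall>V\<in>\<U>. opn V" and lU: "\<forall>V\<in>\<U>. l V \<in> carrier (Sec X V)"
    using l by (simp_all add: P_def \<U>_def)
  have "\<exists>t\<in>carrier (Sec X N). \<forall>V\<in>\<U>. Res X N V t = l V"
    using is_sheaf_glue[OF sheaf_Sec opU lU] compat unfolding Un by blast
  then obtain t where t: "t \<in> carrier (Sec X N)" "\<And>V. V \<in> \<U> \<Longrightarrow> Res X N V t = l V" by blast
  have "to_tilde N t = s"
  proof (rule extensionalityI[where A = "pt ` N"])
    show "s \<in> extensional (pt ` N)" using s by (auto simp: tilde_sections_def PiE_def)
    fix p assume "p \<in> pt ` N"
    then obtain x where x: "x \<in> N" "p = pt x" by blast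
    then obtain V where V: "V \<in> \<U>" "x \<in> V" using Un by blast
    then have op: "opn V" "V \<subseteq> N" by (auto simp: \<U>_def)
    have "restrict (to_tilde N t) (pt ` V) = restrict s (pt ` V)"
      using to_tilde_Res[OF N op t(1)] t(2)[OF V(1)] l[OF V(1)] by (simp add: P_def)
    from fun_cong[OF this, of p] show "to_tilde N t p = s p" using x V by simp
  qed (simp add: to_tilde_def)
  then show ?thesis using t(1) by blast
qed

lemma to_tilde_ring_hom:
  assumes N: "opn N" "N \<subseteq> U"
  shows "to_tilde N \<in> ring_hom (Sec X N) (Sec (Spec A) (pt ` N))"
proof (rule ring_hom_memI)
  interpret N: cring "Sec X N" using N(1) by (rule cring_Sec)
  show "to_tilde N t \<in> carrier (Sec (Spec A) (pt ` N))" if "t \<in> carrier (Sec X N)" for t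
    using to_tilde_section[OF N that] by (simp add: Spec_def)
  {
    fix t t' assume t: "t \<in> carrier (Sec X N)" and t': "t' \<in> carrier (Sec X N)"
    have ops: "germ_fractions N (t \<otimes>\<^bsub>Sec X N\<^esub> t') x
          = germ_fractions N t x \<otimes>\<^bsub>loc_ring A (carrier A - pt x)\<^esub> germ_fractions N t' x \<and>
        germ_fractions N (t \<oplus>\<^bsub>Sec X N\<^esub> t') x
          = germ_fractions N t x \<oplus>\<^bsub>loc_ring A (carrier A - pt x)\<^esub> germ_fractions N t' x"
      if x: "x \<in> N" for x
    proof -
      obtain m g where m: "m \<in> carrier A" and g: "g \<in> carrier A" "x \<in> D g" "D g \<subseteq> N"
        and e: "Res X U (D g) g \<otimes>\<^bsub>Sec X (D g)\<^esub> Res X N (D g) t = Res X U (D g) m"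
        using germ_fractions_local[OF N t x] .
      obtain m' g' where m': "m' \<in> carrier A" and g': "g' \<in> carrier A" "x \<in> D g'" "D g' \<subseteq> N"
        and e': "Res X U (D g') g' \<otimes>\<^bsub>Sec X (D g')\<^esub> Res X N (D g') t' = Res X U (D g') m'"
        using germ_fractions_local[OF N t' x] .
      let ?W = "D g \<inter> D g'"
      have op: "opn ?W" using D_open[OF g(1)] D_open[OF g'(1)] by (rule openin_Int)
      have WU: "?W \<subseteq> U" and WN: "?W \<subseteq> N" and xW: "x \<in> ?W" and xU: "x \<in> U" using g g' N by auto
      interpret W: cring "Sec X ?W" using op by (rule cring_Sec)
      have eW: "Res X U ?W g \<otimes>\<^bsub>Sec X ?W\<^esub> Res X N ?W t = Res X U ?W m"
        using arg_cong[OF e, of "Res X (D g) ?W"]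
          Res_mult[OF D_open[OF g(1)] op _ Res_closed[OF U D_open[OF g(1)] D_subset g(1)] Res_closed[OF N(1) D_open[OF g(1)] g(3) t]]
          Res_Res[OF U D_open[OF g(1)] op _ D_subset g(1)] Res_Res[OF N(1) D_open[OF g(1)] op _ g(3) t]
          Res_Res[OF U D_open[OF g(1)] op _ D_subset m] by simp
      have eW': "Res X U ?W g' \<otimes>\<^bsub>Sec X ?W\<^esub> Res X N ?W t' = Res X U ?W m'"
        using arg_cong[OF e', of "Res X (D g') ?W"]
          Res_mult[OF D_open[OF g'(1)] op _ Res_closed[OF U D_open[OF g'(1)] D_subset g'(1)] Res_closed[OF N(1) D_open[OF g'(1)] g'(3) t']]
          Res_Res[OF U D_open[OF g'(1)] op _ D_subset g'(1)] Res_Res[OF N(1) D_open[OF g'(1)] op _ g'(3) t']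
          Res_Res[OF U D_open[OF g'(1)] op _ D_subset m'] by simp
      have c: "Res X U ?W g \<in> carrier (Sec X ?W)" "Res X U ?W g' \<in> carrier (Sec X ?W)"
        "Res X N ?W t \<in> carrier (Sec X ?W)" "Res X N ?W t' \<in> carrier (Sec X ?W)"
        using Res_closed[OF U op WU] Res_closed[OF N(1) op WN] g g' t t' by auto
      have gg: "g \<otimes>\<^bsub>A\<^esub> g' \<in> carrier A" "x \<in> D (g \<otimes>\<^bsub>A\<^esub> g')"
        using g g' basic_open_mult[OF U g(1) g'(1)] by auto
      have "Res X U ?W (g \<otimes>\<^bsub>A\<^esub> g') \<otimes>\<^bsub>Sec X ?W\<^esub> Res X N ?W (t \<otimes>\<^bsub>Sec X N\<^esub> t') = Res X U ?W (m \<otimes>\<^bsub>A\<^esub> m')"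
        using Res_mult[OF U op WU g(1) g'(1)] Res_mult[OF U op WU m m'] Res_mult[OF N(1) op WN t t']
          W.m_interchange[OF c] eW eW' by simp
      then have mult: "germ_fractions N (t \<otimes>\<^bsub>Sec X N\<^esub> t') x
          = frac (self_module A) (carrier A - pt x) (m \<otimes>\<^bsub>A\<^esub> m') (g \<otimes>\<^bsub>A\<^esub> g')"
        using germ_fractions_eq_frac[OF N _ _ gg op xW WN] t t' m m' by simp
      have "Res X U ?W (g' \<otimes>\<^bsub>A\<^esub> m \<oplus>\<^bsub>A\<^esub> g \<otimes>\<^bsub>A\<^esub> m')
          = Res X U ?W g' \<otimes>\<^bsub>Sec X ?W\<^esub> Res X U ?W m \<oplus>\<^bsub>Sec X ?W\<^esub> Res X U ?W g \<otimes>\<^bsub>Sec X ?W\<^esub> Res X U ?W m'"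
        using Res_add[OF U op WU] Res_mult[OF U op WU] g(1) g'(1) m m' by simp
      also have "\<dots> = (Res X U ?W g \<otimes>\<^bsub>Sec X ?W\<^esub> Res X U ?W g') \<otimes>\<^bsub>Sec X ?W\<^esub> (Res X N ?W t \<oplus>\<^bsub>Sec X ?W\<^esub> Res X N ?W t')"
        unfolding eW[symmetric] eW'[symmetric] using c by (simp add: W.r_distr W.m_ac)
      also have "\<dots> = Res X U ?W (g \<otimes>\<^bsub>A\<^esub> g') \<otimes>\<^bsub>Sec X ?W\<^esub> Res X N ?W (t \<oplus>\<^bsub>Sec X N\<^esub> t')"
        using Res_add[OF N(1) op WN t t'] Res_mult[OF U op WU g(1) g'(1)] by simp
      finally have add: "germ_fractions N (t \<oplus>\<^bsub>Sec X N\<^esub> t') x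
          = frac (self_module A) (carrier A - pt x) (g' \<otimes>\<^bsub>A\<^esub> m \<oplus>\<^bsub>A\<^esub> g \<otimes>\<^bsub>A\<^esub> m') (g \<otimes>\<^bsub>A\<^esub> g')"
        using germ_fractions_eq_frac[OF N _ _ gg op xW WN] t t' m m' g(1) g'(1) by simp
      have gS: "g \<in> carrier A - pt x" "g' \<in> carrier A - pt x" using g g' notin_pt by auto
      show ?thesis
        unfolding mult add
          germ_fractions_on_basic_open[OF N t m g(1,3) e g(2)]
          germ_fractions_on_basic_open[OF N t' m' g'(1,3) e' g'(2)]
        using loc_ring_mult_frac[OF A.is_cring pt_submonoid[OF xU] m gS(1) m' gS(2)]
          loc_ring_add_frac[OF A.is_cring pt_submonoid[OF xU] m gS(1) m' gS(2)] by simp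
    qed
    show "to_tilde N (t \<otimes>\<^bsub>Sec X N\<^esub> t') = to_tilde N t \<otimes>\<^bsub>Sec (Spec A) (pt ` N)\<^esub> to_tilde N t'"
    proof (rule extensionalityI[where A = "pt ` N"])
      fix p assume "p \<in> pt ` N"
      then obtain x where x: "x \<in> N" "p = pt x" by blast
      then show "to_tilde N (t \<otimes>\<^bsub>Sec X N\<^esub> t') p = (to_tilde N t \<otimes>\<^bsub>Sec (Spec A) (pt ` N)\<^esub> to_tilde N t') p"
        using ops[OF x(1)] to_tilde_pt[OF N(2) x(1)] by (simp add: Spec_def)
    qed (simp_all add: to_tilde_def Spec_def)
    show "to_tilde N (t \<oplus>\<^bsub>Sec X N\<^esub> t') = to_tilde N t \<oplus>\<^bsub>Sec (Spec A) (pt ` N)\<^esub> to_tilde N t'"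
    proof (rule extensionalityI[where A = "pt ` N"])
      fix p assume "p \<in> pt ` N"
      then obtain x where x: "x \<in> N" "p = pt x" by blast
      then show "to_tilde N (t \<oplus>\<^bsub>Sec X N\<^esub> t') p = (to_tilde N t \<oplus>\<^bsub>Sec (Spec A) (pt ` N)\<^esub> to_tilde N t') p"
        using ops[OF x(1)] to_tilde_pt[OF N(2) x(1)] by (simp add: Spec_def)
    qed (simp_all add: to_tilde_def Spec_def)
  }
  show "to_tilde N \<one>\<^bsub>Sec X N\<^esub> = \<one>\<^bsub>Sec (Spec A) (pt ` N)\<^esub>"
  proof (rule extensionalityI[where A = "pt ` N"])
    fix p assume "p \<in> pt ` N"
    then obtain x where x: "x \<in> N" "p = pt x" by blast
    have xD: "x \<in> D \<one>\<^bsub>A\<^esub>" using basic_open_Units[OF U A.Units_one_closed] x(1) N(2) by auto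
    have "germ_fractions N \<one>\<^bsub>Sec X N\<^esub> x = frac (self_module A) (carrier A - pt x) \<one>\<^bsub>A\<^esub> \<one>\<^bsub>A\<^esub>"
      by (rule germ_fractions_eq_frac[OF N _ _ _ xD N(1) x(1) order_refl])
        (use Res_one[OF U N] Res_id[OF N(1)] in simp_all)
    then show "to_tilde N \<one>\<^bsub>Sec X N\<^esub> p = \<one>\<^bsub>Sec (Spec A) (pt ` N)\<^esub> p"
      using x to_tilde_pt[OF N(2) x(1)] by (simp add: Spec_def loc_ring_def)
  qed (simp_all add: to_tilde_def Spec_def)
qed

lemma to_tilde_ring_iso:
  assumes N: "opn N" "N \<subseteq> U"
  shows "to_tilde N \<in> ring_iso (Sec X N) (Sec (Spec A) (pt ` N))"
  unfolding ring_iso_def bij_betw_def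
  using to_tilde_ring_hom[OF N] to_tilde_inj[OF N] to_tilde_surj[OF N] to_tilde_section[OF N]
  by (auto simp: Spec_def)

theorem affine_open_of_criterion: "affine_open X U"
proof -
  define \<psi> where "\<psi> W = inv_into (carrier (Sec X (preim (open_subspace X U) pt W))) (to_tilde (preim (open_subspace X U) pt W))" for W
  let ?pre = "preim (open_subspace X U) pt"
  have pre: "?pre W = {x \<in> U. pt x \<in> W}" for W
    using openin_subset[OF U] by (auto simp: preim_def open_subspace_def)
  have pre_sub: "?pre W \<subseteq> U" for W by (auto simp: pre)
  have pre_open: "opn (?pre W)" if "zariski_open A W" for W
  proof -
    have "openin (subtopology (Top X) U) {x \<in> topspace (subtopology (Top X) U). pt x \<in> W}"
      using homeomorphic_imp_continuous_map[OF pt_homeo] that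
      unfolding continuous_map_def openin_zariski by blast
    then show ?thesis using openin_subset[OF U] U by (simp add: pre openin_open_subtopology inf.absorb2)
  qed
  have image_pre: "pt ` ?pre W = W" if "zariski_open A W" for W
  proof (intro equalityI subsetI)
    fix p assume p: "p \<in> W"
    then have "p \<in> pt ` U" using zariski_open_primeideal[OF that] pt_image by simp
    then show "p \<in> pt ` ?pre W" using p by (auto simp: pre)
  qed (auto simp: pre)
  have \<psi>_iso: "\<psi> W \<in> ring_iso (Sec (Spec A) W) (Sec X (?pre W))" if W: "zariski_open A W" for W
    using ring_iso_set_sym[OF cring.axioms(1)[OF cring_Sec[OF pre_open[OF W]]] to_tilde_ring_iso[OF pre_open[OF W] pre_sub]]
    unfolding image_pre[OF W] \<psi>_def .
  have \<psi>_Res: "\<psi> W' (restrict s W') = Res X (?pre W) (?pre W') (\<psi> W s)"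
    if W: "zariski_open A W" "zariski_open A W'" "W' \<subseteq> W" and s: "s \<in> tilde_sections A (self_module A) W" for W W' s
  proof -
    have sub: "?pre W' \<subseteq> ?pre W" using W(3) by (auto simp: pre)
    obtain t where t: "t \<in> carrier (Sec X (?pre W))" "to_tilde (?pre W) t = s"
      using to_tilde_surj[OF pre_open[OF W(1)] pre_sub] s unfolding image_pre[OF W(1)] by blast
    have tW': "Res X (?pre W) (?pre W') t \<in> carrier (Sec X (?pre W'))"
      using Res_closed[OF pre_open[OF W(1)] pre_open[OF W(2)] sub t(1)] .
    have "restrict s W' = to_tilde (?pre W') (Res X (?pre W) (?pre W') t)"
      using to_tilde_Res[OF pre_open[OF W(1)] pre_sub pre_open[OF W(2)] sub t(1)]
      unfolding image_pre[OF W(2)] t(2) by simp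
    then have "\<psi> W' (restrict s W') = Res X (?pre W) (?pre W') t"
      unfolding \<psi>_def using inv_into_f_f[OF to_tilde_inj[OF pre_open[OF W(2)] pre_sub] tW'] by simp
    moreover have "\<psi> W s = t"
      unfolding \<psi>_def t(2)[symmetric] using inv_into_f_f[OF to_tilde_inj[OF pre_open[OF W(1)] pre_sub] t(1)] .
    ultimately show ?thesis by simp
  qed
  have "ringed_space_iso (open_subspace X U) (Spec A) pt \<psi>"
    unfolding ringed_space_iso_def
  proof (intro conjI allI impI)
    show "homeomorphic_map (Top (open_subspace X U)) (Top (Spec A)) pt"
      using pt_homeo by (simp add: open_subspace_def Spec_def)
    show "\<psi> W \<in> ring_iso (Sec (Spec A) W) (Sec (open_subspace X U) (?pre W))"
      if "openin (Top (Spec A)) W" for W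
    proof -
      have "zariski_open A W" using that by (simp add: Spec_def openin_zariski)
      from \<psi>_iso[OF this] show ?thesis by (simp add: open_subspace_def)
    qed
    show "\<psi> W' (Res (Spec A) W W' s) = Res (open_subspace X U) (?pre W) (?pre W') (\<psi> W s)"
      if *: "openin (Top (Spec A)) W \<and> openin (Top (Spec A)) W' \<and> W' \<subseteq> W \<and> s \<in> carrier (Sec (Spec A) W)"
      for W W' s
    proof -
      have "zariski_open A W" "zariski_open A W'" "W' \<subseteq> W" "s \<in> tilde_sections A (self_module A) W"
        using * by (simp_all add: Spec_def openin_zariski)
      from \<psi>_Res[OF this] show ?thesis by (simp add: open_subspace_def Spec_def)
    qed
  qed
  then show ?thesis unfolding affine_open_def using U A.is_cring by blast
qed

end

section \<open>Quasi-coherent sheaves of ideals on affine open sets\<close>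

context ringed_space_locale
begin

lemma affine_open_iff_criterion: "affine_open X U \<longleftrightarrow> affine_criterion U"
proof
  assume "affine_open X U"
  then obtain R :: "'r ring" and \<phi> \<psi> where "opn U" "cring R" "ringed_space_iso (open_subspace X U) (Spec R) \<phi> \<psi>"
    unfolding affine_open_def by blast
  then interpret spec_chart X U R \<phi> \<psi>
    by (intro spec_chart.intro spec_chart_axioms.intro ringed_space_locale_axioms)
  show "affine_criterion U"
    unfolding affine_criterion_def using affine_like_chart extends_up_to_powers_Sec by blast
next
  assume "affine_criterion U"
  then interpret affine_space_criterion X U by unfold_locales
  show "affine_open X U" by (rule affine_open_of_criterion)
qed

lemma affine_openD: "affine_open X U \<Longrightarrow> opn U"
  by (simp add: affine_open_def)

lemma affine_open_affine_like: "affine_open X U \<Longrightarrow> affine_like U"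
  by (simp add: affine_open_iff_criterion affine_criterion_def)

lemma affine_open_basic_open:
  assumes "affine_open X U" "f \<in> carrier (Sec X U)"
  shows "affine_open X (basic_open X U f)"
proof -
  interpret affine_basic_open X U f
    using assms by unfold_locales (simp_all add: affine_open_iff_criterion)
  show ?thesis using affine_criterion_basic_open by (simp add: affine_open_iff_criterion)
qed

text \<open>Otherwise the ideal lies in the prime of some point \<open>x\<close>, but it has an element that does not vanish at \<open>x\<close>.
  This takes the place of quasi-compactness.\<close>

lemma affine_open_covering_ideal:
  assumes U: "affine_open X U" and C: "ideal C (Sec X U)"
    and cover: "\<And>x. x \<in> U \<Longrightarrow> \<exists>g\<in>C. x \<in> basic_open X U g"
  shows "\<one>\<^bsub>Sec X U\<^esub> \<in> C"
proof (rule ccontr)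
  interpret cring "Sec X U" using cring_Sec affine_openD U by blast
  assume "\<one>\<^bsub>Sec X U\<^esub> \<notin> C"
  then have "\<And>n::nat. \<one>\<^bsub>Sec X U\<^esub> [^]\<^bsub>Sec X U\<^esub> n \<notin> C" by simp
  from exists_primeideal_avoiding_powers[OF C one_closed this]
  obtain p where p: "primeideal p (Sec X U)" "C \<subseteq> p" by blast
  have "\<forall>p. primeideal p (Sec X U) \<longrightarrow> (\<exists>x\<in>U. p = prime_at U x)"
    using affine_open_affine_like[OF U] by (simp add: affine_like_def)
  then obtain x where x: "x \<in> U" "p = prime_at U x" using p(1) by blast
  obtain g where "g \<in> C" "x \<in> basic_open X U g" using cover x(1) by blast
  then show False using p(2) x(2) by (auto simp: prime_at_def)
qed

lemma affine_open_basis: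
  assumes "affine_open X U" "opn W" "x \<in> U" "x \<in> W"
  obtains g where "g \<in> carrier (Sec X U)" "x \<in> basic_open X U g" "basic_open X U g \<subseteq> U \<inter> W"
    "affine_open X (basic_open X U g)"
proof -
  have "opn (U \<inter> W)" using affine_openD[OF assms(1)] assms(2) by (rule openin_Int)
  moreover have "x \<in> U \<inter> W" using assms(3,4) by blast
  ultimately obtain g where g: "g \<in> carrier (Sec X U)" "x \<in> basic_open X U g" "basic_open X U g \<subseteq> U \<inter> W"
    using affine_like_basis[OF affine_open_affine_like[OF assms(1)] _ Int_lower1] by metis
  then show ?thesis using that affine_open_basic_open[OF assms(1) g(1)] by blast
qed

lemma affine_open_torsion:
  assumes "affine_open X U" "f \<in> carrier (Sec X U)" "b \<in> carrier (Sec X U)"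
    and "Res X U (basic_open X U f) b = \<zero>\<^bsub>Sec X (basic_open X U f)\<^esub>"
  obtains n :: nat where "f [^]\<^bsub>Sec X U\<^esub> n \<otimes>\<^bsub>Sec X U\<^esub> b = \<zero>\<^bsub>Sec X U\<^esub>"
  using affine_like_torsion[OF affine_open_affine_like] assms by metis

lemma section_empty:
  assumes "s \<in> carrier (Sec X {})" "t \<in> carrier (Sec X {})" shows "s = t"
  using assms by (intro section_eqI[of "{}"]) auto

lemma basic_open_zero:
  assumes U: "affine_open X U" shows "basic_open X U \<zero>\<^bsub>Sec X U\<^esub> = {}"
proof -
  interpret cring "Sec X U" using cring_Sec affine_openD U by blast
  have "\<zero>\<^bsub>Sec X U\<^esub> \<in> prime_at U x" if "x \<in> U" for x
    using affine_open_affine_like[OF U] that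
    by (auto simp: affine_like_def intro: additive_subgroup.zero_closed ideal.axioms(1) primeideal.axioms(1))
  then show ?thesis using basic_open_subset by (fastforce simp: prime_at_def)
qed

lemma basic_open_add:
  assumes U: "affine_open X U" and f: "f \<in> carrier (Sec X U)" and g: "g \<in> carrier (Sec X U)"
  shows "basic_open X U (f \<oplus>\<^bsub>Sec X U\<^esub> g) \<subseteq> basic_open X U f \<union> basic_open X U g"
proof
  fix x assume x: "x \<in> basic_open X U (f \<oplus>\<^bsub>Sec X U\<^esub> g)"
  then have "x \<in> U" using basic_open_subset by blast
  then have "primeideal (prime_at U x) (Sec X U)"
    using affine_open_affine_like[OF U] by (simp add: affine_like_def)
  then have "additive_subgroup (prime_at U x) (Sec X U)"
    by (simp add: ideal.axioms(1) primeideal.axioms(1))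
  moreover have "f \<oplus>\<^bsub>Sec X U\<^esub> g \<notin> prime_at U x" using x by (simp add: prime_at_def)
  ultimately have "f \<notin> prime_at U x \<or> g \<notin> prime_at U x"
    using additive_subgroup.a_closed by metis
  then show "x \<in> basic_open X U f \<union> basic_open X U g" using f g by (simp add: prime_at_def)
qed

lemma ideal_sheaf_presheaf:
  assumes "sheaf_of_ideals X F" shows "ideal_presheaf F"
proof -
  have ideal: "\<forall>V. opn V \<longrightarrow> ideal (F V) (Sec X V)" and "is_sheaf (Top X) F (Res X)"
    using assms by (simp_all add: sheaf_of_ideals_def)
  then have "is_presheaf (Top X) F (Res X)" by (simp add: is_sheaf_def)
  from conjunct1[OF this[unfolded is_presheaf_def]] show ?thesis
    using ideal unfolding ideal_presheaf_def by blast
qed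

lemma ideal_sheaf_local:
  assumes F: "sheaf_of_ideals X F" and U: "opn U" and s: "s \<in> carrier (Sec X U)"
    and loc: "\<And>x. x \<in> U \<Longrightarrow> \<exists>W. opn W \<and> x \<in> W \<and> W \<subseteq> U \<and> Res X U W s \<in> F W"
  shows "s \<in> F U"
proof -
  define \<U> where "\<U> = {W. opn W \<and> W \<subseteq> U \<and> Res X U W s \<in> F W}"
  have Un: "\<Union>\<U> = U" using loc unfolding \<U>_def by blast
  have sheaf: "is_sheaf (Top X) F (Res X)" using F by (simp add: sheaf_of_ideals_def)
  have cov: "\<forall>W\<in>\<U>. opn W" "\<forall>W\<in>\<U>. Res X U W s \<in> F W" by (simp_all add: \<U>_def)
  have "\<forall>W\<in>\<U>. \<forall>V\<in>\<U>. Res X W (W \<inter> V) (Res X U W s) = Res X V (W \<inter> V) (Res X U V s)"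
  proof (intro ballI)
    fix W V assume "W \<in> \<U>" "V \<in> \<U>"
    then have op: "opn W" "opn V" "opn (W \<inter> V)" "W \<subseteq> U" "V \<subseteq> U" by (auto simp: \<U>_def)
    show "Res X W (W \<inter> V) (Res X U W s) = Res X V (W \<inter> V) (Res X U V s)"
      using Res_Res[OF U op(1,3) _ op(4) s] Res_Res[OF U op(2,3) _ op(5) s] by simp
  qed
  from is_sheaf_glue[OF sheaf cov this]
  obtain t where t: "t \<in> F U" "\<forall>W\<in>\<U>. Res X U W t = Res X U W s" unfolding Un by blast
  have "ideal (F U) (Sec X U)" using F U by (simp add: sheaf_of_ideals_def)
  then have tU: "t \<in> carrier (Sec X U)" using t(1) by (rule ideal.Icarr)
  have "t = s"
  proof (rule section_eqI[OF U tU s])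
    fix x assume "x \<in> U"
    then obtain W where "W \<in> \<U>" "x \<in> W" using Un by blast
    then show "\<exists>W. opn W \<and> x \<in> W \<and> W \<subseteq> U \<and> Res X U W t = Res X U W s"
      using t(2) by (intro exI[of _ W]) (simp add: \<U>_def)
  qed
  then show ?thesis using t(1) by simp
qed

text \<open>The neighbourhood is one on which the sheaf is given as some \<open>M\<^sup>~\<close>; its position relative to other affine open
  sets is not controlled.\<close>

lemma quasi_coherent_ideals_local:
  assumes I: "quasi_coherent_ideals X I" and x: "x \<in> topspace (Top X)"
  obtains W where "affine_open X W" "x \<in> W" "extends_up_to_powers I W"
proof -
  obtain W and R :: "'r ring" and \<phi> \<psi> and M :: "('r, 'r) module" and \<eta>
    where W: "opn W" "x \<in> W" and R: "cring R"
      and iso: "ringed_space_iso (open_subspace X W) (Spec R) \<phi> \<psi>" and M: "Module.module R M"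
      and tilde: "tilde_iso (open_subspace X W) (\<lambda>U. ideal_as_module (Sec X U) (I U)) (Res X) R \<phi> \<psi> M \<eta>"
    using I x unfolding quasi_coherent_ideals_def quasi_coherent_def by meson
  interpret spec_chart X W R \<phi> \<psi>
    using W(1) R iso by (intro spec_chart.intro spec_chart_axioms.intro ringed_space_locale_axioms)
  have "extends_up_to_powers I W"
  proof (rule extends_up_to_powers_chart[OF M])
    fix V assume V: "zariski_open R V"
    show "bij_betw (\<eta> V) (tilde_sections R M V) (I (pre V))"
      using tilde V by (simp add: tilde_iso_def tilde_def openin_zariski)
    show "\<eta> V (\<lambda>q\<in>V. a q \<odot>\<^bsub>loc_module R M (carrier R - q)\<^esub> s q) = \<psi> V a \<otimes>\<^bsub>Sec X (pre V)\<^esub> \<eta> V s"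
      if "a \<in> tilde_sections R (self_module R) V" "s \<in> tilde_sections R M V" for a s
      using tilde V that by (simp add: tilde_iso_def tilde_def openin_zariski Sec_Spec_simps(1))
    show "\<eta> V' (restrict s V') = Res X (pre V) (pre V') (\<eta> V s)"
      if "zariski_open R V'" "V' \<subseteq> V" "s \<in> tilde_sections R M V" for V' s
      using tilde V that by (simp add: tilde_iso_def tilde_def openin_zariski)
  qed
  moreover have "affine_open X W" unfolding affine_open_def using W R iso by blast
  ultimately show ?thesis using that W(2) by blast
qed

text \<open>Some \<open>f\<^sup>n b\<close> agrees on \<open>D(f)\<close> with a global section of the ideal sheaf, and the difference is killed by a
  further power of \<open>f\<close>.\<close>

lemma power_times_section_in_ideal:
  assumes U: "affine_open X U" and F: "ideal_presheaf F" and ext: "extends_up_to_powers F U"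
    and f: "f \<in> carrier (Sec X U)" and b: "b \<in> carrier (Sec X U)"
    and bF: "Res X U (basic_open X U f) b \<in> F (basic_open X U f)"
  shows "\<exists>n::nat. f [^]\<^bsub>Sec X U\<^esub> n \<otimes>\<^bsub>Sec X U\<^esub> b \<in> F U"
proof -
  let ?E = "basic_open X U f"
  note opU = affine_openD[OF U]
  have op: "opn ?E" using basic_open_open[OF opU f] .
  interpret cring "Sec X U" using opU by (rule cring_Sec)
  interpret E: cring "Sec X ?E" using op by (rule cring_Sec)
  interpret FU: ideal "F U" "Sec X U" using F opU by (simp add: ideal_presheaf_def)
  obtain n :: nat and c where c: "c \<in> F U"
    and e: "Res X U ?E (f [^]\<^bsub>Sec X U\<^esub> n) \<otimes>\<^bsub>Sec X ?E\<^esub> Res X U ?E b = Res X U ?E c"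
    using extends_up_to_powersE[OF ext f bF] .
  have cc: "c \<in> carrier (Sec X U)" using c FU.Icarr by blast
  have fn: "f [^]\<^bsub>Sec X U\<^esub> n \<in> carrier (Sec X U)" "f [^]\<^bsub>Sec X U\<^esub> n \<otimes>\<^bsub>Sec X U\<^esub> b \<in> carrier (Sec X U)"
    using f b by auto
  have "Res X U ?E (f [^]\<^bsub>Sec X U\<^esub> n \<otimes>\<^bsub>Sec X U\<^esub> b \<ominus>\<^bsub>Sec X U\<^esub> c) = \<zero>\<^bsub>Sec X ?E\<^esub>"
    using Res_minus[OF opU op basic_open_subset fn(2) cc] Res_mult[OF opU op basic_open_subset fn(1) b] e
      Res_closed[OF opU op basic_open_subset cc] by (simp add: E.r_neg E.minus_eq)
  then obtain k :: nat where
    k: "f [^]\<^bsub>Sec X U\<^esub> k \<otimes>\<^bsub>Sec X U\<^esub> (f [^]\<^bsub>Sec X U\<^esub> n \<otimes>\<^bsub>Sec X U\<^esub> b \<ominus>\<^bsub>Sec X U\<^esub> c) = \<zero>\<^bsub>Sec X U\<^esub>"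
    using affine_open_torsion[OF U f minus_closed[OF fn(2) cc]] by blast
  have fk: "f [^]\<^bsub>Sec X U\<^esub> k \<in> carrier (Sec X U)" using f by simp
  have "f [^]\<^bsub>Sec X U\<^esub> k \<otimes>\<^bsub>Sec X U\<^esub> (f [^]\<^bsub>Sec X U\<^esub> n \<otimes>\<^bsub>Sec X U\<^esub> b)
      \<ominus>\<^bsub>Sec X U\<^esub> f [^]\<^bsub>Sec X U\<^esub> k \<otimes>\<^bsub>Sec X U\<^esub> c = \<zero>\<^bsub>Sec X U\<^esub>"
    using k fk fn(2) cc by (simp add: minus_eq r_distr r_minus)
  then have "f [^]\<^bsub>Sec X U\<^esub> k \<otimes>\<^bsub>Sec X U\<^esub> (f [^]\<^bsub>Sec X U\<^esub> n \<otimes>\<^bsub>Sec X U\<^esub> b) = f [^]\<^bsub>Sec X U\<^esub> k \<otimes>\<^bsub>Sec X U\<^esub> c"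
    using r_right_minus_eq[OF m_closed[OF fk fn(2)] m_closed[OF fk cc]] by blast
  then have "f [^]\<^bsub>Sec X U\<^esub> (k + n) \<otimes>\<^bsub>Sec X U\<^esub> b \<in> F U"
    using FU.I_l_closed[OF c fk] m_assoc[OF fk fn(1) b] nat_pow_mult[OF f, of k n] by simp
  then show ?thesis by blast
qed

text \<open>Passes from the open sets on which quasi-coherence is given to all affine open sets. A section \<open>t\<close> of the
  ideal sheaf over \<open>D(f)\<close> satisfies \<open>f\<^sup>n t = b\<close> for some \<open>b \<in> \<O>(V)\<close>, and it remains to find \<open>m\<close> with
  \<open>f\<^sup>m b \<in> I(V)\<close>. The elements \<open>g\<close> such that this holds over \<open>D(g)\<close> for some \<open>m\<close> form an ideal, because
  membership in a sheaf of ideals is local, and by the local form of quasi-coherence they have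
  no common zero.\<close>

theorem quasi_coherent_extends:
  assumes I: "quasi_coherent_ideals X I" and V: "affine_open X V"
  shows "extends_up_to_powers I V"
  unfolding extends_up_to_powers_def
proof (intro ballI)
  fix f t assume f: "f \<in> carrier (Sec X V)" and t: "t \<in> I (basic_open X V f)"
  let ?D = "basic_open X V f"
  have sheafI: "sheaf_of_ideals X I" using I by (simp add: quasi_coherent_ideals_def)
  note preI = ideal_sheaf_presheaf[OF sheafI]
  have ideal_I: "ideal (I U) (Sec X U)" if "opn U" for U using preI that by (simp add: ideal_presheaf_def)
  have Res_I: "Res X U W s \<in> I W" if "opn U" "opn W" "W \<subseteq> U" "s \<in> I U" for U W s
    using preI that by (simp add: ideal_presheaf_def)
  note opV = affine_openD[OF V]
  have opD: "opn ?D" using basic_open_open[OF opV f] .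
  interpret A: cring "Sec X V" using opV by (rule cring_Sec)
  interpret B: cring "Sec X ?D" using opD by (rule cring_Sec)
  have tD: "t \<in> carrier (Sec X ?D)" using ideal.Icarr[OF ideal_I[OF opD] t] .
  have extV: "extends_up_to_powers (\<lambda>V. carrier (Sec X V)) V"
    using V by (simp add: affine_open_iff_criterion affine_criterion_def)
  obtain n :: nat and b where b: "b \<in> carrier (Sec X V)"
    and e: "Res X V ?D (f [^]\<^bsub>Sec X V\<^esub> n) \<otimes>\<^bsub>Sec X ?D\<^esub> t = Res X V ?D b"
    using extends_up_to_powersE[OF extV f tD] .
  have fD: "Res X V ?D (f [^]\<^bsub>Sec X V\<^esub> k) \<in> carrier (Sec X ?D)" for k :: nat
    using Res_closed[OF opV opD basic_open_subset] f by simp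
  have bI: "Res X V ?D b \<in> I ?D"
    using ideal.I_l_closed[OF ideal_I[OF opD] t fD[of n]] e by simp
  \<comment> \<open>from here on the claim concerns the global section \<open>b\<close>, which is in \<open>I\<close> over \<open>D(f)\<close>\<close>
  have fb: "f [^]\<^bsub>Sec X V\<^esub> m \<otimes>\<^bsub>Sec X V\<^esub> b \<in> carrier (Sec X V)" for m :: nat using f b by simp
  define C where "C = {g \<in> carrier (Sec X V). \<exists>m::nat.
    Res X V (basic_open X V g) (f [^]\<^bsub>Sec X V\<^esub> m \<otimes>\<^bsub>Sec X V\<^esub> b) \<in> I (basic_open X V g)}"
  have shift: "Res X V W (f [^]\<^bsub>Sec X V\<^esub> (k + m) \<otimes>\<^bsub>Sec X V\<^esub> b) \<in> I W"
    if W: "opn W" "W \<subseteq> V" and m: "Res X V W (f [^]\<^bsub>Sec X V\<^esub> m \<otimes>\<^bsub>Sec X V\<^esub> b) \<in> I W" for W and k m :: nat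
  proof -
    have fk: "f [^]\<^bsub>Sec X V\<^esub> k \<in> carrier (Sec X V)" "f [^]\<^bsub>Sec X V\<^esub> m \<in> carrier (Sec X V)" using f by auto
    have "f [^]\<^bsub>Sec X V\<^esub> (k + m) \<otimes>\<^bsub>Sec X V\<^esub> b = f [^]\<^bsub>Sec X V\<^esub> k \<otimes>\<^bsub>Sec X V\<^esub> (f [^]\<^bsub>Sec X V\<^esub> m \<otimes>\<^bsub>Sec X V\<^esub> b)"
      using A.m_assoc[OF fk b] A.nat_pow_mult[OF f, of k m] by simp
    then show ?thesis
      using Res_mult[OF opV W fk(1) fb[of m]] ideal.I_l_closed[OF ideal_I[OF W(1)] m Res_closed[OF opV W fk(1)]]
      by simp
  qed
  have "ideal C (Sec X V)"
  proof (rule A.ideal_of_closed)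
    show "C \<subseteq> carrier (Sec X V)" by (auto simp: C_def)
    show "\<zero>\<^bsub>Sec X V\<^esub> \<in> C"
    proof -
      \<comment> \<open>\<open>D(0)\<close> is empty, and over the empty set all sections agree\<close>
      have op: "opn {}" by simp
      have zero: "\<zero>\<^bsub>Sec X {}\<^esub> \<in> I {}"
        using additive_subgroup.zero_closed[OF ideal.axioms(1)[OF ideal_I[OF op]]] .
      have "Res X V {} (f [^]\<^bsub>Sec X V\<^esub> (0::nat) \<otimes>\<^bsub>Sec X V\<^esub> b) = \<zero>\<^bsub>Sec X {}\<^esub>"
        using section_empty[OF Res_closed[OF opV op _ fb] ideal.Icarr[OF ideal_I[OF op] zero]] by blast
      then show ?thesis using zero unfolding C_def basic_open_zero[OF V] mem_Collect_eq
        by (metis A.zero_closed basic_open_zero[OF V])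
    qed
    show "g \<oplus>\<^bsub>Sec X V\<^esub> g' \<in> C" if gC: "g \<in> C" "g' \<in> C" for g g'
    proof -
      obtain m m' :: nat where g: "g \<in> carrier (Sec X V)" "g' \<in> carrier (Sec X V)"
        and m: "Res X V (basic_open X V g) (f [^]\<^bsub>Sec X V\<^esub> m \<otimes>\<^bsub>Sec X V\<^esub> b) \<in> I (basic_open X V g)"
        and m': "Res X V (basic_open X V g') (f [^]\<^bsub>Sec X V\<^esub> m' \<otimes>\<^bsub>Sec X V\<^esub> b) \<in> I (basic_open X V g')"
        using gC by (auto simp: C_def)
      let ?E = "basic_open X V (g \<oplus>\<^bsub>Sec X V\<^esub> g')" and ?s = "f [^]\<^bsub>Sec X V\<^esub> (m + m') \<otimes>\<^bsub>Sec X V\<^esub> b"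
      have gg: "g \<oplus>\<^bsub>Sec X V\<^esub> g' \<in> carrier (Sec X V)" using g by simp
      have opE: "opn ?E" and op: "opn (basic_open X V g)" "opn (basic_open X V g')"
        using basic_open_open[OF opV] g gg by auto
      have s: "Res X V (basic_open X V g) ?s \<in> I (basic_open X V g)"
        "Res X V (basic_open X V g') ?s \<in> I (basic_open X V g')"
        using shift[OF op(1) basic_open_subset m, of m'] shift[OF op(2) basic_open_subset m', of m]
        by (simp_all add: add.commute)
      have step: "Res X ?E (?E \<inter> W) (Res X V ?E ?s) \<in> I (?E \<inter> W)"
        if W: "opn W" "W \<subseteq> V" "Res X V W ?s \<in> I W" for W
      proof -
        have op': "opn (?E \<inter> W)" using opE W(1) by (rule openin_Int)
        show ?thesis
          using Res_I[OF W(1) op' _ W(3)] Res_Res[OF opV W(1) op' _ W(2) fb[of "m + m'"]]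
            Res_Res[OF opV opE op' _ basic_open_subset fb[of "m + m'"]] by simp
      qed
      have "Res X V ?E ?s \<in> I ?E"
      proof (rule ideal_sheaf_local[OF sheafI opE Res_closed[OF opV opE basic_open_subset fb]])
        fix x assume x: "x \<in> ?E"
        then have "x \<in> basic_open X V g \<or> x \<in> basic_open X V g'" using basic_open_add[OF V g] by blast
        then show "\<exists>W. opn W \<and> x \<in> W \<and> W \<subseteq> ?E \<and> Res X ?E W (Res X V ?E ?s) \<in> I W"
        proof
          assume "x \<in> basic_open X V g"
          then show ?thesis
            using step[OF op(1) basic_open_subset s(1)] x openin_Int[OF opE op(1)]
            by (intro exI[of _ "?E \<inter> basic_open X V g"]) blast
        next
          assume "x \<in> basic_open X V g'"
          then show ?thesis
            using step[OF op(2) basic_open_subset s(2)] x openin_Int[OF opE op(2)]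
            by (intro exI[of _ "?E \<inter> basic_open X V g'"]) blast
        qed
      qed
      then show ?thesis using gg by (auto simp: C_def)
    qed
    show "r \<otimes>\<^bsub>Sec X V\<^esub> g \<in> C" if r: "r \<in> carrier (Sec X V)" and gC: "g \<in> C" for r g
    proof -
      obtain m :: nat where g: "g \<in> carrier (Sec X V)"
        and m: "Res X V (basic_open X V g) (f [^]\<^bsub>Sec X V\<^esub> m \<otimes>\<^bsub>Sec X V\<^esub> b) \<in> I (basic_open X V g)"
        using gC by (auto simp: C_def)
      have rg: "r \<otimes>\<^bsub>Sec X V\<^esub> g \<in> carrier (Sec X V)" using r g by simp
      have sub: "basic_open X V (r \<otimes>\<^bsub>Sec X V\<^esub> g) \<subseteq> basic_open X V g"
        using basic_open_mult[OF opV r g] by blast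
      have op: "opn (basic_open X V g)" "opn (basic_open X V (r \<otimes>\<^bsub>Sec X V\<^esub> g))"
        using basic_open_open[OF opV] g rg by auto
      have "Res X V (basic_open X V (r \<otimes>\<^bsub>Sec X V\<^esub> g)) (f [^]\<^bsub>Sec X V\<^esub> m \<otimes>\<^bsub>Sec X V\<^esub> b)
          \<in> I (basic_open X V (r \<otimes>\<^bsub>Sec X V\<^esub> g))"
        using Res_I[OF op sub m] Res_Res[OF opV op sub basic_open_subset fb] by simp
      then show ?thesis using rg by (auto simp: C_def)
    qed
  qed
  moreover have "\<exists>g\<in>C. x \<in> basic_open X V g" if x: "x \<in> V" for x
  proof -
    have "x \<in> topspace (Top X)" using x opV openin_subset by blast
    then obtain W where W: "affine_open X W" "x \<in> W" "extends_up_to_powers I W"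
      using quasi_coherent_ideals_local[OF I] by blast
    obtain h where h: "h \<in> carrier (Sec X W)" "x \<in> basic_open X W h" "basic_open X W h \<subseteq> W \<inter> V"
      and aff: "affine_open X (basic_open X W h)"
      using affine_open_basis[OF W(1) opV W(2) x] .
    \<comment> \<open>on \<open>N\<close> the sheaf is known to extend up to powers, and \<open>N\<close> lies in \<open>V\<close>, where \<open>f\<close> and \<open>b\<close> live\<close>
    let ?N = "basic_open X W h"
    interpret N: affine_basic_open X W h
      using W h by unfold_locales (simp_all add: affine_open_iff_criterion)
    have extN: "extends_up_to_powers I ?N" using N.extends_up_to_powers_basic_open[OF preI W(3)] .
    note opN = affine_openD[OF aff]
    have NV: "?N \<subseteq> V" using h(3) by blast
    let ?f = "Res X V ?N f" and ?b = "Res X V ?N b"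
    have fN: "?f \<in> carrier (Sec X ?N)" "?b \<in> carrier (Sec X ?N)" using Res_closed[OF opV opN NV] f b by auto
    have E: "basic_open X ?N ?f = ?D \<inter> ?N" using basic_open_Res[OF opV opN NV f] .
    have opE: "opn (?D \<inter> ?N)" using opD opN by (rule openin_Int)
    have "Res X ?N (?D \<inter> ?N) ?b = Res X ?D (?D \<inter> ?N) (Res X V ?D b)"
      using Res_Res[OF opV opN opE _ NV b] Res_Res[OF opV opD opE _ basic_open_subset b] by simp
    then have "Res X ?N (basic_open X ?N ?f) ?b \<in> I (basic_open X ?N ?f)"
      unfolding E using Res_I[OF opD opE _ bI] by simp
    from power_times_section_in_ideal[OF aff preI extN fN this]
    obtain k :: nat where "?f [^]\<^bsub>Sec X ?N\<^esub> k \<otimes>\<^bsub>Sec X ?N\<^esub> ?b \<in> I ?N" by blast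
    then have k: "Res X V ?N (f [^]\<^bsub>Sec X V\<^esub> k \<otimes>\<^bsub>Sec X V\<^esub> b) \<in> I ?N"
      using Res_mult[OF opV opN NV A.nat_pow_closed[OF f] b] Res_pow[OF opV opN NV f] by simp
    obtain g where g: "g \<in> carrier (Sec X V)" "x \<in> basic_open X V g" "basic_open X V g \<subseteq> V \<inter> ?N"
      by (rule affine_open_basis[OF V opN x h(2)]) (rule that)
    have opg: "opn (basic_open X V g)" using basic_open_open[OF opV g(1)] .
    have "Res X V (basic_open X V g) (f [^]\<^bsub>Sec X V\<^esub> k \<otimes>\<^bsub>Sec X V\<^esub> b) \<in> I (basic_open X V g)"
      using Res_I[OF opN opg _ k] Res_Res[OF opV opN opg _ NV fb] g(3) by simp
    then show ?thesis using g(1,2) by (auto simp: C_def)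
  qed
  ultimately have "\<one>\<^bsub>Sec X V\<^esub> \<in> C" by (rule affine_open_covering_ideal[OF V])
  then obtain m :: nat where "Res X V V (f [^]\<^bsub>Sec X V\<^esub> m \<otimes>\<^bsub>Sec X V\<^esub> b) \<in> I V"
    by (auto simp: C_def basic_open_Units[OF opV A.Units_one_closed])
  then have c: "f [^]\<^bsub>Sec X V\<^esub> m \<otimes>\<^bsub>Sec X V\<^esub> b \<in> I V" using Res_id[OF opV fb] by simp
  have fmn: "f [^]\<^bsub>Sec X V\<^esub> m \<in> carrier (Sec X V)" "f [^]\<^bsub>Sec X V\<^esub> n \<in> carrier (Sec X V)" using f by auto
  have "Res X V ?D (f [^]\<^bsub>Sec X V\<^esub> (m + n)) \<otimes>\<^bsub>Sec X ?D\<^esub> t = Res X V ?D (f [^]\<^bsub>Sec X V\<^esub> m \<otimes>\<^bsub>Sec X V\<^esub> b)"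
    using A.nat_pow_mult[OF f, of m n] Res_mult[OF opV opD basic_open_subset fmn]
      Res_mult[OF opV opD basic_open_subset fmn(1) b] B.m_assoc[OF fD fD tD] e by metis
  then show "\<exists>n::nat. \<exists>c\<in>I V. Res X V ?D (f [^]\<^bsub>Sec X V\<^esub> n) \<otimes>\<^bsub>Sec X ?D\<^esub> t = Res X V ?D c"
    using c by blast
qed

lemma extend_ideal_ideal:
  assumes "opn U" "opn V" "V \<subseteq> U" "J \<subseteq> carrier (Sec X U)"
  shows "ideal (extend_ideal X U V J) (Sec X V)"
  unfolding extend_ideal_def
  using Res_closed[OF assms(1-3)] assms(4)
  by (intro ring.genideal_ideal[OF cring.axioms(1)[OF cring_Sec[OF assms(2)]]]) blast

lemma extend_ideal_subset:
  assumes F: "ideal_presheaf F" and "opn U" "opn V" "V \<subseteq> U"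
  shows "extend_ideal X U V (F U) \<subseteq> F V"
  unfolding extend_ideal_def
proof (rule ring.genideal_minimal[OF cring.axioms(1)[OF cring_Sec[OF assms(3)]]])
  show "ideal (F V) (Sec X V)" "Res X U V ` F U \<subseteq> F V"
    using assms by (auto simp: ideal_presheaf_def)
qed

text \<open>Together with the evident converse inclusion: \<open>I(D(f)) = I(V)\<^sub>f\<close>.\<close>

lemma quasi_coherent_basic_open_subset:
  assumes I: "quasi_coherent_ideals X I" and V: "affine_open X V" and f: "f \<in> carrier (Sec X V)"
  shows "I (basic_open X V f) \<subseteq> extend_ideal X V (basic_open X V f) (I V)"
proof
  let ?D = "basic_open X V f"
  fix t assume t: "t \<in> I ?D"
  note opV = affine_openD[OF V]
  have opD: "opn ?D" using basic_open_open[OF opV f] .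
  interpret B: cring "Sec X ?D" using opD by (rule cring_Sec)
  have ideal_I: "ideal (I U) (Sec X U)" if "opn U" for U
    using I that by (simp add: quasi_coherent_ideals_def sheaf_of_ideals_def)
  have IV: "I V \<subseteq> carrier (Sec X V)" using ideal.Icarr[OF ideal_I[OF opV]] by blast
  have tD: "t \<in> carrier (Sec X ?D)" using ideal.Icarr[OF ideal_I[OF opD] t] .
  interpret E: ideal "extend_ideal X V ?D (I V)" "Sec X ?D"
    using extend_ideal_ideal[OF opV opD basic_open_subset IV] .
  obtain n :: nat and c where c: "c \<in> I V"
    and e: "Res X V ?D (f [^]\<^bsub>Sec X V\<^esub> n) \<otimes>\<^bsub>Sec X ?D\<^esub> t = Res X V ?D c"
    using extends_up_to_powersE[OF quasi_coherent_extends[OF I V] f t] .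
  have "Res X V ?D ` I V \<subseteq> extend_ideal X V ?D (I V)"
    unfolding extend_ideal_def
    using Res_closed[OF opV opD basic_open_subset] IV by (intro B.genideal_self) blast
  then have cE: "Res X V ?D c \<in> extend_ideal X V ?D (I V)" using c by blast
  have u: "Res X V ?D (f [^]\<^bsub>Sec X V\<^esub> n) \<in> Units (Sec X ?D)"
    using Res_pow[OF opV opD basic_open_subset f] B.Units_pow_closed[OF Res_basic_open_Units[OF opV f]] by simp
  have "t = inv\<^bsub>Sec X ?D\<^esub> (Res X V ?D (f [^]\<^bsub>Sec X V\<^esub> n)) \<otimes>\<^bsub>Sec X ?D\<^esub> Res X V ?D c"
    unfolding e[symmetric]
    using B.m_assoc[OF B.Units_inv_closed[OF u] B.Units_closed[OF u] tD] B.Units_l_inv[OF u] tD by simp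
  then show "t \<in> extend_ideal X V ?D (I V)"
    using E.I_l_closed[OF cE B.Units_inv_closed[OF u]] by simp
qed

section \<open>The closure of a quasi-coherent sheaf of ideals\<close>

text \<open>Let \<open>G\<close> be the set of all \<open>g \<in> \<O>(V)\<close> for which the assertion holds over \<open>D(g)\<close>. Small sets \<open>D(g)\<close> lie in an
  affine open set on which \<open>s\<close> is in the closure, so \<open>g \<in> G\<close> by open persistence and by
  \<open>I(D(g)) = I(V)\<^sub>g\<close>. Hence \<open>G\<close> generates the unit ideal, and glueability applies with \<open>g = 1\<close>.\<close>

lemma closure_on_affine_open:
  assumes cl: "preclosure_over X cl" and glue: "glueable X cl" and I: "quasi_coherent_ideals X I"
    and U: "opn U" and s: "s \<in> cl_sheaf X cl I U" and V: "affine_open X V" "V \<subseteq> U"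
  shows "Res X U V s \<in> cl V (I V)"
proof -
  have sU: "s \<in> carrier (Sec X U)"
    and loc: "\<And>x. x \<in> U \<Longrightarrow> \<exists>W. affine_open X W \<and> x \<in> W \<and> W \<subseteq> U \<and> Res X U W s \<in> cl W (I W)"
    using s by (auto simp: cl_sheaf_def)
  have preI: "ideal_presheaf I"
    using I ideal_sheaf_presheaf by (simp add: quasi_coherent_ideals_def)
  have ideal_I: "ideal (I U) (Sec X U)" if "opn U" for U using preI that by (simp add: ideal_presheaf_def)
  have carr_I: "I U \<subseteq> carrier (Sec X U)" if "opn U" for U using ideal.Icarr[OF ideal_I[OF that]] by blast
  have mono: "cl W J \<subseteq> cl W K" if "affine_open X W" "ideal J (Sec X W)" "ideal K (Sec X W)" "J \<subseteq> K" for W J K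
    using cl that by (auto simp: preclosure_over_def preclosure_on_def mono_on_def)
  note opV = affine_openD[OF V(1)]
  interpret A: cring "Sec X V" using opV by (rule cring_Sec)
  let ?z = "Res X U V s"
  have z: "?z \<in> carrier (Sec X V)" using Res_closed[OF U opV V(2) sU] .
  define G where "G = {g \<in> carrier (Sec X V). Res X V (basic_open X V g) ?z
      \<in> cl (basic_open X V g) (extend_ideal X V (basic_open X V g) (I V))}"
  have G: "G \<subseteq> carrier (Sec X V)" by (auto simp: G_def)
  have "\<exists>g\<in>Idl\<^bsub>Sec X V\<^esub> G. x \<in> basic_open X V g" if x: "x \<in> V" for x
  proof -
    obtain W where W: "affine_open X W" "x \<in> W" "W \<subseteq> U" "Res X U W s \<in> cl W (I W)"
      using loc x V(2) by blast
    note opW = affine_openD[OF W(1)]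
    obtain g where g: "g \<in> carrier (Sec X V)" "x \<in> basic_open X V g" "basic_open X V g \<subseteq> V \<inter> W"
      and aff: "affine_open X (basic_open X V g)"
      using affine_open_basis[OF V(1) opW x W(2)] .
    let ?D = "basic_open X V g"
    note opD = affine_openD[OF aff]
    have DW: "?D \<subseteq> W" using g(3) by blast
    have "Res X W ?D (Res X U W s) \<in> cl ?D (extend_ideal X W ?D (I W))"
      using glue W(1,4) aff DW ideal_I[OF opW] unfolding glueable_def openly_persistent_def by blast
    also have "\<dots> \<subseteq> cl ?D (extend_ideal X V ?D (I V))"
    proof (rule mono[OF aff])
      show "ideal (extend_ideal X W ?D (I W)) (Sec X ?D)"
        using extend_ideal_ideal[OF opW opD DW carr_I[OF opW]] .
      show "ideal (extend_ideal X V ?D (I V)) (Sec X ?D)"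
        using extend_ideal_ideal[OF opV opD basic_open_subset carr_I[OF opV]] .
      show "extend_ideal X W ?D (I W) \<subseteq> extend_ideal X V ?D (I V)"
        using extend_ideal_subset[OF preI opW opD DW] quasi_coherent_basic_open_subset[OF I V(1) g(1)] by blast
    qed
    finally have "g \<in> G"
      using Res_Res[OF U opW opD DW W(3) sU] Res_Res[OF U opV opD basic_open_subset V(2) sU] g(1)
      by (simp add: G_def)
    then show ?thesis using A.genideal_self[OF G] g(2) by blast
  qed
  then have "\<one>\<^bsub>Sec X V\<^esub> \<in> Idl\<^bsub>Sec X V\<^esub> G"
    by (rule affine_open_covering_ideal[OF V(1) A.genideal_ideal[OF G]])
  then have "\<one>\<^bsub>Sec X V\<^esub> \<in> ideal_radical (Sec X V) (Idl\<^bsub>Sec X V\<^esub> G)"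
    by (auto simp: ideal_radical_def)
  moreover have "\<forall>g\<in>G. Res X V (basic_open X V g) ?z
      \<in> cl (basic_open X V g) (extend_ideal X V (basic_open X V g) (I V))"
    by (simp add: G_def)
  \<comment> \<open>glueability for the ideal generated by \<open>G\<close>, with the element \<open>1\<close> of its radical\<close>
  ultimately have "Res X V (basic_open X V \<one>\<^bsub>Sec X V\<^esub>) ?z
      \<in> cl (basic_open X V \<one>\<^bsub>Sec X V\<^esub>) (extend_ideal X V (basic_open X V \<one>\<^bsub>Sec X V\<^esub>) (I V))"
    using glue V(1) A.genideal_ideal[OF G] G ideal_I[OF opV] z unfolding glueable_def by blast
  then have "?z \<in> cl V (extend_ideal X V V (I V))"
    using basic_open_Units[OF opV A.Units_one_closed] Res_id[OF opV z] by simp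
  then show ?thesis
    using mono[OF V(1) extend_ideal_ideal[OF opV opV order_refl carr_I[OF opV]] ideal_I[OF opV]]
      extend_ideal_subset[OF preI opV opV order_refl] by blast
qed

end

theorem theorem2p6:
  fixes X :: "('a, 'r) ringed_space"
    and cl :: "'a set \<Rightarrow> 'r set \<Rightarrow> 'r set"
    and \<I> :: "'a set \<Rightarrow> 'r set"
  assumes "scheme X"
    and "preclosure_over X cl"
    and "glueable X cl"
    and "quasi_coherent_ideals X \<I>"
  shows "(\<forall>U s. openin (Top X) U \<and> s \<in> carrier (Sec X U) \<longrightarrow>
            (s \<in> cl_sheaf X cl \<I> U \<longleftrightarrow>
              (\<forall>V. affine_open X V \<and> V \<subseteq> U \<longrightarrow> Res X U V s \<in> cl V (\<I> V)))) \<and>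
         (\<forall>V. affine_open X V \<longrightarrow> cl_sheaf X cl \<I> V = cl V (\<I> V)) \<and>
         (\<forall>\<F>. sheaf_of_ideals X \<F> \<and> (\<forall>V. affine_open X V \<longrightarrow> \<F> V = cl V (\<I> V)) \<longrightarrow>
            (\<forall>U. openin (Top X) U \<longrightarrow> \<F> U = cl_sheaf X cl \<I> U))"
proof -
  interpret ringed_space_locale X
    using assms(1) by unfold_locales (simp add: scheme_def locally_ringed_space_def)
  have affine_nbhd: "\<exists>V. affine_open X V \<and> x \<in> V \<and> V \<subseteq> U" if U: "opn U" and x: "x \<in> U" for U x
  proof -
    have "x \<in> topspace (Top X)" using openin_subset[OF U] x by blast
    then obtain W where W: "affine_open X W" "x \<in> W"
      using assms(1) unfolding scheme_def by blast
    from affine_open_basis[OF W(1) U W(2) x] obtain g where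
      "x \<in> basic_open X W g" "basic_open X W g \<subseteq> W \<inter> U" "affine_open X (basic_open X W g)" .
    then show ?thesis by blast
  qed
  have characterization: "s \<in> cl_sheaf X cl \<I> U \<longleftrightarrow>
      (\<forall>V. affine_open X V \<and> V \<subseteq> U \<longrightarrow> Res X U V s \<in> cl V (\<I> V))"
    if U: "opn U" and s: "s \<in> carrier (Sec X U)" for U s
  proof
    assume "s \<in> cl_sheaf X cl \<I> U"
    then show "\<forall>V. affine_open X V \<and> V \<subseteq> U \<longrightarrow> Res X U V s \<in> cl V (\<I> V)"
      using closure_on_affine_open[OF assms(2-4) U] by blast
  next
    assume "\<forall>V. affine_open X V \<and> V \<subseteq> U \<longrightarrow> Res X U V s \<in> cl V (\<I> V)"
    then show "s \<in> cl_sheaf X cl \<I> U"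
      using affine_nbhd[OF U] s unfolding cl_sheaf_def by blast
  qed
  have affine: "cl_sheaf X cl \<I> V = cl V (\<I> V)" if V: "affine_open X V" for V
  proof (intro equalityI subsetI)
    note opV = affine_openD[OF V]
    have "ideal (\<I> V) (Sec X V)"
      using assms(4) opV by (simp add: quasi_coherent_ideals_def sheaf_of_ideals_def)
    then have "ideal (cl V (\<I> V)) (Sec X V)"
      using assms(2) V by (auto simp: preclosure_over_def preclosure_on_def)
    then have carr: "s \<in> carrier (Sec X V)" if "s \<in> cl V (\<I> V)" for s
      using that by (rule ideal.Icarr)
    {
      fix s assume s: "s \<in> cl_sheaf X cl \<I> V"
      then have "s \<in> carrier (Sec X V)" by (simp add: cl_sheaf_def)
      then show "s \<in> cl V (\<I> V)"
        using closure_on_affine_open[OF assms(2-4) opV s V order_refl] Res_id[OF opV] by simp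
    next
      fix s assume s: "s \<in> cl V (\<I> V)"
      then have "Res X V V s \<in> cl V (\<I> V)" using Res_id[OF opV carr] by simp
      then show "s \<in> cl_sheaf X cl \<I> V" using V carr[OF s] unfolding cl_sheaf_def by blast
    }
  qed
  have unique: "\<F> U = cl_sheaf X cl \<I> U"
    if F: "sheaf_of_ideals X \<F>" and aff: "\<And>V. affine_open X V \<Longrightarrow> \<F> V = cl V (\<I> V)" and U: "opn U" for \<F> U
  proof (intro equalityI subsetI)
    have pre: "ideal_presheaf \<F>" using ideal_sheaf_presheaf[OF F] .
    {
      fix s assume s: "s \<in> \<F> U"
      then have sU: "s \<in> carrier (Sec X U)"
        using pre U ideal.Icarr by (force simp: ideal_presheaf_def)
      have "Res X U V s \<in> cl V (\<I> V)" if V: "affine_open X V" "V \<subseteq> U" for V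
        using pre U s V affine_openD[OF V(1)] aff[OF V(1)] unfolding ideal_presheaf_def by blast
      then show "s \<in> cl_sheaf X cl \<I> U" using characterization[OF U sU] by blast
    next
      fix s assume s: "s \<in> cl_sheaf X cl \<I> U"
      then have sU: "s \<in> carrier (Sec X U)" by (simp add: cl_sheaf_def)
      show "s \<in> \<F> U"
      proof (rule ideal_sheaf_local[OF F U sU])
        fix x assume "x \<in> U"
        then obtain W where W: "affine_open X W" "x \<in> W" "W \<subseteq> U" "Res X U W s \<in> cl W (\<I> W)"
          using s by (auto simp: cl_sheaf_def)
        then show "\<exists>W. opn W \<and> x \<in> W \<and> W \<subseteq> U \<and> Res X U W s \<in> \<F> W"
          using affine_openD[OF W(1)] aff[OF W(1)] by blast
      qed
    }
  qed
  show ?thesis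
  proof (intro conjI allI impI)
    show "s \<in> cl_sheaf X cl \<I> U \<longleftrightarrow> (\<forall>V. affine_open X V \<and> V \<subseteq> U \<longrightarrow> Res X U V s \<in> cl V (\<I> V))"
      if "opn U \<and> s \<in> carrier (Sec X U)" for U s
      using characterization that by simp
    show "cl_sheaf X cl \<I> V = cl V (\<I> V)" if "affine_open X V" for V
      using affine that .
    show "\<F> U = cl_sheaf X cl \<I> U"
      if "sheaf_of_ideals X \<F> \<and> (\<forall>V. affine_open X V \<longrightarrow> \<F> V = cl V (\<I> V))" "opn U" for \<F> U
      using unique[of \<F> U] that by simp
  qed
qed

end
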